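(* Let $\mathcal{A}$ be a finite-dimensional Hopf algebra over a field $k$ with dual Hopf algebra $\mathcal{H}=\mathcal{A}^*$, let $\{E_i\}$ be a basis of $\mathcal{H}$ and $\{F^i\}$ the dual basis of $\mathcal{A}$. Let $W$ be a finite-dimensional left $\mathcal{H}$-crossed module with action $\triangleright$ and left coaction $w\mapsto\sum w^{(\bar 1)}\otimes w^{(\bar\infty)}\in\mathcal{H}\otimes W$, let $\{e_\alpha\}$ be a basis of $W$ with dual basis $\{f^\alpha\}$, and write $e_\alpha{}^\beta=e_\alpha\otimes f^\beta\in W\otimes W^*=\mathrm{End}(W)$ and $\theta=\sum_\alpha e_\alpha{}^\alpha$. Then the corresponding calculus $\Omega^1(D^*(\mathcal{A}))=\mathrm{End}(W)\otimes D^*(\mathcal{A})$ on the quantum codouble $D^*(\mathcal{A})$ has the following differentials and relations, for all $a\in\mathcal{A}$ and $h\in\mathcal{H}$ (viewed in $D^*(\mathcal{A})$ as $1\otimes a$ and $h\otimes 1$): $$\mathrm{d}h=\sum (h_{(2)}\triangleright e_\beta{}^{(\bar\infty)}\otimes f^\beta)\,\mathrm{Ad}_{e_\beta{}^{(\bar 1)}}(h_{(1)})-\theta h,$$ $$\mathrm{d}a=\sum\langle \mathrm{Ad}_{F^i}(a_{(1)}),e_\beta{}^{(\bar 1)}\rangle\,(e_\beta{}^{(\bar\infty)}\otimes f^\beta)\,E_i\,a_{(2)}-\theta a,$$ $$h.e_\alpha{}^\beta=\sum (h_{(2)}\triangleright e_\alpha\otimes f^\gamma)\,\mathrm{Ad}_{e_\gamma{}^{(\bar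 1)}}(h_{(1)})\,\langle e_\gamma{}^{(\bar\infty)},f^\beta\rangle,$$ $$a.e_\alpha{}^\beta=\sum (e_\alpha\otimes f^\gamma)\,\langle\mathrm{Ad}_{F^i}(a_{(1)}),e_\gamma{}^{(\bar 1)}\rangle\,\langle e_\gamma{}^{(\bar\infty)},f^\beta\rangle\,E_i\,a_{(2)},$$ where repeated indices are summed and $\mathrm{Ad}$ is the right adjoint action, $\mathrm{Ad}_x(y)=\sum (Sx_{(1)})\,y\,x_{(2)}$ (in $\mathcal{A}$ or in $\mathcal{H}$).
   Context: Sweedler notation $\Delta x=\sum x_{(1)}\otimes x_{(2)}$ is used; $S$ is the antipode and $\langle\ ,\ \rangle$ denotes the duality pairings between $\mathcal{A}$ and $\mathcal{H}$ and between $W$ and $W^*$. Quantum double: $D(\mathcal{H})=\mathcal{A}^{op}\bowtie\mathcal{H}$ is $\mathcal{A}\otimes\mathcal{H}$ with the tensor product coalgebra structure, and product $$(a\otimes h)(b\otimes g)=\sum b_{(2)}a\otimes h_{(2)}g\,\langle Sh_{(1)},b_{(1)}\rangle\langle h_{(3)},b_{(3)}\rangle .$$ It contains $\mathcal{A}^{op}$ and $\mathcal{H}$ as $a\otimes1$ and $1\otimes h$, and is quasitriangular with $\mathcal{R}=\sum_i (F^i\otimes 1)\otimes(1\otimes E_i)$. Quantum codouble: $A=D^*(\mathcal{A})=\mathcal{H}^{cop}\blacktriangleright\!\!\blacktriangleleft\mathcal{A}$ is the Hopf algebra dual to $D(\mathcal{H})$ (pairing $\langle a\otimes h,\,g\otimes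 b\rangle=\langle a,g\rangle\langle h,b\rangle$ for $a\otimes h\in D(\mathcal{H})$ and $g\otimes b\in D^*(\mathcal{A})$). It is $\mathcal{H}\otimes\mathcal{A}$ with the tensor product algebra structure and coproduct $$\Delta(h\otimes a)=\sum h_{(2)}\otimes F^i a_{(1)}F^j\otimes (SE_i)h_{(1)}E_j\otimes a_{(2)} .$$ The coquasitriangular structure is $\mathcal{R}(h\otimes a,g\otimes b)=\epsilon(a)\epsilon(g)\langle h,b\rangle$. Left $\mathcal{H}$-crossed module: a vector space $W$ that is a left $\mathcal{H}$-module and a left $\mathcal{H}$-comodule with $$\sum (h_{(1)}\triangleright w)^{(\bar1)}h_{(2)}\otimes(h_{(1)}\triangleright w)^{(\bar\infty)}=\sum h_{(1)}w^{(\bar1)}\otimes h_{(2)}\triangleright w^{(\bar\infty)}$$ for all $h\in\mathcal{H}$, $w\in W$. It is the same thing as a left $D(\mathcal{H})$-module, with $h\in\mathcal{H}$ acting by $\triangleright$ and $a\in\mathcal{A}^{op}$ acting by $w\mapsto\sum\langle a,w^{(\bar1)}\rangle w^{(\bar\infty)}$. Let $\rho:D(\mathcal{H})\to\mathrm{End}(W)$ be this representation, with matrix entries $\rho(x)e_\beta=\sum_\alpha\rho(x)^\alpha{}_\beta e_\alpha$, so $\rho(x)=\sum\rho(x)^\alpha{}_\beta\,e_\alpha{}^\beta$. The calculus corresponding to $W$: for $x\in A=D^*(\mathcal{A})$ put $\mathcal{R}_1(x)=(x\otimes\mathrm{id})(\mathcal{R})$, $\mathcal{R}_2(x)=(\mathrm{id}\otimes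 x)(\mathcal{R})$, $\mathcal{Q}=\mathcal{R}_{21}\mathcal{R}$ and $\mathcal{Q}_2(x)=(\mathrm{id}\otimes x)(\mathcal{Q})$, all elements of $D(\mathcal{H})$. The calculus is $\Omega^1=\mathrm{End}(W)\otimes A$, with right $A$-action by right multiplication on the factor $A$ (and $\omega\otimes x$ written $\omega x$), left $A$-action and $\mathrm{d}$ determined by $$x.e_\alpha{}^\beta=\sum\rho(\mathcal{R}_1(x_{(1)}))^\gamma{}_\alpha\;e_\gamma{}^\delta\;\rho(\mathcal{R}_2(x_{(2)}))^\beta{}_\delta\;x_{(3)},\qquad \mathrm{d}x=\sum\rho(\mathcal{Q}_2(x_{(1)}))\,x_{(2)}-\theta x,\qquad x\in A.$$ *)

theory Defs
  imports Complex_Main "HOL-Library.Function_Algebras"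
begin

section \<open>Vector spaces, dual spaces and tensor products\<close>

text \<open>
  Duals, tensor products and endomorphism spaces depend on the scalar action, so they cannot be
  types of their own.  A vector space is therefore a scalar action on a whole type together with
  a subspace of that type; addition is the one of the type.  On function types addition is
  pointwise.
\<close>

record ('k, 'v) vspace =
  carr :: "'v set"
  scal :: "'k \<Rightarrow> 'v \<Rightarrow> 'v"

definition vec_space :: "('k::field, 'v::ab_group_add, 'z) vspace_scheme \<Rightarrow> bool" where
  "vec_space V \<longleftrightarrow> vector_space (scal V) \<and> module.subspace (scal V) (carr V)"

definition fin_dim :: "('k::field, 'v::ab_group_add, 'z) vspace_scheme \<Rightarrow> bool" where
  "fin_dim V \<longleftrightarrow> (\<exists>B. finite B \<and> B \<subseteq> carr V \<and> module.span (scal V) B = carr V)"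

definition ground :: "('k::field, 'k) vspace" where
  "ground = \<lparr>carr = UNIV, scal = (*)\<rparr>"

definition lin :: "('k::field, 'v::ab_group_add, 'y) vspace_scheme
    \<Rightarrow> ('k, 'u::ab_group_add, 'z) vspace_scheme \<Rightarrow> ('v \<Rightarrow> 'u) \<Rightarrow> bool" where
  "lin V U f \<longleftrightarrow>
     (\<forall>x\<in>carr V. f x \<in> carr U) \<and>
     (\<forall>x\<in>carr V. \<forall>y\<in>carr V. f (x + y) = f x + f y) \<and>
     (\<forall>c. \<forall>x\<in>carr V. f (scal V c x) = scal U c (f x))"

definition bilin :: "('k::field, 'v::ab_group_add, 'x) vspace_scheme
    \<Rightarrow> ('k, 'w::ab_group_add, 'y) vspace_scheme
    \<Rightarrow> ('k, 'u::ab_group_add, 'z) vspace_scheme \<Rightarrow> ('v \<Rightarrow> 'w \<Rightarrow> 'u) \<Rightarrow> bool" where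
  "bilin V W U f \<longleftrightarrow>
     (\<forall>w\<in>carr W. lin V U (\<lambda>v. f v w)) \<and> (\<forall>v\<in>carr V. lin W U (f v))"

definition basis :: "('k::field, 'v::ab_group_add, 'z) vspace_scheme
    \<Rightarrow> 'i set \<Rightarrow> ('i \<Rightarrow> 'v) \<Rightarrow> bool" where
  "basis V I b \<longleftrightarrow> finite I \<and> b ` I \<subseteq> carr V \<and> inj_on b I \<and>
     \<not> module.dependent (scal V) (b ` I) \<and> module.span (scal V) (b ` I) = carr V"

definition fscal :: "'k::field \<Rightarrow> ('x \<Rightarrow> 'k) \<Rightarrow> 'x \<Rightarrow> 'k" where
  "fscal c f = (\<lambda>x. c * f x)"

text \<open>Maps on a carrier are made unique as functions by the value 0 outside the carrier.\<close>

definition on :: "('k, 'v, 'z) vspace_scheme \<Rightarrow> ('v \<Rightarrow> 'u::zero) \<Rightarrow> 'v \<Rightarrow> 'u" where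
  "on V f = (\<lambda>x. if x \<in> carr V then f x else 0)"

definition dual :: "('k::field, 'v::ab_group_add, 'z) vspace_scheme \<Rightarrow> ('k, 'v \<Rightarrow> 'k) vspace" where
  "dual V = \<lparr>carr = {f. lin V ground f \<and> (\<forall>x. x \<notin> carr V \<longrightarrow> f x = 0)}, scal = fscal\<rparr>"

definition dual_basis :: "('k::field, 'v::ab_group_add, 'z) vspace_scheme
    \<Rightarrow> 'i set \<Rightarrow> ('i \<Rightarrow> 'v) \<Rightarrow> ('i \<Rightarrow> 'v \<Rightarrow> 'k) \<Rightarrow> bool" where
  "dual_basis V I b b' \<longleftrightarrow> (\<forall>i\<in>I. b' i \<in> carr (dual V)) \<and>
     (\<forall>i\<in>I. \<forall>j\<in>I. b' i (b j) = (if i = j then 1 else 0))"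

text \<open>
  The space \<open>V \<otimes> W\<close> is realised inside the dual of the space of bilinear forms on \<open>V \<times> W\<close>:
  the pure tensor \<open>v \<otimes> w\<close> is evaluation at \<open>(v, w)\<close>, and \<open>V \<otimes> W\<close> is the span of the pure
  tensors.  Over a field this is the tensor product, because bilinear forms separate the
  elements of \<open>V \<otimes> W\<close>.
\<close>

type_synonym ('k, 'v, 'w) tens = "('v \<Rightarrow> 'w \<Rightarrow> 'k) \<Rightarrow> 'k"

definition tpure :: "('k::field, 'v::ab_group_add, 'y) vspace_scheme
    \<Rightarrow> ('k, 'w::ab_group_add, 'z) vspace_scheme \<Rightarrow> 'v \<Rightarrow> 'w \<Rightarrow> ('k, 'v, 'w) tens" where
  "tpure V W v w = (\<lambda>\<beta>. if bilin V W ground \<beta> then \<beta> v w else 0)"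

definition tensor :: "('k::field, 'v::ab_group_add, 'y) vspace_scheme
    \<Rightarrow> ('k, 'w::ab_group_add, 'z) vspace_scheme \<Rightarrow> ('k, ('k, 'v, 'w) tens) vspace" where
  "tensor V W =
     \<lparr>carr = module.span fscal {tpure V W v w | v w. v \<in> carr V \<and> w \<in> carr W}, scal = fscal\<rparr>"

text \<open>
  \<open>tlift V W f t\<close> is the sum of \<open>f v w\<close> over a representation of \<open>t\<close> as a finite sum of pure
  tensors \<open>v \<otimes> w\<close>.  It is only used with \<open>f\<close> bilinear, where it does not depend on the
  representation: it is the linear map on \<open>V \<otimes> W\<close> induced by \<open>f\<close>.
\<close>

definition trep :: "('k::field, 'v::ab_group_add, 'y) vspace_scheme
    \<Rightarrow> ('k, 'w::ab_group_add, 'z) vspace_scheme \<Rightarrow> ('k, 'v, 'w) tens \<Rightarrow> ('v \<times> 'w) list" where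
  "trep V W t = (SOME ps. set ps \<subseteq> carr V \<times> carr W \<and> t = (\<Sum>(v, w)\<leftarrow>ps. tpure V W v w))"

definition tlift :: "('k::field, 'v::ab_group_add, 'y) vspace_scheme
    \<Rightarrow> ('k, 'w::ab_group_add, 'z) vspace_scheme
    \<Rightarrow> ('v \<Rightarrow> 'w \<Rightarrow> 'u::ab_group_add) \<Rightarrow> ('k, 'v, 'w) tens \<Rightarrow> 'u" where
  "tlift V W f t = (\<Sum>(v, w)\<leftarrow>trep V W t. f v w)"


section \<open>Hopf algebras\<close>

record ('k, 'v) alg = "('k, 'v) vspace" +
  mult :: "'v \<Rightarrow> 'v \<Rightarrow> 'v"
  unity :: 'v

record ('k, 'v) bialg = "('k, 'v) alg" +
  comult :: "'v \<Rightarrow> ('k, 'v, 'v) tens"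
  counit :: "'v \<Rightarrow> 'k"

record ('k, 'v) hopf = "('k, 'v) bialg" +
  antipode :: "'v \<Rightarrow> 'v"

text \<open>
  Sweedler sums: \<open>swe2 C x f\<close> is the sum of \<open>f x(1) x(2)\<close> and \<open>swe3 C x f\<close> is the sum of
  \<open>f x(1) x(2) x(3)\<close>.
\<close>

definition swe2 :: "('k::field, 'v::ab_group_add, 'z) bialg_scheme
    \<Rightarrow> 'v \<Rightarrow> ('v \<Rightarrow> 'v \<Rightarrow> 'u::ab_group_add) \<Rightarrow> 'u" where
  "swe2 C x f = tlift C C f (comult C x)"

definition swe3 :: "('k::field, 'v::ab_group_add, 'z) bialg_scheme
    \<Rightarrow> 'v \<Rightarrow> ('v \<Rightarrow> 'v \<Rightarrow> 'v \<Rightarrow> 'u::ab_group_add) \<Rightarrow> 'u" where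
  "swe3 C x f = swe2 C x (\<lambda>x12 x3. swe2 C x12 (\<lambda>x1 x2. f x1 x2 x3))"

definition algebra :: "('k::field, 'v::ab_group_add, 'z) alg_scheme \<Rightarrow> bool" where
  "algebra A \<longleftrightarrow> vec_space A \<and> bilin A A A (mult A) \<and> unity A \<in> carr A \<and>
     (\<forall>x\<in>carr A. \<forall>y\<in>carr A. \<forall>z\<in>carr A. mult A (mult A x y) z = mult A x (mult A y z)) \<and>
     (\<forall>x\<in>carr A. mult A (unity A) x = x \<and> mult A x (unity A) = x)"

text \<open>Coassociativity is stated in \<open>C \<otimes> (C \<otimes> C)\<close>.\<close>

definition coalgebra :: "('k::field, 'v::ab_group_add, 'z) bialg_scheme \<Rightarrow> bool" where
  "coalgebra C \<longleftrightarrow> vec_space C \<and> lin C (tensor C C) (comult C) \<and> lin C ground (counit C) \<and>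
     (\<forall>x\<in>carr C.
        swe2 C x (\<lambda>x12 x3. swe2 C x12 (\<lambda>x1 x2. tpure C (tensor C C) x1 (tpure C C x2 x3))) =
        swe2 C x (\<lambda>x1 x23. tpure C (tensor C C) x1 (comult C x23))) \<and>
     (\<forall>x\<in>carr C. swe2 C x (\<lambda>x1 x2. scal C (counit C x1) x2) = x \<and>
                  swe2 C x (\<lambda>x1 x2. scal C (counit C x2) x1) = x)"

definition bialgebra :: "('k::field, 'v::ab_group_add, 'z) bialg_scheme \<Rightarrow> bool" where
  "bialgebra B \<longleftrightarrow> algebra B \<and> coalgebra B \<and>
     (\<forall>x\<in>carr B. \<forall>y\<in>carr B.
        comult B (mult B x y) =
          swe2 B x (\<lambda>x1 x2. swe2 B y (\<lambda>y1 y2. tpure B B (mult B x1 y1) (mult B x2 y2)))) \<and>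
     comult B (unity B) = tpure B B (unity B) (unity B) \<and>
     (\<forall>x\<in>carr B. \<forall>y\<in>carr B. counit B (mult B x y) = counit B x * counit B y) \<and>
     counit B (unity B) = 1"

definition hopf_algebra :: "('k::field, 'v::ab_group_add, 'z) hopf_scheme \<Rightarrow> bool" where
  "hopf_algebra H \<longleftrightarrow> bialgebra H \<and> lin H H (antipode H) \<and>
     (\<forall>x\<in>carr H.
        swe2 H x (\<lambda>x1 x2. mult H (antipode H x1) x2) = scal H (counit H x) (unity H) \<and>
        swe2 H x (\<lambda>x1 x2. mult H x1 (antipode H x2)) = scal H (counit H x) (unity H))"

definition Ad :: "('k::field, 'v::ab_group_add, 'z) hopf_scheme \<Rightarrow> 'v \<Rightarrow> 'v \<Rightarrow> 'v" where
  "Ad H x y = swe2 H x (\<lambda>x1 x2. mult H (mult H (antipode H x1) y) x2)"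

text \<open>
  The dual Hopf algebra of a finite-dimensional Hopf algebra.  The pairing
  \<open>\<langle>a, h\<rangle> = \<langle>h, a\<rangle>\<close> is written \<open>h a\<close>.  The coproduct of \<open>h\<close> is the element of \<open>A\<^sup>* \<otimes> A\<^sup>*\<close>
  corresponding to the form \<open>(a, b) \<mapsto> h (a b)\<close>; it exists and is unique for finite-dimensional
  \<open>A\<close>.
\<close>

definition dual_hopf :: "('k::field, 'v::ab_group_add, 'z) hopf_scheme \<Rightarrow> ('k, 'v \<Rightarrow> 'k) hopf" where
  "dual_hopf A =
     \<lparr>carr = carr (dual A), scal = fscal,
      mult = (\<lambda>h g. on A (\<lambda>a. swe2 A a (\<lambda>a1 a2. h a1 * g a2))),
      unity = on A (counit A),
      comult = (\<lambda>h. THE t. t \<in> carr (tensor (dual A) (dual A)) \<and>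
        (\<forall>a\<in>carr A. \<forall>b\<in>carr A.
           tlift (dual A) (dual A) (\<lambda>h1 h2. h1 a * h2 b) t = h (mult A a b))),
      counit = (\<lambda>h. h (unity A)),
      antipode = (\<lambda>h. on A (\<lambda>a. h (antipode A a)))\<rparr>"

definition tensor_mult :: "('k::field, 'v::ab_group_add, 'y) alg_scheme
    \<Rightarrow> ('k, 'w::ab_group_add, 'z) alg_scheme
    \<Rightarrow> ('k, 'v, 'w) tens \<Rightarrow> ('k, 'v, 'w) tens \<Rightarrow> ('k, 'v, 'w) tens" where
  "tensor_mult A B s t =
     tlift A B (\<lambda>a b. tlift A B (\<lambda>a' b'. tpure A B (mult A a a') (mult B b b')) t) s"


section \<open>Crossed modules\<close>

record ('k, 'h, 'w) crossed = "('k, 'w) vspace" +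
  act :: "'h \<Rightarrow> 'w \<Rightarrow> 'w"
  coact :: "'w \<Rightarrow> ('k, 'h, 'w) tens"

text \<open>\<open>sweW H W w f\<close> is the Sweedler sum of \<open>f u v\<close> over the coaction \<open>w \<mapsto> \<Sum> u \<otimes> v\<close>.\<close>

definition sweW :: "('k::field, 'h::ab_group_add, 'y) hopf_scheme
    \<Rightarrow> ('k, 'h, 'w::ab_group_add, 'z) crossed_scheme
    \<Rightarrow> 'w \<Rightarrow> ('h \<Rightarrow> 'w \<Rightarrow> 'u::ab_group_add) \<Rightarrow> 'u" where
  "sweW H W w f = tlift H W f (coact W w)"

definition left_module :: "('k::field, 'h::ab_group_add, 'y) hopf_scheme
    \<Rightarrow> ('k, 'h, 'w::ab_group_add, 'z) crossed_scheme \<Rightarrow> bool" where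
  "left_module H W \<longleftrightarrow> vec_space W \<and> bilin H W W (act W) \<and>
     (\<forall>w\<in>carr W. act W (unity H) w = w) \<and>
     (\<forall>h\<in>carr H. \<forall>g\<in>carr H. \<forall>w\<in>carr W. act W (mult H h g) w = act W h (act W g w))"

definition left_comodule :: "('k::field, 'h::ab_group_add, 'y) hopf_scheme
    \<Rightarrow> ('k, 'h, 'w::ab_group_add, 'z) crossed_scheme \<Rightarrow> bool" where
  "left_comodule H W \<longleftrightarrow> vec_space W \<and> lin W (tensor H W) (coact W) \<and>
     (\<forall>w\<in>carr W.
        sweW H W w (\<lambda>u v. swe2 H u (\<lambda>u1 u2. tpure H (tensor H W) u1 (tpure H W u2 v))) =
        sweW H W w (\<lambda>u v. tpure H (tensor H W) u (coact W v))) \<and>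
     (\<forall>w\<in>carr W. sweW H W w (\<lambda>u v. scal W (counit H u) v) = w)"

definition crossed_module :: "('k::field, 'h::ab_group_add, 'y) hopf_scheme
    \<Rightarrow> ('k, 'h, 'w::ab_group_add, 'z) crossed_scheme \<Rightarrow> bool" where
  "crossed_module H W \<longleftrightarrow> left_module H W \<and> left_comodule H W \<and>
     (\<forall>h\<in>carr H. \<forall>w\<in>carr W.
        swe2 H h (\<lambda>h1 h2. sweW H W (act W h1 w) (\<lambda>u v. tpure H W (mult H u h2) v)) =
        swe2 H h (\<lambda>h1 h2. sweW H W w (\<lambda>u v. tpure H W (mult H h1 u) (act W h2 v))))"

definition endo :: "('k::field, 'w::ab_group_add, 'z) vspace_scheme \<Rightarrow> ('k, 'w \<Rightarrow> 'w) vspace" where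
  "endo W = \<lparr>carr = {\<phi>. lin W W \<phi> \<and> (\<forall>w. w \<notin> carr W \<longrightarrow> \<phi> w = 0)},
             scal = (\<lambda>c \<phi> w. scal W c (\<phi> w))\<rparr>"

text \<open>The element \<open>w \<otimes> f\<close> of \<open>W \<otimes> W\<^sup>* = End(W)\<close>.\<close>

definition rank1 :: "('k, 'w, 'z) vspace_scheme \<Rightarrow> 'w \<Rightarrow> ('w \<Rightarrow> 'k) \<Rightarrow> 'w \<Rightarrow> 'w" where
  "rank1 W w f = (\<lambda>v. scal W (f v) w)"


section \<open>The quantum double and codouble\<close>

text \<open>Antipodes of the double and codouble are not needed below and are left out.\<close>

definition double :: "('k::field, 'a::ab_group_add) hopf \<Rightarrow> ('k, ('k, 'a, 'a \<Rightarrow> 'k) tens) bialg" where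
  "double A = (let H = dual_hopf A; X = tensor A H in
     \<lparr>carr = carr X, scal = scal X,
      mult = (\<lambda>s t. tlift A H (\<lambda>a h. tlift A H (\<lambda>b g.
        swe3 A b (\<lambda>b1 b2 b3. swe3 H h (\<lambda>h1 h2 h3.
          fscal ((antipode H h1) b1 * h3 b3) (tpure A H (mult A b2 a) (mult H h2 g))))) t) s),
      unity = tpure A H (unity A) (unity H),
      comult = tlift A H (\<lambda>a h. swe2 A a (\<lambda>a1 a2. swe2 H h (\<lambda>h1 h2.
        tpure X X (tpure A H a1 h1) (tpure A H a2 h2)))),
      counit = tlift A H (\<lambda>a h. counit A a * counit H h)\<rparr>)"

text \<open>\<open>E\<close> is a basis of the dual of \<open>A\<close> and \<open>F\<close> the dual basis of \<open>A\<close>, both indexed by \<open>I\<close>.\<close>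

definition codouble :: "('k::field, 'a::ab_group_add) hopf
    \<Rightarrow> 'i set \<Rightarrow> ('i \<Rightarrow> 'a \<Rightarrow> 'k) \<Rightarrow> ('i \<Rightarrow> 'a) \<Rightarrow> ('k, ('k, 'a \<Rightarrow> 'k, 'a) tens) bialg" where
  "codouble A I E F = (let H = dual_hopf A; X = tensor H A in
     \<lparr>carr = carr X, scal = scal X,
      mult = tensor_mult H A,
      unity = tpure H A (unity H) (unity A),
      comult = tlift H A (\<lambda>h a. swe2 H h (\<lambda>h1 h2. swe2 A a (\<lambda>a1 a2.
        \<Sum>i\<in>I. \<Sum>j\<in>I. tpure X X
          (tpure H A h2 (mult A (mult A (F i) a1) (F j)))
          (tpure H A (mult H (mult H (antipode H (E i)) h1) (E j)) a2)))),
      counit = tlift H A (\<lambda>h a. counit H h * counit A a)\<rparr>)"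

definition codouble_H :: "('k::field, 'a::ab_group_add) hopf
    \<Rightarrow> ('a \<Rightarrow> 'k) \<Rightarrow> ('k, 'a \<Rightarrow> 'k, 'a) tens" where
  "codouble_H A h = tpure (dual_hopf A) A h (unity A)"

definition codouble_A :: "('k::field, 'a::ab_group_add) hopf
    \<Rightarrow> 'a \<Rightarrow> ('k, 'a \<Rightarrow> 'k, 'a) tens" where
  "codouble_A A a = tpure (dual_hopf A) A (unity (dual_hopf A)) a"

definition dpair :: "('k::field, 'a::ab_group_add) hopf
    \<Rightarrow> ('k, 'a, 'a \<Rightarrow> 'k) tens \<Rightarrow> ('k, 'a \<Rightarrow> 'k, 'a) tens \<Rightarrow> 'k" where
  "dpair A u x = (let H = dual_hopf A in
     tlift A H (\<lambda>a h. tlift H A (\<lambda>g b. g a * h b) x) u)"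

definition Rmat :: "('k::field, 'a::ab_group_add) hopf
    \<Rightarrow> 'i set \<Rightarrow> ('i \<Rightarrow> 'a \<Rightarrow> 'k) \<Rightarrow> ('i \<Rightarrow> 'a)
    \<Rightarrow> ('k, ('k, 'a, 'a \<Rightarrow> 'k) tens, ('k, 'a, 'a \<Rightarrow> 'k) tens) tens" where
  "Rmat A I E F = (let H = dual_hopf A; D = double A in
     \<Sum>i\<in>I. tpure D D (tpure A H (F i) (unity H)) (tpure A H (unity A) (E i)))"

definition Qmat :: "('k::field, 'a::ab_group_add) hopf
    \<Rightarrow> 'i set \<Rightarrow> ('i \<Rightarrow> 'a \<Rightarrow> 'k) \<Rightarrow> ('i \<Rightarrow> 'a)
    \<Rightarrow> ('k, ('k, 'a, 'a \<Rightarrow> 'k) tens, ('k, 'a, 'a \<Rightarrow> 'k) tens) tens" where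
  "Qmat A I E F = (let D = double A; R = Rmat A I E F in
     tensor_mult D D (tlift D D (\<lambda>u v. tpure D D v u) R) R)"

text \<open>For \<open>T\<close> in the tensor square of the double: \<open>(x \<otimes> id)(T)\<close> and \<open>(id \<otimes> x)(T)\<close>.\<close>

definition slice1 :: "('k::field, 'a::ab_group_add) hopf
    \<Rightarrow> ('k, ('k, 'a, 'a \<Rightarrow> 'k) tens, ('k, 'a, 'a \<Rightarrow> 'k) tens) tens
    \<Rightarrow> ('k, 'a \<Rightarrow> 'k, 'a) tens \<Rightarrow> ('k, 'a, 'a \<Rightarrow> 'k) tens" where
  "slice1 A T x = tlift (double A) (double A) (\<lambda>u v. fscal (dpair A u x) v) T"

definition slice2 :: "('k::field, 'a::ab_group_add) hopf
    \<Rightarrow> ('k, ('k, 'a, 'a \<Rightarrow> 'k) tens, ('k, 'a, 'a \<Rightarrow> 'k) tens) tens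
    \<Rightarrow> ('k, 'a \<Rightarrow> 'k, 'a) tens \<Rightarrow> ('k, 'a, 'a \<Rightarrow> 'k) tens" where
  "slice2 A T x = tlift (double A) (double A) (\<lambda>u v. fscal (dpair A v x) u) T"

text \<open>
  The representation of the double on a crossed module.  Since \<open>a \<otimes> h = (a \<otimes> 1)(1 \<otimes> h)\<close>, the
  element \<open>a \<otimes> h\<close> acts by \<open>h\<close> first and then by \<open>a\<close> through the coaction.
\<close>

definition rep :: "('k::field, 'a::ab_group_add) hopf
    \<Rightarrow> ('k, 'a \<Rightarrow> 'k, 'w::ab_group_add) crossed \<Rightarrow> ('k, 'a, 'a \<Rightarrow> 'k) tens \<Rightarrow> 'w \<Rightarrow> 'w" where
  "rep A W x = (let H = dual_hopf A in
     on W (\<lambda>w. tlift A H (\<lambda>a h. sweW H W (act W h w) (\<lambda>u v. scal W (u a) v)) x))"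


section \<open>The differential calculus of a crossed module\<close>

text \<open>
  The parameters are \<open>A\<close>; the dual bases \<open>E\<close>, \<open>F\<close> indexed by \<open>I\<close>; the crossed module \<open>W\<close>; and
  its basis \<open>e\<close> with dual basis \<open>f\<close>, indexed by \<open>J\<close>.  The space of one-forms is
  \<open>tensor (endo W) (codouble A I E F)\<close>; \<open>form\<close> gives its pure tensors.
\<close>

definition form :: "('k::field, 'a::ab_group_add) hopf
    \<Rightarrow> 'i set \<Rightarrow> ('i \<Rightarrow> 'a \<Rightarrow> 'k) \<Rightarrow> ('i \<Rightarrow> 'a)
    \<Rightarrow> ('k, 'a \<Rightarrow> 'k, 'w::ab_group_add) crossed
    \<Rightarrow> ('w \<Rightarrow> 'w) \<Rightarrow> ('k, 'a \<Rightarrow> 'k, 'a) tens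
    \<Rightarrow> ('k, 'w \<Rightarrow> 'w, ('k, 'a \<Rightarrow> 'k, 'a) tens) tens" where
  "form A I E F W \<phi> x = tpure (endo W) (codouble A I E F) \<phi> x"

definition right_act :: "('k::field, 'a::ab_group_add) hopf
    \<Rightarrow> 'i set \<Rightarrow> ('i \<Rightarrow> 'a \<Rightarrow> 'k) \<Rightarrow> ('i \<Rightarrow> 'a)
    \<Rightarrow> ('k, 'a \<Rightarrow> 'k, 'w::ab_group_add) crossed
    \<Rightarrow> ('k, 'w \<Rightarrow> 'w, ('k, 'a \<Rightarrow> 'k, 'a) tens) tens \<Rightarrow> ('k, 'a \<Rightarrow> 'k, 'a) tens
    \<Rightarrow> ('k, 'w \<Rightarrow> 'w, ('k, 'a \<Rightarrow> 'k, 'a) tens) tens" where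
  "right_act A I E F W \<omega> x = (let C = codouble A I E F in
     tlift (endo W) C (\<lambda>\<phi> y. form A I E F W \<phi> (mult C y x)) \<omega>)"

definition entry :: "('j \<Rightarrow> 'w) \<Rightarrow> ('j \<Rightarrow> 'w \<Rightarrow> 'k) \<Rightarrow> ('w \<Rightarrow> 'w) \<Rightarrow> 'j \<Rightarrow> 'j \<Rightarrow> 'k" where
  "entry e f \<phi> \<alpha> \<beta> = f \<alpha> (\<phi> (e \<beta>))"

text \<open>The product \<open>x . e\<^sub>\<alpha>\<^sup>\<beta>\<close>, and its extension to a left action commuting with the right one.\<close>

definition left_act_basis :: "('k::field, 'a::ab_group_add) hopf
    \<Rightarrow> 'i set \<Rightarrow> ('i \<Rightarrow> 'a \<Rightarrow> 'k) \<Rightarrow> ('i \<Rightarrow> 'a)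
    \<Rightarrow> ('k, 'a \<Rightarrow> 'k, 'w::ab_group_add) crossed \<Rightarrow> 'j set \<Rightarrow> ('j \<Rightarrow> 'w) \<Rightarrow> ('j \<Rightarrow> 'w \<Rightarrow> 'k)
    \<Rightarrow> ('k, 'a \<Rightarrow> 'k, 'a) tens \<Rightarrow> 'j \<Rightarrow> 'j
    \<Rightarrow> ('k, 'w \<Rightarrow> 'w, ('k, 'a \<Rightarrow> 'k, 'a) tens) tens" where
  "left_act_basis A I E F W J e f x \<alpha> \<beta> =
     (let R = Rmat A I E F in
      swe3 (codouble A I E F) x (\<lambda>x1 x2 x3. \<Sum>\<gamma>\<in>J. \<Sum>\<delta>\<in>J.
        fscal (entry e f (rep A W (slice1 A R x1)) \<gamma> \<alpha> * entry e f (rep A W (slice2 A R x2)) \<beta> \<delta>)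
          (form A I E F W (rank1 W (e \<gamma>) (f \<delta>)) x3)))"

definition left_act :: "('k::field, 'a::ab_group_add) hopf
    \<Rightarrow> 'i set \<Rightarrow> ('i \<Rightarrow> 'a \<Rightarrow> 'k) \<Rightarrow> ('i \<Rightarrow> 'a)
    \<Rightarrow> ('k, 'a \<Rightarrow> 'k, 'w::ab_group_add) crossed \<Rightarrow> 'j set \<Rightarrow> ('j \<Rightarrow> 'w) \<Rightarrow> ('j \<Rightarrow> 'w \<Rightarrow> 'k)
    \<Rightarrow> ('k, 'a \<Rightarrow> 'k, 'a) tens \<Rightarrow> ('k, 'w \<Rightarrow> 'w, ('k, 'a \<Rightarrow> 'k, 'a) tens) tens
    \<Rightarrow> ('k, 'w \<Rightarrow> 'w, ('k, 'a \<Rightarrow> 'k, 'a) tens) tens" where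
  "left_act A I E F W J e f x \<omega> =
     tlift (endo W) (codouble A I E F)
       (\<lambda>\<phi> y. \<Sum>\<alpha>\<in>J. \<Sum>\<beta>\<in>J.
          fscal (entry e f \<phi> \<alpha> \<beta>)
            (right_act A I E F W (left_act_basis A I E F W J e f x \<alpha> \<beta>) y)) \<omega>"

definition theta :: "('k, 'w::ab_group_add, 'z) vspace_scheme
    \<Rightarrow> 'j set \<Rightarrow> ('j \<Rightarrow> 'w) \<Rightarrow> ('j \<Rightarrow> 'w \<Rightarrow> 'k) \<Rightarrow> 'w \<Rightarrow> 'w" where
  "theta W J e f = (\<Sum>\<alpha>\<in>J. rank1 W (e \<alpha>) (f \<alpha>))"

definition diff :: "('k::field, 'a::ab_group_add) hopf
    \<Rightarrow> 'i set \<Rightarrow> ('i \<Rightarrow> 'a \<Rightarrow> 'k) \<Rightarrow> ('i \<Rightarrow> 'a)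
    \<Rightarrow> ('k, 'a \<Rightarrow> 'k, 'w::ab_group_add) crossed \<Rightarrow> 'j set \<Rightarrow> ('j \<Rightarrow> 'w) \<Rightarrow> ('j \<Rightarrow> 'w \<Rightarrow> 'k)
    \<Rightarrow> ('k, 'a \<Rightarrow> 'k, 'a) tens \<Rightarrow> ('k, 'w \<Rightarrow> 'w, ('k, 'a \<Rightarrow> 'k, 'a) tens) tens" where
  "diff A I E F W J e f x =
     swe2 (codouble A I E F) x
       (\<lambda>x1 x2. form A I E F W (rep A W (slice2 A (Qmat A I E F) x1)) x2)
     - form A I E F W (theta W J e f) x"

end

theory Submission
  imports Defs
begin

text \<open>
  A one-form is an endomorphism of \<open>W\<close> times an element of the codouble.  Both the differential and
  the left action arise from the coproduct of \<open>x\<close> by applying \<open>\<rho>\<close> to slices of \<open>\<Q>\<close> or \<open>\<R>\<close> at the leading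
  factors and keeping the last factor.  So it is enough to know the endomorphisms that belong to a
  pure tensor \<open>g \<otimes> b\<close>, and then to sum over the coproduct of the codouble.

  The slices are contractions of dual bases: \<open>\<R>\<^sub>1(g \<otimes> b) = \<epsilon>(b) (1 \<otimes> g)\<close>, \<open>\<R>\<^sub>2(g \<otimes> b) = \<epsilon>(g) (b \<otimes> 1)\<close> and
  \<open>\<Q>\<^sub>2(g \<otimes> b) = (1 \<otimes> g)(b \<otimes> 1)\<close> (lemmas \<open>slice1_R\<close>, \<open>slice2_R\<close>, \<open>slice2_Q\<close>).  The last product acts on \<open>W\<close>
  by the coaction paired with \<open>b\<close>, followed by \<open>g\<close>; this is where the crossed module condition is used,
  together with the antipode axiom of \<open>H\<close> (lemma \<open>rep_slice2_Q\<close>).  For the left action, the counits in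
  the first two slices make the coproduct of \<open>g \<otimes> b\<close> collapse (lemma \<open>swe2_codouble_collapse\<close>): the
  endomorphism is \<open>e\<^sub>\<alpha>\<^sup>\<beta>\<close> with \<open>g\<close> applied to \<open>e\<^sub>\<alpha>\<close> and \<open>b\<close> applied, transposed, to \<open>f\<^sup>\<beta>\<close>.

  It remains to sum.  For \<open>h \<otimes> 1\<close> the coproduct is \<open>\<Sum> h\<^sub>(\<^sub>2\<^sub>) \<otimes> F\<^sub>i F\<^sub>j \<otimes> (S E\<^sub>i) h\<^sub>(\<^sub>1\<^sub>) E\<^sub>j \<otimes> 1\<close>, and the factor
  \<open>F\<^sub>i F\<^sub>j\<close> is paired with the coaction component \<open>u\<close>.  As \<open>\<Sum> u(F\<^sub>i F\<^sub>j) E\<^sub>i \<otimes> E\<^sub>j\<close> is the coproduct of \<open>u\<close>,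
  the sum is \<open>Ad\<^sub>u(h\<^sub>(\<^sub>1\<^sub>))\<close>.  For \<open>1 \<otimes> a\<close> the sum is \<open>\<Sum> u(F\<^sub>i a\<^sub>(\<^sub>1\<^sub>) F\<^sub>j) (S E\<^sub>i) E\<^sub>j\<close>, the functional
  \<open>b \<mapsto> u(Ad\<^sub>b(a\<^sub>(\<^sub>1\<^sub>)))\<close> on \<open>A\<close>, which expands as \<open>\<Sum> u(Ad\<^bsub>F\<^sub>i\<^esub>(a\<^sub>(\<^sub>1\<^sub>))) E\<^sub>i\<close> (lemma \<open>Ad_A_dual\<close>).

  Sweedler sums are finite sums over a chosen representation of a tensor.  They may be rearranged freely
  as long as the tensor stays the same, and replacing a tensor by an equal expression requires the
  summand to be bilinear; hence the many lemmas on linearity.  The Hopf algebra identities of \<open>H\<close> are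
  obtained from those of \<open>A\<close>, by evaluation or in coordinates.
\<close>

section \<open>Linear and bilinear maps\<close>

lemma ground_simps [simp]: "carr ground = UNIV" "scal ground = (*)"
  by (simp_all add: ground_def)

lemma vec_space_ground: "vec_space (ground :: ('k::field, 'k) vspace)"
proof -
  interpret vector_space "(*) :: 'k \<Rightarrow> 'k \<Rightarrow> 'k"
    by unfold_locales (auto simp: algebra_simps)
  show ?thesis
    unfolding vec_space_def by (simp add: vector_space_axioms)
qed

lemma vector_space_fscal: "vector_space (fscal :: 'k::field \<Rightarrow> ('x \<Rightarrow> 'k) \<Rightarrow> 'x \<Rightarrow> 'k)"
  by unfold_locales (auto simp: fscal_def algebra_simps plus_fun_def)

lemma vec_spaceD:
  assumes "vec_space V"
  shows "vector_space (scal V)"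
    and "0 \<in> carr V"
    and "\<And>x y. x \<in> carr V \<Longrightarrow> y \<in> carr V \<Longrightarrow> x + y \<in> carr V"
    and "\<And>c x. x \<in> carr V \<Longrightarrow> scal V c x \<in> carr V"
proof -
  interpret vector_space "scal V" using assms by (simp add: vec_space_def)
  have sub: "subspace (carr V)" using assms by (simp add: vec_space_def)
  show "vector_space (scal V)" by (rule vector_space_axioms)
  show "0 \<in> carr V" "\<And>x y. x \<in> carr V \<Longrightarrow> y \<in> carr V \<Longrightarrow> x + y \<in> carr V"
    "\<And>c x. x \<in> carr V \<Longrightarrow> scal V c x \<in> carr V"
    using sub by (auto intro: subspace_0 subspace_add subspace_scale)
qed

lemma vec_space_diff:
  assumes "vec_space V" "x \<in> carr V" "y \<in> carr V"
  shows "x - y \<in> carr V"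
proof -
  interpret vector_space "scal V" using assms(1) by (rule vec_spaceD)
  have "subspace (carr V)" using assms(1) by (simp add: vec_space_def)
  then show ?thesis using assms(2,3) by (rule subspace_diff)
qed

lemma vec_space_sum:
  assumes "vec_space V" "\<And>i. i \<in> S \<Longrightarrow> x i \<in> carr V"
  shows "sum x S \<in> carr V"
  using assms(2)
  by (induction S rule: infinite_finite_induct) (auto intro: vec_spaceD[OF assms(1)])

lemma scal_add_right: "vec_space V \<Longrightarrow> scal V c (x + y) = scal V c x + scal V c y"
  and scal_add_left: "vec_space V \<Longrightarrow> scal V (c + d) x = scal V c x + scal V d x"
  and scal_scal: "vec_space V \<Longrightarrow> scal V c (scal V d x) = scal V (c * d) x"
  and scal_one: "vec_space V \<Longrightarrow> scal V 1 x = x"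
  and scal_zero_left: "vec_space V \<Longrightarrow> scal V 0 x = 0"
  and scal_zero_right: "vec_space V \<Longrightarrow> scal V c 0 = 0"
proof -
  assume "vec_space V"
  then interpret vector_space "scal V" by (rule vec_spaceD)
  show "scal V c (x + y) = scal V c x + scal V c y" by (rule scale_right_distrib)
  show "scal V (c + d) x = scal V c x + scal V d x" by (rule scale_left_distrib)
  show "scal V c (scal V d x) = scal V (c * d) x" by simp
  show "scal V 1 x = x" by simp
  show "scal V 0 x = 0" by simp
  show "scal V c 0 = 0" by simp
qed

lemma scal_sum_right: "vec_space V \<Longrightarrow> scal V c (sum x S) = (\<Sum>i\<in>S. scal V c (x i))"
  by (induction S rule: infinite_finite_induct) (auto simp: scal_zero_right scal_add_right)

lemma scal_sum_left: "vec_space V \<Longrightarrow> scal V (sum c S) x = (\<Sum>i\<in>S. scal V (c i) x)"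
  by (induction S rule: infinite_finite_induct) (auto simp: scal_zero_left scal_add_left)

lemma sum_fun_apply: "(\<Sum>i\<in>S. g i) x = (\<Sum>i\<in>S. g i x)"
  for g :: "'i \<Rightarrow> 'x \<Rightarrow> 'u::comm_monoid_add"
  by (induction S rule: infinite_finite_induct) (auto simp: plus_fun_def zero_fun_def)

lemma sum_list_fun_apply: "(\<Sum>p\<leftarrow>ps. g p) x = (\<Sum>p\<leftarrow>ps. g p x)"
  for g :: "'i \<Rightarrow> 'x \<Rightarrow> 'u::comm_monoid_add"
  by (induction ps) (auto simp: plus_fun_def zero_fun_def)

lemma fscal_1: "fscal 1 t = t"
  and fscal_fscal: "fscal c (fscal d t) = fscal (c * d) t"
  and fscal_sum: "fscal c (sum x S) = (\<Sum>i\<in>S. fscal c (x i))"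
  by (simp_all add: fscal_def mult.assoc sum_fun_apply sum_distrib_left fun_eq_iff)

lemma linD:
  assumes "lin V U f"
  shows "\<And>x. x \<in> carr V \<Longrightarrow> f x \<in> carr U"
    and "\<And>x y. x \<in> carr V \<Longrightarrow> y \<in> carr V \<Longrightarrow> f (x + y) = f x + f y"
    and "\<And>c x. x \<in> carr V \<Longrightarrow> f (scal V c x) = scal U c (f x)"
  using assms by (auto simp: lin_def)

lemma lin_0: "lin V U f \<Longrightarrow> vec_space V \<Longrightarrow> f 0 = 0"
  using linD(2)[of V U f 0 0] vec_spaceD(2)[of V] by auto

lemma lin_apply_sum:
  assumes "lin V U f" "vec_space V" "\<And>i. i \<in> S \<Longrightarrow> x i \<in> carr V"
  shows "f (sum x S) = (\<Sum>i\<in>S. f (x i))"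
  using assms(3)
  by (induction S rule: infinite_finite_induct)
     (auto simp: lin_0[OF assms(1,2)] linD(2)[OF assms(1)] vec_space_sum[OF assms(2)])

lemma lin_apply_sum2:
  assumes "lin V U f" "vec_space V" "\<And>i j. i \<in> S \<Longrightarrow> j \<in> T \<Longrightarrow> x i j \<in> carr V"
  shows "f (\<Sum>i\<in>S. \<Sum>j\<in>T. x i j) = (\<Sum>i\<in>S. \<Sum>j\<in>T. f (x i j))"
  using assms(3)
  by (subst lin_apply_sum[OF assms(1,2)])
    (auto intro!: sum.cong lin_apply_sum[OF assms(1,2)] vec_space_sum[OF assms(2)])

lemma lin_apply_sum_list:
  assumes "lin V U f" "vec_space V" "set ps \<subseteq> P" "\<And>p. p \<in> P \<Longrightarrow> x p \<in> carr V"
  shows "f (\<Sum>p\<leftarrow>ps. x p) = (\<Sum>p\<leftarrow>ps. f (x p)) \<and> (\<Sum>p\<leftarrow>ps. x p) \<in> carr V"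
  using assms(3)
  by (induction ps)
     (auto simp: lin_0[OF assms(1,2)] linD(2)[OF assms(1)] assms(4) intro: vec_spaceD[OF assms(2)])

lemma bilinI:
  assumes "\<And>w. w \<in> carr W \<Longrightarrow> lin V U (\<lambda>v. f v w)" "\<And>v. v \<in> carr V \<Longrightarrow> lin W U (\<lambda>w. f v w)"
  shows "bilin V W U f"
  using assms by (simp add: bilin_def)

lemma bilinD:
  assumes "bilin V W U f"
  shows "\<And>w. w \<in> carr W \<Longrightarrow> lin V U (\<lambda>v. f v w)" "\<And>v. v \<in> carr V \<Longrightarrow> lin W U (\<lambda>w. f v w)"
    and "\<And>v w. v \<in> carr V \<Longrightarrow> w \<in> carr W \<Longrightarrow> f v w \<in> carr U"
  using assms by (auto simp: bilin_def lin_def)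

lemma lin_id: "lin V V (\<lambda>x. x)"
  by (simp add: lin_def)

lemma lin_compose: "lin U Z g \<Longrightarrow> lin V U f \<Longrightarrow> lin V Z (\<lambda>x. g (f x))"
  by (simp add: lin_def)

lemma lin_bilin_left: "bilin P Q U b \<Longrightarrow> lin V P f \<Longrightarrow> q \<in> carr Q \<Longrightarrow> lin V U (\<lambda>x. b (f x) q)"
  using lin_compose[OF bilinD(1)] by blast

lemma lin_bilin_right: "bilin P Q U b \<Longrightarrow> p \<in> carr P \<Longrightarrow> lin V Q f \<Longrightarrow> lin V U (\<lambda>x. b p (f x))"
  using lin_compose[OF bilinD(2)] by blast

lemma lin_scal: "vec_space U \<Longrightarrow> lin V U f \<Longrightarrow> lin V U (\<lambda>x. scal U c (f x))"
  by (auto simp: lin_def scal_add_right scal_scal mult.commute intro: vec_spaceD)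

lemma lin_coeff: "vec_space U \<Longrightarrow> lin V ground f \<Longrightarrow> u \<in> carr U \<Longrightarrow> lin V U (\<lambda>x. scal U (f x) u)"
  by (auto simp: lin_def scal_add_left scal_scal intro: vec_spaceD)

lemma lin_times_left: "lin V ground f \<Longrightarrow> lin V ground (\<lambda>x. f x * c)"
  and lin_times_right: "lin V ground f \<Longrightarrow> lin V ground (\<lambda>x. c * f x)"
  by (auto simp: lin_def algebra_simps)

lemma lin_sum:
  assumes "vec_space U" "\<And>i. i \<in> S \<Longrightarrow> lin V U (f i)"
  shows "lin V U (\<lambda>x. \<Sum>i\<in>S. f i x)"
  using assms(2)
  by (auto simp: lin_def sum.distrib scal_sum_right[OF assms(1)] intro!: vec_space_sum[OF
      assms(1)] sum.cong)

lemma lin_cong: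
  assumes "vec_space V" "\<And>x. x \<in> carr V \<Longrightarrow> f x = g x"
  shows "lin V U f = lin V U g"
  using assms vec_spaceD(3,4)[OF assms(1)] by (auto simp: lin_def)

lemma basis_expansion:
  assumes V: "vec_space V" and b: "basis V I b"
    and f: "\<And>i. i \<in> I \<Longrightarrow> lin V ground (f i)"
      "\<And>i j. i \<in> I \<Longrightarrow> j \<in> I \<Longrightarrow> f i (b j) = (if i = j then 1 else 0)"
    and v: "v \<in> carr V"
  shows "v = (\<Sum>i\<in>I. scal V (f i v) (b i))"
proof -
  interpret vector_space "scal V" by (rule vec_spaceD(1)[OF V])
  have fin: "finite I" and mem: "\<And>i. i \<in> I \<Longrightarrow> b i \<in> carr V"
    and span: "v \<in> span (b ` I)" and inj: "inj_on b I"
    using b v by (auto simp: basis_def)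
  from span obtain u where "v = (\<Sum>x\<in>b ` I. scal V (u x) x)"
    using span_finite[of "b ` I"] fin by auto
  then have u: "v = (\<Sum>i\<in>I. scal V (u (b i)) (b i))"
    using inj by (simp add: sum.reindex)
  have "f j v = u (b j)" if j: "j \<in> I" for j
  proof -
    have "f j v = (\<Sum>i\<in>I. f j (scal V (u (b i)) (b i)))"
      unfolding u by (rule lin_apply_sum[OF f(1)[OF j] V]) (auto intro: vec_spaceD[OF V] mem)
    also have "\<dots> = (\<Sum>i\<in>I. if i = j then u (b i) else 0)"
      using linD(3)[OF f(1)[OF j] mem] f(2)[OF j] by (intro sum.cong) auto
    finally show ?thesis using j fin by (simp add: sum.delta)
  qed
  then have "(\<Sum>i\<in>I. scal V (u (b i)) (b i)) = (\<Sum>i\<in>I. scal V (f i v) (b i))" by simp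
  with u show ?thesis by (rule trans)
qed

section \<open>Tensor products and lifts of bilinear maps\<close>

text \<open>
  The codouble and \<open>H \<otimes> A\<close> are different records on the same space, and likewise for the double and
  for the dual space underlying \<open>H\<close>.  What is built from a vector space depends only on its carrier
  and its scalar action, so it may be transported between such records.
\<close>

lemma bilin_carr_cong:
  assumes "carr V = carr V'" "scal V = scal V'" "carr W = carr W'" "scal W = scal W'"
  shows "bilin V W U f = bilin V' W' U f"
  using assms by (simp add: bilin_def lin_def)

lemma tpure_carr_cong:
  assumes "carr V = carr V'" "scal V = scal V'" "carr W = carr W'" "scal W = scal W'"
  shows "tpure V W = tpure V' W'"
proof -
  have "bilin V W ground \<beta> = bilin V' W' ground \<beta>" for \<beta>
    by (rule bilin_carr_cong[OF assms])
  then show ?thesis by (simp add: tpure_def[abs_def])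
qed

lemma tensor_carr_cong:
  assumes "carr V = carr V'" "scal V = scal V'" "carr W = carr W'" "scal W = scal W'"
  shows "tensor V W = tensor V' W'"
  using tpure_carr_cong[OF assms] assms by (simp add: tensor_def)

lemma tlift_carr_cong:
  assumes "carr V = carr V'" "scal V = scal V'" "carr W = carr W'" "scal W = scal W'"
  shows "tlift V W = tlift V' W'"
  using tpure_carr_cong[OF assms] assms by (simp add: tlift_def[abs_def] trep_def[abs_def])

lemma tensor_scal [simp]: "scal (tensor V W) = fscal"
  by (simp add: tensor_def)

lemma vec_space_tensor:
  fixes V :: "('a::field, 'v::ab_group_add, 'y) vspace_scheme"
    and W :: "('a, 'w::ab_group_add, 'z) vspace_scheme"
  shows "vec_space (tensor V W)"
proof -
  interpret vector_space "fscal :: 'a \<Rightarrow> (('v \<Rightarrow> 'w \<Rightarrow> 'a) \<Rightarrow> 'a) \<Rightarrow> ('v \<Rightarrow> 'w \<Rightarrow> 'a) \<Rightarrow> 'a" by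
      (rule vector_space_fscal)
  show ?thesis by (simp add: vec_space_def tensor_def vector_space_fscal)
qed

lemma tpure_mem:
  fixes V :: "('a::field, 'v::ab_group_add, 'y) vspace_scheme"
    and W :: "('a, 'w::ab_group_add, 'z) vspace_scheme"
  shows "v \<in> carr V \<Longrightarrow> w \<in> carr W \<Longrightarrow> tpure V W v w \<in> carr (tensor V W)"
proof -
  interpret vector_space "fscal :: 'a \<Rightarrow> (('v \<Rightarrow> 'w \<Rightarrow> 'a) \<Rightarrow> 'a) \<Rightarrow> ('v \<Rightarrow> 'w \<Rightarrow> 'a) \<Rightarrow> 'a" by
      (rule vector_space_fscal)
  show "v \<in> carr V \<Longrightarrow> w \<in> carr W \<Longrightarrow> ?thesis"
    by (auto simp: tensor_def intro!: span_base)
qed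

lemma bilin_tpure: "bilin V W (tensor V W) (tpure V W)"
proof (rule bilinI)
  fix w assume w: "w \<in> carr W"
  show "lin V (tensor V W) (\<lambda>v. tpure V W v w)"
    using w linD(2,3)[OF bilinD(1), of V W ground _ w]
    by (auto simp: lin_def tpure_mem) (auto simp: tpure_def fscal_def plus_fun_def fun_eq_iff)
next
  fix v assume v: "v \<in> carr V"
  show "lin W (tensor V W) (tpure V W v)"
    using v linD(2,3)[OF bilinD(2), of V W ground _ v]
    by (auto simp: lin_def tpure_mem) (auto simp: tpure_def fscal_def plus_fun_def fun_eq_iff)
qed

text \<open>
  A scalar in front of a pure tensor can be absorbed in its first factor, so linear combinations of
  pure tensors are sums of pure tensors.
\<close>

lemma tensor_representation:
  fixes V :: "('a::field, 'v::ab_group_add, 'y) vspace_scheme"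
    and W :: "('a, 'w::ab_group_add, 'z) vspace_scheme"
  assumes "vec_space V" "t \<in> carr (tensor V W)"
  shows "\<exists>ps. set ps \<subseteq> carr V \<times> carr W \<and> t = (\<Sum>(v, w)\<leftarrow>ps. tpure V W v w)"
proof -
  interpret vector_space "fscal :: 'a \<Rightarrow> (('v \<Rightarrow> 'w \<Rightarrow> 'a) \<Rightarrow> 'a) \<Rightarrow> ('v \<Rightarrow> 'w \<Rightarrow> 'a) \<Rightarrow> 'a" by
      (rule vector_space_fscal)
  have "t \<in> span {tpure V W v w | v w. v \<in> carr V \<and> w \<in> carr W}"
    using assms(2) by (simp add: tensor_def)
  then show ?thesis
  proof (induction rule: span_induct_alt)
    case base
    show ?case by (intro exI[of _ "[]"]) simp
  next
    case (step c x y)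
    then obtain v w ps where *: "v \<in> carr V" "w \<in> carr W" "x = tpure V W v w"
      "set ps \<subseteq> carr V \<times> carr W" "y = (\<Sum>(v, w)\<leftarrow>ps. tpure V W v w)"
      by auto
    have "fscal c x = tpure V W (scal V c v) w"
      using linD(3)[OF bilinD(1)[OF bilin_tpure *(2)] *(1), of c] *(3) by simp
    then show ?case
      using * vec_spaceD(4)[OF assms(1)] by (intro exI[of _ "(scal V c v, w) # ps"]) auto
  qed
qed

lemma trep_props:
  assumes "vec_space V" "t \<in> carr (tensor V W)"
  shows "set (trep V W t) \<subseteq> carr V \<times> carr W" "t = (\<Sum>(v, w)\<leftarrow>trep V W t. tpure V W v w)"
  using someI_ex[OF tensor_representation[OF assms]] unfolding trep_def by auto

lemma separating_functional:
  fixes U :: "('a::field, 'u::ab_group_add, 'z) vspace_scheme"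
  assumes "vec_space U" "u \<noteq> 0"
  shows "\<exists>\<phi>. lin U ground \<phi> \<and> \<phi> u \<noteq> 0"
proof -
  interpret U: vector_space "scal U" using assms(1) by (rule vec_spaceD)
  interpret K: vector_space "(*) :: 'a \<Rightarrow> 'a \<Rightarrow> 'a"
    using vec_spaceD(1)[OF vec_space_ground] by simp
  interpret vector_space_pair "scal U" "(*)" ..
  have ind: "U.independent {u}" using assms(2) by simp
  interpret c: Vector_Spaces.linear "scal U" "(*)" "construct {u} (\<lambda>_. 1)"
    by (rule linear_construct[OF ind])
  show ?thesis
    using construct_basis[OF ind, of u "\<lambda>_. 1"]
    by (intro exI[of _ "construct {u} (\<lambda>_. 1)"]) (auto simp: lin_def c.add c.scale)
qed

text \<open>
  Tensors are compared through bilinear forms only.  A bilinear map into \<open>U\<close> is reduced to bilinear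
  forms by composing it with the linear functionals on \<open>U\<close>, and these separate the points of \<open>U\<close>.
\<close>

lemma tlift_well_defined:
  assumes V: "vec_space V" and U: "vec_space U" and f: "bilin V W U f"
    and ps: "set ps \<subseteq> carr V \<times> carr W" and qs: "set qs \<subseteq> carr V \<times> carr W"
    and eq: "(\<Sum>(v, w)\<leftarrow>ps. tpure V W v w) = (\<Sum>(v, w)\<leftarrow>qs. tpure V W v w)"
  shows "(\<Sum>(v, w)\<leftarrow>ps. f v w) = (\<Sum>(v, w)\<leftarrow>qs. f v w)"
proof (rule ccontr)
  let ?F = "\<lambda>ps. \<Sum>(v, w)\<leftarrow>ps. f v w"
  assume "?F ps \<noteq> ?F qs"
  then obtain \<phi> where \<phi>: "lin U ground \<phi>" "\<phi> (?F ps - ?F qs) \<noteq> 0"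
    using separating_functional[OF U, of "?F ps - ?F qs"] by auto
  have \<beta>: "bilin V W ground (\<lambda>v w. \<phi> (f v w))"
    using f \<phi>(1) by (auto simp: bilin_def intro: lin_compose)
  have ev: "\<phi> (?F rs) = (\<Sum>(v, w)\<leftarrow>rs. tpure V W v w) (\<lambda>v w. \<phi> (f v w))"
    "?F rs \<in> carr U" if "set rs \<subseteq> carr V \<times> carr W" for rs
    using lin_apply_sum_list[OF \<phi>(1) U that, of "\<lambda>(v, w). f v w"] bilinD(3)[OF f] \<beta>
    by (auto simp: sum_list_fun_apply tpure_def split_beta')
  have "\<phi> (?F ps) = \<phi> (?F qs)"
    using ev(1)[OF ps] ev(1)[OF qs] eq by simp
  moreover have "?F ps - ?F qs \<in> carr U"
    using ev(2)[OF ps] ev(2)[OF qs] by (rule vec_space_diff[OF U])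
  then have "\<phi> (?F ps - ?F qs + ?F qs) = \<phi> (?F ps - ?F qs) + \<phi> (?F qs)"
    using linD(2)[OF \<phi>(1) _ ev(2)[OF qs]] by blast
  ultimately show False using \<phi>(2) by simp
qed

lemma tlift_sum_list:
  assumes "vec_space V" "vec_space U" "bilin V W U f" "set ps \<subseteq> carr V \<times> carr W"
  shows "tlift V W f (\<Sum>(v, w)\<leftarrow>ps. tpure V W v w) = (\<Sum>(v, w)\<leftarrow>ps. f v w)"
proof -
  let ?t = "\<Sum>(v, w)\<leftarrow>ps. tpure V W v w"
  have "?t \<in> carr (tensor V W)"
    using lin_apply_sum_list[OF lin_id vec_space_tensor[of V W] assms(4), of "\<lambda>(v, w). tpure V W v w"]
      tpure_mem[of _ V _ W] by auto
  from trep_props[OF assms(1) this] show ?thesis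
    unfolding tlift_def by (intro tlift_well_defined[OF assms(1-3) _ assms(4)]) auto
qed

lemma tlift_tpure:
  assumes "vec_space V" "vec_space U" "bilin V W U f" "v \<in> carr V" "w \<in> carr W"
  shows "tlift V W f (tpure V W v w) = f v w"
  using tlift_sum_list[OF assms(1-3), of "[(v, w)]"] assms(4,5) by simp

lemma scal_sum_list_bilin:
  assumes f: "bilin V W U f" and U: "vec_space U" and ps: "set ps \<subseteq> carr V \<times> carr W"
  shows "scal U c (\<Sum>(v, w)\<leftarrow>ps. f v w) = (\<Sum>(v, w)\<leftarrow>map (\<lambda>(v, w). (scal V c v, w)) ps. f v w)"
proof -
  have "scal U c (\<Sum>(v, w)\<leftarrow>ps. f v w) = (\<Sum>(v, w)\<leftarrow>ps. scal U c (f v w))"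
    using lin_apply_sum_list[OF lin_scal[OF U lin_id] U ps, of "\<lambda>(v, w). f v w"] bilinD(3)[OF f]
    by (auto simp: split_beta')
  also have "\<dots> = (\<Sum>(v, w)\<leftarrow>map (\<lambda>(v, w). (scal V c v, w)) ps. f v w)"
    using linD(3)[OF bilinD(1)[OF f]] ps
    by (auto simp: o_def split_beta' intro!: arg_cong[of _ _ sum_list] map_cong)
  finally show ?thesis .
qed

lemma lin_tlift:
  fixes V :: "('a::field, 'v::ab_group_add, 'x) vspace_scheme"
    and W :: "('a, 'w::ab_group_add, 'y) vspace_scheme"
    and U :: "('a, 'u::ab_group_add, 'z) vspace_scheme"
  assumes V: "vec_space V" and U: "vec_space U" and f: "bilin V W U f"
  shows "lin (tensor V W) U (tlift V W f)"
  unfolding lin_def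
proof (intro conjI ballI allI)
  fix s assume s: "s \<in> carr (tensor V W)"
  note S = trep_props[OF V s]
  let ?ps = "trep V W s"
  have fs: "tlift V W f s = (\<Sum>(v, w)\<leftarrow>?ps. f v w)" by (simp add: tlift_def)
  show "tlift V W f s \<in> carr U"
    unfolding fs using lin_apply_sum_list[OF lin_id U S(1), of "\<lambda>(v, w). f v w"] bilinD(3)[OF f] by auto
  show "tlift V W f (s + t) = tlift V W f s + tlift V W f t" if t: "t \<in> carr (tensor V W)" for t
  proof -
    note T = trep_props[OF V t]
    have "s + t = (\<Sum>(v, w)\<leftarrow>?ps @ trep V W t. tpure V W v w)" using S T by simp
    then show ?thesis
      using tlift_sum_list[OF V U f, of "?ps @ trep V W t"] S(1) T(1) by (simp add: tlift_def)
  qed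
  fix c
  let ?qs = "map (\<lambda>(v, w). (scal V c v, w)) ?ps"
  have qs: "set ?qs \<subseteq> carr V \<times> carr W" using S(1) vec_spaceD(4)[OF V] by auto
  have "scal (tensor V W) c s = (\<Sum>(v, w)\<leftarrow>?qs. tpure V W v w)"
    using scal_sum_list_bilin[OF bilin_tpure vec_space_tensor S(1)] S(2) by simp
  then show "tlift V W f (scal (tensor V W) c s) = scal U c (tlift V W f s)"
    using tlift_sum_list[OF V U f qs] scal_sum_list_bilin[OF f U S(1)] fs by simp
qed

text \<open>
  For a fixed tensor, all lifts are sums over one and the same representation.  Hence Sweedler sums
  over fixed tensors commute with each other, with finite sums and with linear maps.
\<close>

lemma tlift_eq_sum:
  "tlift V W f t = (\<Sum>n<length (trep V W t). f (fst (trep V W t ! n)) (snd (trep V W t ! n)))"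
  by (simp add: tlift_def sum_list_sum_nth split_beta' atLeast0LessThan)

lemma trep_nth_mem:
  assumes "vec_space V" "t \<in> carr (tensor V W)" "n < length (trep V W t)"
  shows "fst (trep V W t ! n) \<in> carr V" "snd (trep V W t ! n) \<in> carr W"
  using trep_props(1)[OF assms(1,2)] nth_mem[OF assms(3)] by auto

lemma tlift_mem:
  assumes "vec_space V" "vec_space U" "t \<in> carr (tensor V W)"
    and "\<And>v w. v \<in> carr V \<Longrightarrow> w \<in> carr W \<Longrightarrow> f v w \<in> carr U"
  shows "tlift V W f t \<in> carr U"
  unfolding tlift_eq_sum
  by (intro vec_space_sum[OF assms(2)] assms(4)) (auto intro: trep_nth_mem[OF assms(1,3)])

lemma tlift_cong:
  assumes "vec_space V" "t \<in> carr (tensor V W)"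
    and "\<And>v w. v \<in> carr V \<Longrightarrow> w \<in> carr W \<Longrightarrow> f v w = g v w"
  shows "tlift V W f t = tlift V W g t"
  unfolding tlift_eq_sum
  by (intro sum.cong refl assms(3)) (auto intro: trep_nth_mem[OF assms(1,2)])

lemma tlift_apply_lin:
  assumes "vec_space V" "t \<in> carr (tensor V W)" "vec_space U" "lin U Z g"
    and "\<And>v w. v \<in> carr V \<Longrightarrow> w \<in> carr W \<Longrightarrow> f v w \<in> carr U"
  shows "g (tlift V W f t) = tlift V W (\<lambda>v w. g (f v w)) t"
  unfolding tlift_eq_sum
  by (intro lin_apply_sum[OF assms(4,3)] assms(5)) (auto intro: trep_nth_mem[OF assms(1,2)])

lemma tlift_sum: "tlift V W (\<lambda>v w. \<Sum>i\<in>S. f i v w) t = (\<Sum>i\<in>S. tlift V W (f i) t)"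
  unfolding tlift_eq_sum by (rule sum.swap)

lemma tlift_swap:
  "tlift V W (\<lambda>v w. tlift V' W' (f v w) t') t = tlift V' W' (\<lambda>v' w'. tlift V W
      (\<lambda>v w. f v w v' w') t) t'"
  unfolding tlift_eq_sum by (rule sum.swap)

lemma lin_tlift_param:
  assumes "vec_space P" "vec_space U" "t \<in> carr (tensor P Q)"
    and "\<And>p q. p \<in> carr P \<Longrightarrow> q \<in> carr Q \<Longrightarrow> lin V U (\<lambda>x. f x p q)"
  shows "lin V U (\<lambda>x. tlift P Q (f x) t)"
  unfolding tlift_eq_sum
  by (intro lin_sum[OF assms(2)] assms(4)) (auto intro: trep_nth_mem[OF assms(1,3)])

lemma tensor_ext:
  assumes V: "vec_space V" and f: "lin (tensor V W) U f" and g: "lin (tensor V W) U g"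
    and eq: "\<And>v w. v \<in> carr V \<Longrightarrow> w \<in> carr W \<Longrightarrow> f (tpure V W v w) = g (tpure V W v w)"
    and t: "t \<in> carr (tensor V W)"
  shows "f t = g t"
proof -
  have *: "t = tlift V W (tpure V W) t"
    using trep_props(2)[OF V t] by (simp add: tlift_def)
  have "f t = tlift V W (\<lambda>v w. f (tpure V W v w)) t"
    by (subst *, rule tlift_apply_lin[OF V t vec_space_tensor f tpure_mem])
  also have "\<dots> = tlift V W (\<lambda>v w. g (tpure V W v w)) t"
    by (rule tlift_cong[OF V t eq])
  also have "\<dots> = g t"
    by (subst (2) *, rule tlift_apply_lin[OF V t vec_space_tensor g tpure_mem, symmetric])
  finally show ?thesis .
qed

lemma lin_fscal: "lin V (tensor P Q) f \<Longrightarrow> lin V (tensor P Q) (\<lambda>x. fscal c (f x))"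
  using lin_scal[OF vec_space_tensor] by simp

lemma lin_fscal_coeff:
  "lin V ground f \<Longrightarrow> t \<in> carr (tensor P Q) \<Longrightarrow> lin V (tensor P Q) (\<lambda>x. fscal (f x) t)"
  using lin_coeff[OF vec_space_tensor] by simp

lemma fscal_mem: "t \<in> carr (tensor P Q) \<Longrightarrow> fscal c t \<in> carr (tensor P Q)"
  using vec_spaceD(4)[OF vec_space_tensor] by simp

lemma lin_tpure_left: "lin V P f \<Longrightarrow> q \<in> carr Q \<Longrightarrow> lin V (tensor P Q) (\<lambda>x. tpure P Q (f x) q)"
  by (rule lin_bilin_left[OF bilin_tpure])

lemma lin_tpure_right: "p \<in> carr P \<Longrightarrow> lin V Q f \<Longrightarrow> lin V (tensor P Q) (\<lambda>x. tpure P Q p (f x))"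
  by (rule lin_bilin_right[OF bilin_tpure])

lemma tlift_sum_tpure:
  assumes V: "vec_space V" and U: "vec_space U" and f: "bilin V W U f"
    and "\<And>i. i \<in> S \<Longrightarrow> p i \<in> carr V" "\<And>i. i \<in> S \<Longrightarrow> q i \<in> carr W"
  shows "tlift V W f (\<Sum>i\<in>S. tpure V W (p i) (q i)) = (\<Sum>i\<in>S. f (p i) (q i))"
  using assms(4,5)
  by (subst lin_apply_sum[OF lin_tlift[OF V U f] vec_space_tensor])
    (auto intro!: sum.cong tpure_mem tlift_tpure[OF V U f])

section \<open>Sweedler sums\<close>

lemma swe3_tlift_swap:
  "swe3 B b (\<lambda>x y z. tlift P Q (k x y z) t) = tlift P Q (\<lambda>p q. swe3 B b (\<lambda>x y z. k x y z p q)) t"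
proof -
  have *: "swe2 B c (\<lambda>x y. tlift P Q (k x y z) t) =
      tlift P Q (\<lambda>p q. swe2 B c (\<lambda>x y. k x y z p q)) t" for c z
    unfolding swe2_def by (rule tlift_swap)
  show ?thesis
    unfolding swe3_def * by (subst (1 3) swe2_def) (rule tlift_swap)
qed

text \<open>
  The rules for Sweedler sums rest on the linearity of the coproduct; in this form they serve \<open>A\<close>, its
  dual and the codouble alike.
\<close>

locale comultiplication =
  fixes C :: "('k::field, 'v::ab_group_add, 'z) bialg_scheme"
  assumes vec_space_C: "vec_space C" and lin_comult: "lin C (tensor C C) (comult C)"
begin

lemma comult_mem: "x \<in> carr C \<Longrightarrow> comult C x \<in> carr (tensor C C)"
  using lin_comult by (rule linD)

lemma swe2_cong:
  "x \<in> carr C \<Longrightarrow> (\<And>p q. p \<in> carr C \<Longrightarrow> q \<in> carr C \<Longrightarrow> f p q = g p q) \<Longrightarrow> swe2 C x f = swe2 C x g"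
  unfolding swe2_def by (rule tlift_cong[OF vec_space_C comult_mem])

lemma swe2_mem:
  "x \<in> carr C \<Longrightarrow> vec_space U \<Longrightarrow> (\<And>p q. p \<in> carr C \<Longrightarrow> q \<in> carr C \<Longrightarrow> f p q \<in> carr U) \<Longrightarrow>
    swe2 C x f \<in> carr U"
  unfolding swe2_def by (rule tlift_mem[OF vec_space_C _ comult_mem])

lemma lin_swe2: "vec_space U \<Longrightarrow> bilin C C U f \<Longrightarrow> lin V C g \<Longrightarrow> lin V U (\<lambda>x. swe2 C (g x) f)"
  unfolding swe2_def by (intro lin_compose[OF lin_tlift[OF vec_space_C]] lin_compose[OF lin_comult])

lemma lin_swe2_param:
  "x \<in> carr C \<Longrightarrow> vec_space U \<Longrightarrow>
    (\<And>p q. p \<in> carr C \<Longrightarrow> q \<in> carr C \<Longrightarrow> lin V U (\<lambda>y. f y p q)) \<Longrightarrow> lin V U (\<lambda>y. swe2 C x (f y))"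
  unfolding swe2_def by (rule lin_tlift_param[OF vec_space_C _ comult_mem])

lemma swe2_apply_lin:
  "x \<in> carr C \<Longrightarrow> vec_space U \<Longrightarrow> lin U Z g \<Longrightarrow>
    (\<And>p q. p \<in> carr C \<Longrightarrow> q \<in> carr C \<Longrightarrow> f p q \<in> carr U) \<Longrightarrow>
    g (swe2 C x f) = swe2 C x (\<lambda>p q. g (f p q))"
  unfolding swe2_def by (rule tlift_apply_lin[OF vec_space_C comult_mem])

lemma swe2_sum: "swe2 C x (\<lambda>p q. \<Sum>i\<in>S. f i p q) = (\<Sum>i\<in>S. swe2 C x (f i))"
  unfolding swe2_def by (rule tlift_sum)

lemma swe2_grouplike:
  assumes x: "x \<in> carr C" "comult C x = tpure C C x x" and U: "vec_space U" and f: "bilin C C U f"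
  shows "swe2 C x f = f x x"
  unfolding swe2_def x(2) by (rule tlift_tpure[OF vec_space_C U f x(1) x(1)])

lemma lin_swe3:
  assumes U: "vec_space U" and g: "lin V C g"
    and f1: "\<And>p q. p \<in> carr C \<Longrightarrow> q \<in> carr C \<Longrightarrow> lin C U (\<lambda>x. f x p q)"
    and f2: "\<And>p q. p \<in> carr C \<Longrightarrow> q \<in> carr C \<Longrightarrow> lin C U (\<lambda>x. f p x q)"
    and f3: "\<And>p q. p \<in> carr C \<Longrightarrow> q \<in> carr C \<Longrightarrow> lin C U (\<lambda>x. f p q x)"
  shows "lin V U (\<lambda>x. swe3 C (g x) f)"
  unfolding swe3_def
  by (intro lin_swe2[OF U _ g] bilinI lin_swe2[OF U _ lin_id] lin_swe2_param[OF _ U] f1 f2 f3)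

lemma lin_swe3_param:
  assumes "x \<in> carr C" "vec_space U"
    and "\<And>p q r. p \<in> carr C \<Longrightarrow> q \<in> carr C \<Longrightarrow> r \<in> carr C \<Longrightarrow> lin V U (\<lambda>y. f y p q r)"
  shows "lin V U (\<lambda>y. swe3 C x (f y))"
  unfolding swe3_def by (intro lin_swe2_param[OF _ assms(2)] assms(1,3))

lemma swe3_grouplike:
  assumes x: "x \<in> carr C" "comult C x = tpure C C x x" and U: "vec_space U"
    and f1: "\<And>p q. p \<in> carr C \<Longrightarrow> q \<in> carr C \<Longrightarrow> lin C U (\<lambda>x. f x p q)"
    and f2: "\<And>p q. p \<in> carr C \<Longrightarrow> q \<in> carr C \<Longrightarrow> lin C U (\<lambda>x. f p x q)"
    and f3: "\<And>p q. p \<in> carr C \<Longrightarrow> q \<in> carr C \<Longrightarrow> lin C U (\<lambda>x. f p q x)"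
  shows "swe3 C x f = f x x x"
proof -
  have "swe3 C x f = swe2 C x (\<lambda>p q. f p q x)"
    unfolding swe3_def
    by (intro swe2_grouplike[OF x U] bilinI lin_swe2[OF U _ lin_id] lin_swe2_param[OF _ U] f1 f2
        f3 x(1))
  also have "\<dots> = f x x x"
    by (intro swe2_grouplike[OF x U] bilinI f1 f2 x(1))
  finally show ?thesis .
qed

lemma swe3_apply_lin:
  assumes x: "x \<in> carr C" and U: "vec_space U" and g: "lin U Z g"
    and f: "\<And>p q r. p \<in> carr C \<Longrightarrow> q \<in> carr C \<Longrightarrow> r \<in> carr C \<Longrightarrow> f p q r \<in> carr U"
  shows "g (swe3 C x f) = swe3 C x (\<lambda>p q r. g (f p q r))"
  unfolding swe3_def
  apply (subst swe2_apply_lin[OF x U g])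
   apply (intro swe2_mem[OF _ U] f; assumption)
  apply (rule swe2_cong[OF x])
  apply (rule swe2_apply_lin[OF _ U g])
   apply (assumption | intro f)+
  done

lemma swe3_cong:
  "x \<in> carr C \<Longrightarrow> (\<And>p q r. p \<in> carr C \<Longrightarrow> q \<in> carr C \<Longrightarrow> r \<in> carr C \<Longrightarrow> f p q r = g p q r) \<Longrightarrow>
    swe3 C x f = swe3 C x g"
  unfolding swe3_def by (intro swe2_cong)

lemma swe3_mem:
  "x \<in> carr C \<Longrightarrow> vec_space U \<Longrightarrow>
    (\<And>p q r. p \<in> carr C \<Longrightarrow> q \<in> carr C \<Longrightarrow> r \<in> carr C \<Longrightarrow> f p q r \<in> carr U) \<Longrightarrow> swe3 C x f \<in> carr U"
  unfolding swe3_def by (intro swe2_mem)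

end

section \<open>The dual Hopf algebra in coordinates\<close>

text \<open>
  A finite-dimensional Hopf algebra with its dual.  Finite dimension is expressed by the basis \<open>F\<close>;
  the functionals \<open>E\<close> dual to it then form a basis of \<open>H\<close> automatically.
\<close>

locale dual_pair =
  fixes A :: "('k::field, 'a::ab_group_add) hopf"
    and H :: "('k, 'a \<Rightarrow> 'k) hopf"
    and I :: "'i set" and E :: "'i \<Rightarrow> 'a \<Rightarrow> 'k" and F :: "'i \<Rightarrow> 'a"
  assumes hopf: "hopf_algebra A" and H_def: "H = dual_hopf A"
    and basis_F: "basis A I F"
    and E_mem: "i \<in> I \<Longrightarrow> E i \<in> carr H"
    and E_F: "i \<in> I \<Longrightarrow> j \<in> I \<Longrightarrow> E i (F j) = (if i = j then 1 else 0)"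
begin

lemma algebra_A: "algebra A" and coalgebra_A: "coalgebra A" and bialgebra_A: "bialgebra A"
  using hopf by (auto simp: hopf_algebra_def bialgebra_def)

lemma vec_space_A: "vec_space A" using algebra_A by (simp add: algebra_def)

lemma bilin_mult_A: "bilin A A A (mult A)" using algebra_A by (simp add: algebra_def)

lemma unity_A: "unity A \<in> carr A" using algebra_A by (simp add: algebra_def)

lemma mult_A_mem: "x \<in> carr A \<Longrightarrow> y \<in> carr A \<Longrightarrow> mult A x y \<in> carr A"
  using bilinD(3)[OF bilin_mult_A] .

lemma mult_A_unity: "x \<in> carr A \<Longrightarrow> mult A (unity A) x = x" "x \<in> carr A \<Longrightarrow> mult A x (unity A) = x"
  using algebra_A by (auto simp: algebra_def)

lemma mult_A_assoc:
  "x \<in> carr A \<Longrightarrow> y \<in> carr A \<Longrightarrow> z \<in> carr A \<Longrightarrow> mult A (mult A x y) z = mult A x (mult A y z)"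
  using algebra_A by (auto simp: algebra_def)

lemma lin_antipode_A: "lin A A (antipode A)" using hopf by (simp add: hopf_algebra_def)

lemma lin_counit_A: "lin A ground (counit A)" using coalgebra_A by (simp add: coalgebra_def)

sublocale cA: comultiplication A
  using coalgebra_A by unfold_locales (auto simp: coalgebra_def)

lemma H_simps [simp]: "scal H = fscal" "counit H h = h (unity A)"
  by (simp_all add: H_def dual_hopf_def)

lemma carr_H: "h \<in> carr H \<longleftrightarrow> lin A ground h \<and> (\<forall>x. x \<notin> carr A \<longrightarrow> h x = 0)"
  by (simp add: H_def dual_hopf_def dual_def)

lemma H_lin: "h \<in> carr H \<Longrightarrow> lin A ground h" by (simp add: carr_H)

lemma H_eqI: "h \<in> carr H \<Longrightarrow> g \<in> carr H \<Longrightarrow> (\<And>a. a \<in> carr A \<Longrightarrow> h a = g a) \<Longrightarrow> h = g"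
  by (fastforce simp: carr_H fun_eq_iff)

lemma on_mem: "lin A ground \<phi> \<Longrightarrow> on A \<phi> \<in> carr H"
  by (auto simp: carr_H on_def lin_cong[OF vec_space_A, of "\<lambda>x. if x \<in> carr A then \<phi> x else 0" \<phi>])

lemma vec_space_H: "vec_space H"
proof -
  interpret vector_space "fscal :: 'k \<Rightarrow> ('a \<Rightarrow> 'k) \<Rightarrow> 'a \<Rightarrow> 'k" by (rule vector_space_fscal)
  have "subspace (carr H)"
    by (rule subspaceI) (auto simp: carr_H lin_def fscal_def plus_fun_def zero_fun_def algebra_simps)
  then show ?thesis by (simp add: vec_space_def vector_space_axioms)
qed

lemma fscal_H_mem: "h \<in> carr H \<Longrightarrow> fscal c h \<in> carr H"
  using vec_spaceD(4)[OF vec_space_H] by simp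

lemma lin_eval: "lin H ground (\<lambda>h. h a)"
  by (auto simp: lin_def fscal_def plus_fun_def)

lemma lin_into_H:
  assumes "\<And>x. x \<in> carr V \<Longrightarrow> f x \<in> carr H" "\<And>a. a \<in> carr A \<Longrightarrow> lin V ground (\<lambda>x. f x a)" "vec_space V"
  shows "lin V H f"
  unfolding lin_def
proof (intro conjI ballI allI)
  fix x c assume x: "x \<in> carr V"
  show "f x \<in> carr H" by (rule assms(1)[OF x])
  have "scal H c (f x) \<in> carr H" "f (scal V c x) \<in> carr H"
    using vec_spaceD(4)[OF vec_space_H] vec_spaceD(4)[OF assms(3)] assms(1) x by blast+
  then show "f (scal V c x) = scal H c (f x)"
    using linD(3)[OF assms(2) x] by (intro H_eqI) (auto simp: fscal_def)
  fix y assume y: "y \<in> carr V"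
  have "f x + f y \<in> carr H" "f (x + y) \<in> carr H"
    using vec_spaceD(3)[OF vec_space_H] vec_spaceD(3)[OF assms(3)] assms(1) x y by blast+
  then show "f (x + y) = f x + f y"
    using linD(2)[OF assms(2) x y] by (intro H_eqI) (auto simp: plus_fun_def)
qed

lemma F_mem: "i \<in> I \<Longrightarrow> F i \<in> carr A"
  using basis_F by (auto simp: basis_def)

lemma expand_A: "a \<in> carr A \<Longrightarrow> a = (\<Sum>i\<in>I. scal A (E i a) (F i))"
  by (rule basis_expansion[OF vec_space_A basis_F H_lin[OF E_mem] E_F])

lemma lin_expand_A:
  assumes "lin A U g" "a \<in> carr A"
  shows "g a = (\<Sum>i\<in>I. scal U (E i a) (g (F i)))"
proof -
  have "g a = g (\<Sum>i\<in>I. scal A (E i a) (F i))" by (rule arg_cong[OF expand_A[OF assms(2)]])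
  also have "\<dots> = (\<Sum>i\<in>I. g (scal A (E i a) (F i)))"
    by (rule lin_apply_sum[OF assms(1) vec_space_A]) (auto intro: vec_spaceD[OF vec_space_A] F_mem)
  finally show ?thesis using linD(3)[OF assms(1) F_mem] by simp
qed

lemma sum_scal_E_apply: "(\<Sum>i\<in>I. fscal (c i) (E i)) a = (\<Sum>i\<in>I. c i * E i a)"
  by (simp add: sum_fun_apply fscal_def)

lemma expand_H:
  assumes h: "h \<in> carr H"
  shows "h = (\<Sum>i\<in>I. fscal (h (F i)) (E i))"
proof (rule H_eqI[OF h])
  show "(\<Sum>i\<in>I. fscal (h (F i)) (E i)) \<in> carr H"
    by (intro vec_space_sum[OF vec_space_H] fscal_H_mem E_mem)
  fix a assume "a \<in> carr A"
  then show "h a = (\<Sum>i\<in>I. fscal (h (F i)) (E i)) a"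
    using lin_expand_A[OF H_lin[OF h]] by (simp add: sum_scal_E_apply mult.commute)
qed

lemma lin_expand_H:
  assumes "lin H U g" "h \<in> carr H"
  shows "g h = (\<Sum>i\<in>I. scal U (h (F i)) (g (E i)))"
proof -
  have "g h = g (\<Sum>i\<in>I. scal H (h (F i)) (E i))"
    unfolding H_simps(1) by (rule arg_cong[OF expand_H[OF assms(2)]])
  also have "\<dots> = (\<Sum>i\<in>I. g (scal H (h (F i)) (E i)))"
    by (rule lin_apply_sum[OF assms(1) vec_space_H]) (simp add: fscal_H_mem E_mem)
  finally show ?thesis using linD(3)[OF assms(1) E_mem] by simp
qed

lemma bilin_expand_H:
  assumes f: "bilin H H U f" and U: "vec_space U" and h: "h \<in> carr H" "g \<in> carr H"
  shows "f h g = (\<Sum>i\<in>I. \<Sum>j\<in>I. scal U (h (F i) * g (F j)) (f (E i) (E j)))"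
proof -
  have "f h g = (\<Sum>i\<in>I. scal U (h (F i)) (f (E i) g))"
    by (rule lin_expand_H[OF bilinD(1)[OF f h(2)] h(1)])
  also have "\<dots> = (\<Sum>i\<in>I. \<Sum>j\<in>I. scal U (h (F i) * g (F j)) (f (E i) (E j)))"
    using lin_expand_H[OF bilinD(2)[OF f E_mem] h(2)]
    by (intro sum.cong) (auto simp: scal_sum_right[OF U] scal_scal[OF U])
  finally show ?thesis .
qed

lemma bilin_eval: "bilin H H ground (\<lambda>h1 h2. h1 a * h2 b)"
  by (intro bilinI lin_times_left lin_times_right lin_eval)

text \<open>
  The pairings with \<open>F\<^sub>i\<close> and \<open>F\<^sub>j\<close> are the coordinates of a tensor, so an element of \<open>H \<otimes> H\<close> is
  determined by its pairings with pairs of elements of \<open>A\<close>.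
\<close>

lemma tensor_H_expand:
  assumes "t \<in> carr (tensor H H)"
  shows "t = (\<Sum>i\<in>I. \<Sum>j\<in>I. fscal (tlift H H (\<lambda>h g. h (F i) * g (F j)) t) (tpure H H (E i) (E j)))"
proof -
  have "t = tlift H H (tpure H H) t"
    using trep_props(2)[OF vec_space_H assms] by (simp add: tlift_def)
  also have "\<dots> = tlift H H (\<lambda>h g. \<Sum>i\<in>I. \<Sum>j\<in>I. fscal (h (F i) * g (F j)) (tpure H H (E i) (E j))) t"
    by (rule tlift_cong[OF vec_space_H assms])
      (rule bilin_expand_H[OF bilin_tpure vec_space_tensor, unfolded tensor_scal])
  also have "\<dots> = (\<Sum>i\<in>I. \<Sum>j\<in>I. fscal (tlift H H (\<lambda>h g. h (F i) * g (F j)) t) (tpure H H (E i) (E j)))"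
    unfolding tlift_sum
  proof (intro sum.cong refl)
    fix i j assume ij: "i \<in> I" "j \<in> I"
    have "lin ground (tensor H H) (\<lambda>c. scal (tensor H H) c (tpure H H (E i) (E j)))"
      using ij by (intro lin_coeff[OF vec_space_tensor lin_id] tpure_mem E_mem)
    from tlift_apply_lin[OF vec_space_H assms vec_space_ground this, of "\<lambda>h g. h (F i) * g (F j)"]
    show "tlift H H (\<lambda>h g. fscal (h (F i) * g (F j)) (tpure H H (E i) (E j))) t =
      fscal (tlift H H (\<lambda>h g. h (F i) * g (F j)) t) (tpure H H (E i) (E j))" by simp
  qed
  finally show ?thesis .
qed

text \<open>
  Expansion of \<open>a\<close> and \<open>b\<close> in the basis \<open>F\<close>.
\<close>

lemma pairing_expand:
  assumes h: "h \<in> carr H" and a: "a \<in> carr A" and b: "b \<in> carr A"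
  shows "(\<Sum>i\<in>I. \<Sum>j\<in>I. h (mult A (F i) (F j)) * (E i a * E j b)) = h (mult A a b)"
proof -
  have "(\<Sum>i\<in>I. \<Sum>j\<in>I. h (mult A (F i) (F j)) * (E i a * E j b)) = (\<Sum>i\<in>I. E i a * h (mult A (F i) b))"
    using lin_expand_A[OF lin_bilin_right[OF bilin_mult_A F_mem lin_id, THEN lin_compose[OF
        H_lin[OF h]]] b]
    by (intro sum.cong refl) (simp add: sum_distrib_left mult_ac)
  also have "\<dots> = h (mult A a b)"
    using lin_expand_A[OF lin_bilin_left[OF bilin_mult_A lin_id b, THEN lin_compose[OF H_lin[OF h]]] a]
    by simp
  finally show ?thesis .
qed

text \<open>
  The coproduct of \<open>H\<close> is dual to the product of \<open>A\<close>, hence its coordinates are the values of \<open>h\<close> on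
  products of basis elements.  This tensor has the pairings that define the coproduct, and no other
  tensor has, by lemma \<open>tensor_H_expand\<close>.
\<close>

lemma comult_H:
  assumes h: "h \<in> carr H"
  shows "comult H h = (\<Sum>i\<in>I. \<Sum>j\<in>I. fscal (h (mult A (F i) (F j))) (tpure H H (E i) (E j)))"
proof -
  let ?P = "\<lambda>t. t \<in> carr (tensor H H) \<and>
    (\<forall>a\<in>carr A. \<forall>b\<in>carr A. tlift H H (\<lambda>h1 h2. h1 a * h2 b) t = h (mult A a b))"
  let ?t = "\<Sum>i\<in>I. \<Sum>j\<in>I. fscal (h (mult A (F i) (F j))) (tpure H H (E i) (E j))"
  have "carr (dual A) = carr H" "scal (dual A) = scal H"
    by (auto simp: carr_H dual_def)
  then have H: "H = dual_hopf A" "tensor (dual A) (dual A) =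
      tensor H H" "tlift (dual A) (dual A) = tlift H H"
    using H_def tensor_carr_cong[of "dual A" H "dual A" H] tlift_carr_cong[of "dual A" H "dual A" H]
    by simp_all
  have "comult H h = (THE t. ?P t)"
    unfolding H(2,3)[symmetric] by (subst H(1)) (simp add: dual_hopf_def)
  also have "\<dots> = ?t"
  proof (rule the_equality)
    have mem: "?t \<in> carr (tensor H H)"
      using vec_spaceD(4)[OF vec_space_tensor[of H H]]
      by (auto intro!: vec_space_sum[OF vec_space_tensor] tpure_mem E_mem)
    moreover have "tlift H H (\<lambda>h1 h2. h1 a * h2 b) ?t = h (mult A a b)"
      if a: "a \<in> carr A" and b: "b \<in> carr A" for a b
    proof -
      note L = lin_tlift[OF vec_space_H vec_space_ground bilin_eval[of a b]]
      have sc: "fscal c (tpure H H (E i) (E j)) \<in> carr (tensor H H)" if "i \<in> I" "j \<in> I" for i j c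
        using vec_spaceD(4)[OF vec_space_tensor[of H H]] that by (auto intro: tpure_mem E_mem)
      have "tlift H H (\<lambda>h1 h2. h1 a * h2 b) ?t =
        (\<Sum>i\<in>I. \<Sum>j\<in>I. tlift H H (\<lambda>h1 h2. h1 a * h2 b)
          (fscal (h (mult A (F i) (F j))) (tpure H H (E i) (E j))))"
        using sc by (rule lin_apply_sum2[OF L vec_space_tensor])
      also have "\<dots> = (\<Sum>i\<in>I. \<Sum>j\<in>I. h (mult A (F i) (F j)) * (E i a * E j b))"
        using linD(3)[OF L tpure_mem[OF E_mem E_mem]]
        by (intro sum.cong refl)
          (simp add: tlift_tpure[OF vec_space_H vec_space_ground bilin_eval] E_mem)
      also have "\<dots> = h (mult A a b)" by (rule pairing_expand[OF h a b])
      finally show ?thesis .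
    qed
    ultimately show "?P ?t" by blast
    fix t assume "?P t"
    then have t: "t \<in> carr (tensor H H)"
      and ev: "tlift H H (\<lambda>h1 h2. h1 (F i) * h2 (F j)) t =
          h (mult A (F i) (F j))" if "i \<in> I" "j \<in> I" for i j
      using F_mem that by blast+
    have "t = (\<Sum>i\<in>I. \<Sum>j\<in>I. fscal (tlift H H (\<lambda>h g. h (F i) * g (F j)) t) (tpure H H (E i) (E j)))"
      using \<open>?P t\<close> by (intro tensor_H_expand) blast
    also have "\<dots> = ?t" by (intro sum.cong refl) (simp only: ev)
    finally show "t = ?t" .
  qed
  finally show ?thesis .
qed

lemma lin_comult_H: "lin H (tensor H H) (comult H)"
proof -
  have "lin H (tensor H H) (\<lambda>h. \<Sum>i\<in>I. \<Sum>j\<in>I. scal (tensor H H) (h (mult A (F i) (F j))) (tpure H H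
      (E i) (E j)))"
    by (intro lin_sum[OF vec_space_tensor] lin_coeff[OF vec_space_tensor] lin_eval tpure_mem E_mem)
  then show ?thesis by (subst lin_cong[OF vec_space_H comult_H]) auto
qed

sublocale cH: comultiplication H
  by unfold_locales (rule vec_space_H, rule lin_comult_H)

text \<open>
  With this formula identities for Sweedler sums in \<open>H\<close> become identities for the product of \<open>A\<close>.
\<close>

lemma swe2_H:
  assumes h: "h \<in> carr H" and U: "vec_space U" and f: "bilin H H U f"
  shows "swe2 H h f = (\<Sum>i\<in>I. \<Sum>j\<in>I. scal U (h (mult A (F i) (F j))) (f (E i) (E j)))"
proof -
  note L = lin_tlift[OF vec_space_H U f]
  have sc: "fscal c (tpure H H (E i) (E j)) \<in> carr (tensor H H)" if "i \<in> I" "j \<in> I" for i j c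
    using vec_spaceD(4)[OF vec_space_tensor[of H H]] that by (auto intro: tpure_mem E_mem)
  have "swe2 H h f = (\<Sum>i\<in>I. \<Sum>j\<in>I. tlift H H f (fscal (h (mult A (F i) (F j))) (tpure H H (E i) (E j))))"
    unfolding swe2_def comult_H[OF h]
    using sc by (rule lin_apply_sum2[OF L vec_space_tensor])
  also have "\<dots> = (\<Sum>i\<in>I. \<Sum>j\<in>I. scal U (h (mult A (F i) (F j))) (f (E i) (E j)))"
    using linD(3)[OF L tpure_mem[OF E_mem E_mem]]
    by (intro sum.cong refl) (simp add: tlift_tpure[OF vec_space_H U f] E_mem)
  finally show ?thesis .
qed

lemma mult_H_apply: "a \<in> carr A \<Longrightarrow> mult H h g a = swe2 A a (\<lambda>a1 a2. h a1 * g a2)"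
  by (simp add: H_def dual_hopf_def on_def)

lemma unity_H_apply: "a \<in> carr A \<Longrightarrow> unity H a = counit A a"
  by (simp add: H_def dual_hopf_def on_def)

lemma antipode_H_apply: "a \<in> carr A \<Longrightarrow> antipode H h a = h (antipode A a)"
  by (simp add: H_def dual_hopf_def on_def)

lemma antipode_A_mem: "a \<in> carr A \<Longrightarrow> antipode A a \<in> carr A"
  using lin_antipode_A by (rule linD)

lemma bilin_H_H: "h \<in> carr H \<Longrightarrow> g \<in> carr H \<Longrightarrow> bilin A A ground (\<lambda>a1 a2. h a1 * g a2)"
  by (intro bilinI lin_times_left lin_times_right H_lin)

lemma mult_H_mem: "h \<in> carr H \<Longrightarrow> g \<in> carr H \<Longrightarrow> mult H h g \<in> carr H"
  using on_mem[OF cA.lin_swe2[OF vec_space_ground bilin_H_H lin_id]]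
  by (simp add: H_def dual_hopf_def)

lemma unity_H: "unity H \<in> carr H"
  using on_mem[OF lin_counit_A] by (simp add: H_def dual_hopf_def)

lemma antipode_H_mem: "h \<in> carr H \<Longrightarrow> antipode H h \<in> carr H"
  using on_mem[OF lin_compose[OF H_lin lin_antipode_A]] by (simp add: H_def dual_hopf_def)

lemma bilin_mult_H: "bilin H H H (mult H)"
proof (rule bilinI)
  fix g assume g: "g \<in> carr H"
  have "lin H ground (\<lambda>h. mult H h g a)" if a: "a \<in> carr A" for a
    unfolding mult_H_apply[OF a]
    by (intro cA.lin_swe2_param[OF a vec_space_ground] lin_times_left lin_eval)
  then show "lin H H (\<lambda>h. mult H h g)" by (intro lin_into_H vec_space_H mult_H_mem g)
next
  fix h assume h: "h \<in> carr H"
  have "lin H ground (\<lambda>g. mult H h g a)" if a: "a \<in> carr A" for a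
    unfolding mult_H_apply[OF a]
    by (intro cA.lin_swe2_param[OF a vec_space_ground] lin_times_right lin_eval)
  then show "lin H H (mult H h)" by (intro lin_into_H vec_space_H mult_H_mem h)
qed

lemma lin_antipode_H: "lin H H (antipode H)"
  by (rule lin_into_H) (simp_all add: antipode_H_mem antipode_H_apply lin_eval vec_space_H)

lemma swe2_A_counit:
  assumes "a \<in> carr A" "lin A U g" "vec_space U"
  shows "swe2 A a (\<lambda>a1 a2. scal U (counit A a1) (g a2)) = g a"
    and "swe2 A a (\<lambda>a1 a2. scal U (counit A a2) (g a1)) = g a"
proof -
  have "swe2 A a (\<lambda>a1 a2. scal A (counit A a1) a2) = a" "swe2 A a (\<lambda>a1 a2. scal A (counit A a2) a1) = a"
    using coalgebra_A assms(1) by (auto simp: coalgebra_def)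
  then show "swe2 A a (\<lambda>a1 a2. scal U (counit A a1) (g a2)) = g a"
    "swe2 A a (\<lambda>a1 a2. scal U (counit A a2) (g a1)) = g a"
    using cA.swe2_apply_lin[OF assms(1) vec_space_A assms(2), of "\<lambda>a1 a2. scal A (counit A a1) a2"]
      cA.swe2_apply_lin[OF assms(1) vec_space_A assms(2), of "\<lambda>a1 a2. scal A (counit A a2) a1"]
      cA.swe2_cong[OF assms(1)] linD(3)[OF assms(2)] vec_spaceD(4)[OF vec_space_A]
    by (simp_all cong: cA.swe2_cong[OF assms(1)])
qed

lemma mult_H_unity:
  assumes h: "h \<in> carr H"
  shows "mult H (unity H) h = h" "mult H h (unity H) = h"
proof -
  show "mult H (unity H) h = h"
  proof (rule H_eqI[OF mult_H_mem[OF unity_H h] h])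
    fix a assume a: "a \<in> carr A"
    show "mult H (unity H) h a = h a"
      using swe2_A_counit(1)[OF a H_lin[OF h] vec_space_ground]
      by (simp add: mult_H_apply[OF a] unity_H_apply cong: cA.swe2_cong[OF a])
  qed
  show "mult H h (unity H) = h"
  proof (rule H_eqI[OF mult_H_mem[OF h unity_H] h])
    fix a assume a: "a \<in> carr A"
    show "mult H h (unity H) a = h a"
      using swe2_A_counit(2)[OF a H_lin[OF h] vec_space_ground]
      by (simp add: mult_H_apply[OF a] unity_H_apply mult.commute cong: cA.swe2_cong[OF a])
  qed
qed

lemma swe2_H_pairing:
  assumes h: "h \<in> carr H" and a: "a \<in> carr A" and b: "b \<in> carr A"
  shows "swe2 H h (\<lambda>h1 h2. h1 a * h2 b) = h (mult A a b)"
  using swe2_H[OF h vec_space_ground bilin_eval] pairing_expand[OF assms] by simp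

text \<open>
  Coassociativity is an equation in \<open>A \<otimes> (A \<otimes> A)\<close>; here it is tested against the linear form that
  applies one functional to each factor.
\<close>

lemma swe2_A_coassoc:
  assumes a: "a \<in> carr A" and hgk: "h \<in> carr H" "g \<in> carr H" "k \<in> carr H"
  shows "swe2 A a (\<lambda>a12 a3. swe2 A a12 (\<lambda>a1 a2. h a1 * (g a2 * k a3))) =
    swe2 A a (\<lambda>a1 a23. swe2 A a23 (\<lambda>a2 a3. h a1 * (g a2 * k a3)))"
proof -
  let ?T = "tensor A A" and ?f = "\<lambda>x t. h x * tlift A A (\<lambda>y z. g y * k z) t"
  let ?L = "tlift A ?T ?f"
  have gk: "lin ?T ground (tlift A A (\<lambda>y z. g y * k z))"
    by (intro lin_tlift vec_space_A vec_space_ground bilin_H_H hgk)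
  have f: "bilin A ?T ground ?f"
    by (intro bilinI lin_times_left lin_times_right gk H_lin hgk)
  have L: "lin (tensor A ?T) ground ?L"
    by (rule lin_tlift[OF vec_space_A vec_space_ground f])
  have p: "tlift A A (\<lambda>y z. g y * k z) (tpure A A y z) = g y * k z" if "y \<in> carr A" "z \<in> carr A" for y z
    by (rule tlift_tpure[OF vec_space_A vec_space_ground bilin_H_H[OF hgk(2,3)] that])
  have q: "?L (tpure A ?T x t) = ?f x t" if "x \<in> carr A" "t \<in> carr ?T" for x t
    by (rule tlift_tpure[OF vec_space_A vec_space_ground f that])
  have "?L (swe2 A a (\<lambda>x12 x3. swe2 A x12 (\<lambda>x1 x2. tpure A ?T x1 (tpure A A x2 x3)))) =
    swe2 A a (\<lambda>a12 a3. swe2 A a12 (\<lambda>a1 a2. h a1 * (g a2 * k a3)))"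
    apply (subst cA.swe2_apply_lin[OF a vec_space_tensor L])
     apply (intro cA.swe2_mem vec_space_tensor tpure_mem; assumption)
    apply (rule cA.swe2_cong[OF a])
    apply (subst cA.swe2_apply_lin[OF _ vec_space_tensor L], assumption)
     apply (intro tpure_mem; assumption)
    apply (rule cA.swe2_cong, assumption)
    apply (simp add: q p tpure_mem)
    done
  moreover have "?L (swe2 A a (\<lambda>x1 x23. tpure A ?T x1 (comult A x23))) =
    swe2 A a (\<lambda>a1 a23. swe2 A a23 (\<lambda>a2 a3. h a1 * (g a2 * k a3)))"
    apply (subst cA.swe2_apply_lin[OF a vec_space_tensor L])
     apply (intro tpure_mem cA.comult_mem; assumption)
    apply (rule cA.swe2_cong[OF a])
    apply (subst q, assumption, erule cA.comult_mem)
    apply (subst swe2_def[symmetric])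
    apply (rule cA.swe2_apply_lin[OF _ vec_space_ground lin_times_right[OF lin_id]])
     apply simp_all
    done
  moreover have "swe2 A a (\<lambda>x12 x3. swe2 A x12 (\<lambda>x1 x2. tpure A ?T x1 (tpure A A x2 x3))) =
      swe2 A a (\<lambda>x1 x23. tpure A ?T x1 (comult A x23))"
    using coalgebra_A a by (auto simp: coalgebra_def)
  ultimately show ?thesis by simp
qed

text \<open>
  Dual to the coassociativity of \<open>A\<close>.
\<close>

lemma mult_H_assoc:
  assumes hgk: "h \<in> carr H" "g \<in> carr H" "k \<in> carr H"
  shows "mult H (mult H h g) k = mult H h (mult H g k)"
proof (rule H_eqI)
  fix a assume a: "a \<in> carr A"
  have "mult H (mult H h g) k a = swe2 A a (\<lambda>a12 a3. swe2 A a12 (\<lambda>a1 a2. h a1 * (g a2 * k a3)))"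
    unfolding mult_H_apply[OF a]
  proof (rule cA.swe2_cong[OF a])
    fix p q assume p: "p \<in> carr A"
    show "mult H h g p * k q = swe2 A p (\<lambda>a1 a2. h a1 * (g a2 * k q))"
      using cA.swe2_apply_lin[OF p vec_space_ground lin_times_left[OF lin_id], of
          "\<lambda>a1 a2. h a1 * g a2" "k q"]
      by (simp add: mult_H_apply[OF p] mult.assoc)
  qed
  also have "\<dots> = swe2 A a (\<lambda>a1 a23. swe2 A a23 (\<lambda>a2 a3. h a1 * (g a2 * k a3)))"
    by (rule swe2_A_coassoc[OF a hgk])
  also have "\<dots> = mult H h (mult H g k) a"
    unfolding mult_H_apply[OF a]
  proof (rule cA.swe2_cong[OF a])
    fix p q assume q: "q \<in> carr A"
    show "swe2 A q (\<lambda>a2 a3. h p * (g a2 * k a3)) = h p * mult H g k q"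
      using cA.swe2_apply_lin[OF q vec_space_ground lin_times_right[OF lin_id], of
          "\<lambda>a1 a2. g a1 * k a2" "h p"]
      by (simp add: mult_H_apply[OF q])
  qed
  finally show "mult H (mult H h g) k a = mult H h (mult H g k) a" .
qed (intro mult_H_mem hgk)+

text \<open>
  In coordinates the two sides have the coefficients \<open>x ((F\<^sub>k F\<^sub>l) F\<^sub>j)\<close> and \<open>x (F\<^sub>k (F\<^sub>l F\<^sub>j))\<close>, so the
  coassociativity of \<open>H\<close> is the associativity of \<open>A\<close>.
\<close>

lemma swe2_H_coassoc:
  fixes U :: "('k, 'u::ab_group_add, 'm) vspace_scheme"
  assumes x: "x \<in> carr H" and U: "vec_space U"
    and f1: "\<And>h g. h \<in> carr H \<Longrightarrow> g \<in> carr H \<Longrightarrow> lin H U (\<lambda>x. f x h g)"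
    and f2: "\<And>h g. h \<in> carr H \<Longrightarrow> g \<in> carr H \<Longrightarrow> lin H U (\<lambda>x. f h x g)"
    and f3: "\<And>h g. h \<in> carr H \<Longrightarrow> g \<in> carr H \<Longrightarrow> lin H U (\<lambda>x. f h g x)"
  shows "swe2 H x (\<lambda>x12 x3. swe2 H x12 (\<lambda>x1 x2. f x1 x2 x3)) =
    swe2 H x (\<lambda>x1 x23. swe2 H x23 (\<lambda>x2 x3. f x1 x2 x3))"
proof -
  let ?m = "\<lambda>i j. mult A (F i) (F j)"
  have rotate: "(\<Sum>l\<in>I. \<Sum>j\<in>I. \<Sum>i\<in>I. g l j i) = (\<Sum>i\<in>I. \<Sum>l\<in>I. \<Sum>j\<in>I. g l j i)"
    for g :: "'i \<Rightarrow> 'i \<Rightarrow> 'i \<Rightarrow> 'u"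
    by (rule trans[OF sum.cong[OF refl sum.swap] sum.swap])
  have *: "(\<Sum>i\<in>I. scal U (x (mult A (F i) b)) (scal U (E i a) u)) = scal U (x (mult A a b)) u"
    "(\<Sum>i\<in>I. scal U (x (mult A b (F i))) (scal U (E i a) u)) = scal U (x (mult A b a)) u"
    if "a \<in> carr A" "b \<in> carr A" for a b u
    using lin_expand_A[OF lin_bilin_left[OF bilin_mult_A lin_id that(2), THEN lin_compose[OF
        H_lin[OF x]]] that(1)]
      lin_expand_A[OF lin_bilin_right[OF bilin_mult_A that(2) lin_id, THEN lin_compose[OF H_lin[OF
          x]]] that(1)]
    by (simp_all add: scal_scal[OF U] scal_sum_left[OF U] mult.commute)
  have "swe2 H x (\<lambda>x12 x3. swe2 H x12 (\<lambda>x1 x2. f x1 x2 x3)) =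
      (\<Sum>i\<in>I. \<Sum>j\<in>I. scal U (x (?m i j)) (swe2 H (E i) (\<lambda>x1 x2. f x1 x2 (E j))))"
    by (intro swe2_H[OF x U] bilinI cH.lin_swe2[OF U _ lin_id] cH.lin_swe2_param[OF _ U] f1 f2 f3)
  also have "\<dots> = (\<Sum>i\<in>I. \<Sum>j\<in>I. scal U (x (?m i j)) (\<Sum>k\<in>I. \<Sum>l\<in>I. scal U (E i (?m k l)) (f (E k)
      (E l) (E j))))"
    by (intro sum.cong refl arg_cong[of _ _ "scal U _"] swe2_H U bilinI f1 f2 E_mem)
  also have "\<dots> = (\<Sum>j\<in>I. \<Sum>k\<in>I. \<Sum>l\<in>I. \<Sum>i\<in>I. scal U (x (?m i j)) (scal U (E i (?m k l)) (f (E k)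
      (E l) (E j))))"
    unfolding scal_sum_right[OF U]
    by (subst sum.swap, rule sum.cong[OF refl], subst sum.swap, rule sum.cong[OF refl], rule sum.swap)
  also have "\<dots> = (\<Sum>j\<in>I. \<Sum>k\<in>I. \<Sum>l\<in>I. scal U (x (mult A (?m k l) (F j))) (f (E k) (E l) (E j)))"
    by (intro sum.cong refl *(1) mult_A_mem F_mem)
  also have "\<dots> = (\<Sum>k\<in>I. \<Sum>l\<in>I. \<Sum>j\<in>I. scal U (x (mult A (F k) (?m l j))) (f (E k) (E l) (E j)))"
    by (subst sum.swap, rule sum.cong[OF refl], subst sum.swap) (simp add: mult_A_assoc F_mem)
  also have "\<dots> = (\<Sum>k\<in>I. \<Sum>l\<in>I. \<Sum>j\<in>I. \<Sum>i\<in>I. scal U (x (?m k i)) (scal U (E i (?m l j)) (f (E k)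
      (E l) (E j))))"
    by (intro sum.cong refl *(2)[symmetric] mult_A_mem F_mem)
  also have "\<dots> = (\<Sum>k\<in>I. \<Sum>i\<in>I. scal U (x (?m k i)) (\<Sum>l\<in>I. \<Sum>j\<in>I. scal U (E i (?m l j)) (f (E k)
      (E l) (E j))))"
    unfolding scal_sum_right[OF U]
    by (rule sum.cong[OF refl], rule rotate)
  also have "\<dots> = (\<Sum>k\<in>I. \<Sum>i\<in>I. scal U (x (?m k i)) (swe2 H (E i) (\<lambda>x2 x3. f (E k) x2 x3)))"
    by (intro sum.cong refl arg_cong[of _ _ "scal U _"] swe2_H[symmetric] U bilinI f2 f3 E_mem)
  also have "\<dots> = swe2 H x (\<lambda>x1 x23. swe2 H x23 (\<lambda>x2 x3. f x1 x2 x3))"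
    by (intro swe2_H[OF x U, symmetric] bilinI cH.lin_swe2[OF U _ lin_id] cH.lin_swe2_param[OF _
        U] f1 f2 f3)
  finally show ?thesis .
qed

lemma swe2_H_counit:
  assumes h: "h \<in> carr H" and U: "vec_space U" and g: "lin H U g"
  shows "swe2 H h (\<lambda>h1 h2. scal U (h1 (unity A)) (g h2)) = g h"
proof -
  have "swe2 H h (\<lambda>h1 h2. scal U (h1 (unity A)) (g h2)) =
      (\<Sum>i\<in>I. \<Sum>j\<in>I. scal U (h (mult A (F i) (F j))) (scal U (E i (unity A)) (g (E j))))"
    using linD(1)[OF g] by (intro swe2_H[OF h U] bilinI lin_coeff[OF U] lin_scal[OF U] g lin_eval) auto
  also have "\<dots> = (\<Sum>j\<in>I. scal U (\<Sum>i\<in>I. E i (unity A) * h (mult A (F i) (F j))) (g (E j)))"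
    by (subst sum.swap) (simp add: scal_scal[OF U] scal_sum_left[OF U] mult.commute)
  also have "\<dots> = (\<Sum>j\<in>I. scal U (h (F j)) (g (E j)))"
  proof (intro sum.cong refl)
    fix j assume j: "j \<in> I"
    show "scal U (\<Sum>i\<in>I. E i (unity A) * h (mult A (F i) (F j))) (g (E j)) = scal U (h (F j)) (g (E j))"
      using lin_expand_A[OF lin_bilin_left[OF bilin_mult_A lin_id F_mem[OF j], THEN lin_compose[OF
          H_lin[OF h]]] unity_A]
      by (simp add: mult_A_unity F_mem[OF j])
  qed
  also have "\<dots> = g h" by (rule lin_expand_H[OF g h, symmetric])
  finally show ?thesis .
qed

text \<open>
  At \<open>a\<close> the left side is the value of \<open>h\<close> on \<open>\<Sum> (S a\<^sub>(\<^sub>1\<^sub>)) a\<^sub>(\<^sub>2\<^sub>)\<close>, to which the antipode axiom of \<open>A\<close>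
  applies.
\<close>

lemma swe2_H_antipode:
  assumes h: "h \<in> carr H"
  shows "swe2 H h (\<lambda>h1 h2. mult H (antipode H h1) h2) = fscal (h (unity A)) (unity H)"
proof (rule H_eqI)
  have b: "bilin H H H (\<lambda>h1 h2. mult H (antipode H h1) h2)"
    by (intro bilinI lin_bilin_left[OF bilin_mult_H] lin_bilin_right[OF bilin_mult_H]
        lin_antipode_H lin_id antipode_H_mem)
  show "swe2 H h (\<lambda>h1 h2. mult H (antipode H h1) h2) \<in> carr H"
    by (intro cH.swe2_mem[OF h vec_space_H] mult_H_mem antipode_H_mem)
  show "fscal (h (unity A)) (unity H) \<in> carr H"
    using vec_spaceD(4)[OF vec_space_H unity_H] by simp
  fix a assume a: "a \<in> carr A"
  have "swe2 H h (\<lambda>h1 h2. mult H (antipode H h1) h2) a =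
      swe2 H h (\<lambda>h1 h2. swe2 A a (\<lambda>a1 a2. h1 (antipode A a1) * h2 a2))"
    apply (subst cH.swe2_apply_lin[OF h vec_space_H lin_eval])
     apply (intro mult_H_mem antipode_H_mem; assumption)
    apply (rule cH.swe2_cong[OF h])
    apply (subst mult_H_apply[OF a])
    apply (rule cA.swe2_cong[OF a])
    apply (simp add: antipode_H_apply)
    done
  also have "\<dots> = swe2 A a (\<lambda>a1 a2. swe2 H h (\<lambda>h1 h2. h1 (antipode A a1) * h2 a2))"
    unfolding swe2_def by (rule tlift_swap)
  also have "\<dots> = swe2 A a (\<lambda>a1 a2. h (mult A (antipode A a1) a2))"
  proof (rule cA.swe2_cong[OF a])
    fix p q assume p: "p \<in> carr A" and q: "q \<in> carr A"
    show "swe2 H h (\<lambda>h1 h2. h1 (antipode A p) * h2 q) = h (mult A (antipode A p) q)"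
      by (rule swe2_H_pairing[OF h antipode_A_mem[OF p] q])
  qed
  also have "\<dots> = h (swe2 A a (\<lambda>a1 a2. mult A (antipode A a1) a2))"
    by (intro cA.swe2_apply_lin[OF a vec_space_A H_lin[OF h], symmetric] mult_A_mem antipode_A_mem)
  also have "\<dots> = fscal (h (unity A)) (unity H) a"
    using hopf a linD(3)[OF H_lin[OF h] unity_A]
    by (simp add: hopf_algebra_def fscal_def unity_H_apply mult.commute)
  finally show "swe2 H h (\<lambda>h1 h2. mult H (antipode H h1) h2) a = fscal (h (unity A)) (unity H) a" .
qed

lemma grouplike_unity_A: "comult A (unity A) = tpure A A (unity A) (unity A)"
  using bialgebra_A by (simp add: bialgebra_def)

text \<open>
  Dual to the multiplicativity of the counit of \<open>A\<close>.
\<close>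

lemma grouplike_unity_H: "comult H (unity H) = tpure H H (unity H) (unity H)"
proof -
  have "unity H (mult A a b) = unity H a * unity H b" if "a \<in> carr A" "b \<in> carr A" for a b
    using bialgebra_A that by (simp add: unity_H_apply mult_A_mem bialgebra_def)
  then show ?thesis
    unfolding comult_H[OF unity_H] bilin_expand_H[OF bilin_tpure vec_space_tensor unity_H unity_H]
    by (intro sum.cong refl) (simp add: F_mem)
qed

lemmas swe2_A_unity = cA.swe2_grouplike[OF unity_A grouplike_unity_A]
  and swe2_H_unity = cH.swe2_grouplike[OF unity_H grouplike_unity_H]
  and swe3_A_unity = cA.swe3_grouplike[OF unity_A grouplike_unity_A]
  and swe3_H_unity = cH.swe3_grouplike[OF unity_H grouplike_unity_H]

lemma counit_mult_A: "a \<in> carr A \<Longrightarrow> b \<in> carr A \<Longrightarrow> counit A (mult A a b) = counit A a * counit A b"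
  and counit_unity_A: "counit A (unity A) = 1"
  using bialgebra_A by (auto simp: bialgebra_def)

text \<open>
  The antipode axiom at the unit.
\<close>

lemma antipode_unity_A: "antipode A (unity A) = unity A"
proof -
  have "swe2 A (unity A) (\<lambda>x y. mult A (antipode A x) y) = mult A (antipode A (unity A)) (unity A)"
    by (intro swe2_A_unity[OF vec_space_A] bilinI lin_bilin_left[OF bilin_mult_A]
        lin_bilin_right[OF bilin_mult_A] lin_antipode_A lin_id antipode_A_mem)
  then show ?thesis
    using hopf unity_A
    by (simp add: hopf_algebra_def counit_unity_A scal_one[OF vec_space_A] mult_A_unity antipode_A_mem)
qed

lemma mult_H_apply_unity: "h \<in> carr H \<Longrightarrow> g \<in> carr H \<Longrightarrow> mult H h g (unity A) = h (unity A) * g (unity A)"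
  by (simp add: mult_H_apply[OF unity_A] swe2_A_unity[OF vec_space_ground bilin_H_H])

lemmas lin_intros = lin_sum lin_id
  lin_bilin_left[OF bilin_mult_A] lin_bilin_right[OF bilin_mult_A]
  lin_bilin_left[OF bilin_mult_H] lin_bilin_right[OF bilin_mult_H]
  lin_tpure_left lin_tpure_right

section \<open>The adjoint actions and dual bases\<close>

lemma bilin_Ad_H: "h \<in> carr H \<Longrightarrow> bilin H H H (\<lambda>p q. mult H (mult H (antipode H p) h) q)"
  by (intro bilinI lin_intros lin_antipode_H mult_H_mem antipode_H_mem)

lemma bilin_Ad_A: "a \<in> carr A \<Longrightarrow> bilin A A A (\<lambda>p q. mult A (mult A (antipode A p) a) q)"
  by (intro bilinI lin_intros lin_antipode_A mult_A_mem antipode_A_mem)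

lemma lin_Ad_A: "a \<in> carr A \<Longrightarrow> lin A A (\<lambda>x. Ad A x a)"
  unfolding Ad_def by (intro cA.lin_swe2[OF vec_space_A] bilin_Ad_A lin_id)

text \<open>
  The coefficients \<open>u (F\<^sub>i F\<^sub>j)\<close> that the calculus produces are those of the coproduct of \<open>u\<close>.
\<close>

lemma Ad_H_sum:
  assumes u: "u \<in> carr H" and h: "h \<in> carr H"
  shows "Ad H u h = (\<Sum>i\<in>I. \<Sum>j\<in>I. fscal (u (mult A (F i) (F j))) (mult H (mult H (antipode H
      (E i)) h) (E j)))"
  unfolding Ad_def swe2_H[OF u vec_space_H bilin_Ad_H[OF h]] by simp

text \<open>
  Both sides are the functional \<open>b \<mapsto> u (Ad\<^sub>b a)\<close>.  On the left the dual bases reproduce the two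
  factors in \<open>u ((S b\<^sub>(\<^sub>1\<^sub>)) a b\<^sub>(\<^sub>2\<^sub>))\<close>; on the right \<open>b\<close> is expanded in the basis \<open>F\<close>.
\<close>

lemma Ad_A_dual:
  assumes u: "u \<in> carr H" and a: "a \<in> carr A"
  shows "(\<Sum>i\<in>I. \<Sum>j\<in>I. fscal (u (mult A (mult A (F i) a) (F j))) (mult H (antipode H (E i)) (E j))) =
    (\<Sum>i\<in>I. fscal (u (Ad A (F i) a)) (E i))" (is "?l = ?r")
proof (rule H_eqI)
  show "?l \<in> carr H"
    by (intro vec_space_sum[OF vec_space_H] fscal_H_mem mult_H_mem antipode_H_mem E_mem)
  show "?r \<in> carr H"
    by (intro vec_space_sum[OF vec_space_H] fscal_H_mem E_mem)
  fix b assume b: "b \<in> carr A"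
  let ?u = "\<lambda>x y. u (mult A (mult A x a) y)"
  have u1: "lin A ground (\<lambda>x. ?u x y)" if "y \<in> carr A" for y
    by (intro lin_compose[OF H_lin[OF u]] lin_intros that a)
  have u2: "lin A ground (\<lambda>y. ?u x y)" if "x \<in> carr A" for x
    by (intro lin_compose[OF H_lin[OF u]] lin_intros mult_A_mem that a)
  have "?l b = (\<Sum>i\<in>I. \<Sum>j\<in>I. ?u (F i) (F j) * swe2 A b (\<lambda>b1 b2. E i (antipode A b1) * E j b2))"
    unfolding sum_fun_apply fscal_def mult_H_apply[OF b]
    by (intro sum.cong refl arg_cong2[of _ _ _ _ "(*)"] cA.swe2_cong[OF b]) (simp add: antipode_H_apply)
  also have "\<dots> = (\<Sum>i\<in>I. \<Sum>j\<in>I. swe2 A b (\<lambda>b1 b2. ?u (F i) (F j) * (E i (antipode A b1) * E j b2)))"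
    by (intro sum.cong refl cA.swe2_apply_lin[OF b vec_space_ground lin_times_right[OF lin_id]]) simp
  also have "\<dots> = swe2 A b (\<lambda>b1 b2. \<Sum>i\<in>I. \<Sum>j\<in>I. ?u (F i) (F j) * (E i (antipode A b1) * E j b2))"
    by (simp only: cA.swe2_sum)
  also have "\<dots> = swe2 A b (\<lambda>b1 b2. ?u (antipode A b1) b2)"
  proof (rule cA.swe2_cong[OF b])
    fix p q assume p: "p \<in> carr A" and q: "q \<in> carr A"
    have "(\<Sum>i\<in>I. \<Sum>j\<in>I. ?u (F i) (F j) * (E i (antipode A p) * E j q)) =
      (\<Sum>i\<in>I. E i (antipode A p) * (\<Sum>j\<in>I. E j q * ?u (F i) (F j)))"
      by (simp add: sum_distrib_left mult_ac)
    also have "\<dots> = (\<Sum>i\<in>I. E i (antipode A p) * ?u (F i) q)"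
      using lin_expand_A[OF u2[OF F_mem] q] by (intro sum.cong refl) simp
    also have "\<dots> = ?u (antipode A p) q"
      using lin_expand_A[OF u1[OF q] antipode_A_mem[OF p]] by simp
    finally show "(\<Sum>i\<in>I. \<Sum>j\<in>I. ?u (F i) (F j) * (E i (antipode A p) * E j q)) = ?u (antipode A p) q" .
  qed
  also have "\<dots> = u (Ad A b a)"
    unfolding Ad_def
    by (intro cA.swe2_apply_lin[OF b vec_space_A H_lin[OF u], symmetric] mult_A_mem antipode_A_mem a)
  also have "\<dots> = ?r b"
    using lin_expand_A[OF lin_compose[OF H_lin[OF u] lin_Ad_A[OF a]] b]
    by (simp add: sum_fun_apply fscal_def mult.commute)
  finally show "?l b = ?r b" .
qed

section \<open>The quantum codouble\<close>

abbreviation "C \<equiv> codouble A I E F"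

lemma carr_C [simp]: "carr C = carr (tensor H A)" "scal C = fscal"
  and unity_C: "unity C = tpure H A (unity H) (unity A)"
  and mult_C: "mult C = tensor_mult H A"
  by (simp_all add: codouble_def Let_def H_def)

lemma vec_space_C: "vec_space C"
  using vec_space_tensor[of H A] by (simp add: vec_space_def)

lemma C_cong: "tpure (tensor H A) (tensor H A) = tpure C C" "tensor (tensor H A) (tensor H A) =
    tensor C C"
  by (auto intro!: tpure_carr_cong tensor_carr_cong)

lemma lin_C: "lin C U f = lin (tensor H A) U f" "lin V C g = lin V (tensor H A) g"
  by (simp_all add: lin_def)

definition codouble_coproduct :: "('a \<Rightarrow> 'k) \<Rightarrow> 'a \<Rightarrow> _" where
  "codouble_coproduct h a = swe2 H h (\<lambda>h1 h2. swe2 A a (\<lambda>a1 a2. \<Sum>i\<in>I. \<Sum>j\<in>I. tpure C C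
     (tpure H A h2 (mult A (mult A (F i) a1) (F j)))
     (tpure H A (mult H (mult H (antipode H (E i)) h1) (E j)) a2)))"

lemma comult_C: "comult C = tlift H A codouble_coproduct"
  unfolding codouble_coproduct_def[abs_def] C_cong(1)[symmetric]
  by (simp add: codouble_def Let_def H_def)

lemma bilin_codouble_coproduct: "bilin H A (tensor C C) codouble_coproduct"
  unfolding codouble_coproduct_def
  by (intro bilinI cH.lin_swe2[OF vec_space_tensor _ lin_id] cA.lin_swe2[OF vec_space_tensor _ lin_id]
      cH.lin_swe2_param[OF _ vec_space_tensor] cA.lin_swe2_param[OF _ vec_space_tensor]
      lin_sum[OF vec_space_tensor] lin_tpure_left lin_tpure_right lin_C(2)[THEN iffD2]
      lin_bilin_left[OF bilin_mult_A] lin_bilin_right[OF bilin_mult_A]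
      lin_bilin_left[OF bilin_mult_H] lin_bilin_right[OF bilin_mult_H] lin_id)
    (auto intro!: tpure_mem mult_A_mem mult_H_mem antipode_H_mem E_mem F_mem)

sublocale cC: comultiplication C
  by unfold_locales
    (auto simp: comult_C lin_C(1) vec_space_C intro!: lin_tlift vec_space_H vec_space_tensor
        bilin_codouble_coproduct)

lemma swe2_C:
  assumes U: "vec_space U" and f: "bilin C C U f" and h: "h \<in> carr H" and a: "a \<in> carr A"
  shows "swe2 C (tpure H A h a) f = swe2 H h (\<lambda>h1 h2. swe2 A a (\<lambda>a1 a2. \<Sum>i\<in>I. \<Sum>j\<in>I. f
     (tpure H A h2 (mult A (mult A (F i) a1) (F j)))
     (tpure H A (mult H (mult H (antipode H (E i)) h1) (E j)) a2)))"
proof -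
  note L = lin_tlift[OF vec_space_C U f]
  have c: "tpure H A h (mult A (mult A (F i) b) (F j)) \<in> carr C"
    "tpure H A (mult H (mult H (antipode H (E i)) h) (E j)) b \<in> carr C"
    if "h \<in> carr H" "b \<in> carr A" "i \<in> I" "j \<in> I" for h b i j
    using that by (auto intro!: tpure_mem mult_A_mem mult_H_mem antipode_H_mem E_mem F_mem)
  have "swe2 C (tpure H A h a) f = tlift C C f (codouble_coproduct h a)"
    by (simp add: swe2_def comult_C tlift_tpure[OF vec_space_H vec_space_tensor
        bilin_codouble_coproduct h a])
  also have "\<dots> = swe2 H h (\<lambda>h1 h2. swe2 A a (\<lambda>a1 a2. \<Sum>i\<in>I. \<Sum>j\<in>I. f
     (tpure H A h2 (mult A (mult A (F i) a1) (F j)))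
     (tpure H A (mult H (mult H (antipode H (E i)) h1) (E j)) a2)))"
    unfolding codouble_coproduct_def
    apply (subst cH.swe2_apply_lin[OF h vec_space_tensor L])
     apply (intro cA.swe2_mem[OF a vec_space_tensor] vec_space_sum[OF vec_space_tensor] tpure_mem
         c; assumption)
    apply (rule cH.swe2_cong[OF h])
    apply (subst cA.swe2_apply_lin[OF a vec_space_tensor L])
     apply (intro vec_space_sum[OF vec_space_tensor] tpure_mem c; assumption)
    apply (rule cA.swe2_cong[OF a])
    apply (subst lin_apply_sum2[OF L vec_space_tensor])
     apply (intro tpure_mem c; assumption)
    apply (intro sum.cong refl tlift_tpure[OF vec_space_C U f] c; assumption)
    done
  finally show ?thesis .
qed

lemma codouble_H_A: "codouble_H A h = tpure H A h (unity A)" "codouble_A A a = tpure H A (unity H) a"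
  by (simp_all add: codouble_H_def codouble_A_def H_def)

lemma swe2_codouble_H:
  assumes U: "vec_space U" and f: "bilin C C U f" and h: "h \<in> carr H"
  shows "swe2 C (codouble_H A h) f = swe2 H h (\<lambda>h1 h2. \<Sum>i\<in>I. \<Sum>j\<in>I. f
     (tpure H A h2 (mult A (F i) (F j)))
     (codouble_H A (mult H (mult H (antipode H (E i)) h1) (E j))))"
proof -
  have "bilin A A U (\<lambda>a1 a2. \<Sum>i\<in>I. \<Sum>j\<in>I. f
     (tpure H A h2 (mult A (mult A (F i) a1) (F j)))
     (tpure H A (mult H (mult H (antipode H (E i)) h1) (E j)) a2))" if "h1 \<in> carr H" "h2 \<in> carr H"
         for h1 h2
    using that
    by (intro bilinI lin_sum[OF U] lin_bilin_left[OF f] lin_bilin_right[OF f] lin_C(2)[THEN iffD2]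
        lin_intros)
      (auto intro!: tpure_mem mult_A_mem mult_H_mem antipode_H_mem E_mem F_mem)
  then show ?thesis
    unfolding codouble_H_A(1) swe2_C[OF U f h unity_A]
    by (intro cH.swe2_cong[OF h]) (simp add: swe2_A_unity[OF U] mult_A_unity F_mem)
qed

lemma swe2_codouble_A:
  assumes U: "vec_space U" and f: "bilin C C U f" and a: "a \<in> carr A"
  shows "swe2 C (codouble_A A a) f = swe2 A a (\<lambda>a1 a2. \<Sum>i\<in>I. \<Sum>j\<in>I. f
     (tpure H A (unity H) (mult A (mult A (F i) a1) (F j)))
     (tpure H A (mult H (antipode H (E i)) (E j)) a2))"
proof -
  have b: "bilin H H U (\<lambda>h1 h2. swe2 A a (\<lambda>a1 a2. \<Sum>i\<in>I. \<Sum>j\<in>I. f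
     (tpure H A h2 (mult A (mult A (F i) a1) (F j)))
     (tpure H A (mult H (mult H (antipode H (E i)) h1) (E j)) a2)))"
    using a
    by (intro bilinI cA.lin_swe2_param[OF a U] lin_sum[OF U] lin_bilin_left[OF f] lin_bilin_right[OF f]
        lin_C(2)[THEN iffD2] lin_intros)
      (auto intro!: tpure_mem mult_A_mem mult_H_mem antipode_H_mem E_mem F_mem)
  show ?thesis
    unfolding codouble_H_A(2) swe2_C[OF U f unity_H a] swe2_H_unity[OF U b]
    by (simp add: mult_H_unity antipode_H_mem E_mem)
qed

text \<open>
  Suppose that \<open>P\<close> sees only the factor from \<open>H\<close> and \<open>Q\<close> only the one from \<open>A\<close>, with counits on the
  other factors.  The counits turn the two dual bases in the coproduct of the codouble into
  \<open>\<Sum>\<^sub>i \<epsilon>(F\<^sub>i) E\<^sub>i(1) = \<epsilon>(1) = 1\<close> and remove \<open>g\<^sub>(\<^sub>1\<^sub>)\<close> and \<open>b\<^sub>(\<^sub>1\<^sub>)\<close>, so that the sum factorises.  The two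
  slices of the universal R-matrix have this form.
\<close>

lemma swe2_codouble_collapse:
  assumes P: "lin C ground P" "\<And>g b. g \<in> carr H \<Longrightarrow> b \<in> carr A \<Longrightarrow> P (tpure H A g b) = counit A b * \<phi> g"
    and Q: "lin C ground Q" "\<And>g b. g \<in> carr H \<Longrightarrow> b \<in> carr A \<Longrightarrow> Q (tpure H A g b) = g (unity A) * \<psi> b"
    and \<phi>: "lin H ground \<phi>" and \<psi>: "lin A ground \<psi>"
    and g: "g \<in> carr H" and b: "b \<in> carr A"
  shows "swe2 C (tpure H A g b) (\<lambda>x y. P x * Q y) = \<phi> g * \<psi> b"
proof -
  have e: "(\<Sum>i\<in>I. counit A (F i) * E i (unity A)) = 1"
    using lin_expand_A[OF lin_counit_A unity_A] by (simp add: counit_unity_A mult.commute)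
  have "bilin C C ground (\<lambda>x y. P x * Q y)"
    by (intro bilinI lin_times_left lin_times_right P(1) Q(1))
  then have "swe2 C (tpure H A g b) (\<lambda>x y. P x * Q y) =
    swe2 H g (\<lambda>g1 g2. swe2 A b (\<lambda>b1 b2. \<Sum>i\<in>I. \<Sum>j\<in>I.
      P (tpure H A g2 (mult A (mult A (F i) b1) (F j))) *
      Q (tpure H A (mult H (mult H (antipode H (E i)) g1) (E j)) b2)))"
    by (rule swe2_C[OF vec_space_ground _ g b])
  also have "\<dots> = swe2 H g (\<lambda>g1 g2. swe2 A b (\<lambda>b1 b2. g1 (unity A) * \<phi> g2 * (counit A b1 * \<psi> b2)))"
  proof (intro cH.swe2_cong[OF g] cA.swe2_cong[OF b])
    fix g1 g2 b1 b2 assume m: "g1 \<in> carr H" "g2 \<in> carr H" "b1 \<in> carr A" "b2 \<in> carr A"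
    have "(\<Sum>i\<in>I. \<Sum>j\<in>I.
      P (tpure H A g2 (mult A (mult A (F i) b1) (F j))) *
      Q (tpure H A (mult H (mult H (antipode H (E i)) g1) (E j)) b2)) =
      (\<Sum>i\<in>I. \<Sum>j\<in>I. (counit A (F i) * E i (unity A)) * (counit A (F j) * E j (unity A)) *
        (g1 (unity A) * \<phi> g2 * (counit A b1 * \<psi> b2)))"
      using m
      by (intro sum.cong refl)
        (simp add: P(2) Q(2) mult_A_mem mult_H_mem antipode_H_mem E_mem F_mem counit_mult_A
          mult_H_apply_unity antipode_H_apply[OF unity_A] antipode_unity_A mult_ac)
    also have "\<dots> = (\<Sum>i\<in>I. counit A (F i) * E i (unity A)) * (\<Sum>i\<in>I. counit A (F i) * E i (unity A)) *
      (g1 (unity A) * \<phi> g2 * (counit A b1 * \<psi> b2))"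
      by (subst sum_product) (simp only: sum_distrib_right)
    finally show "(\<Sum>i\<in>I. \<Sum>j\<in>I.
      P (tpure H A g2 (mult A (mult A (F i) b1) (F j))) *
      Q (tpure H A (mult H (mult H (antipode H (E i)) g1) (E j)) b2)) =
      g1 (unity A) * \<phi> g2 * (counit A b1 * \<psi> b2)" by (simp add: e)
  qed
  also have "\<dots> = swe2 H g (\<lambda>g1 g2. g1 (unity A) * (\<phi> g2 * \<psi> b))"
  proof (intro cH.swe2_cong[OF g])
    fix g1 g2
    show "swe2 A b (\<lambda>b1 b2. g1 (unity A) * \<phi> g2 * (counit A b1 * \<psi> b2)) = g1 (unity A) * (\<phi> g2 * \<psi> b)"
      using swe2_A_counit(1)[OF b \<psi> vec_space_ground]
        cA.swe2_apply_lin[OF b vec_space_ground lin_times_right[OF lin_id], of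
            "\<lambda>b1 b2. counit A b1 * \<psi> b2" "g1 (unity A) * \<phi> g2"]
      by (simp add: mult.assoc)
  qed
  also have "\<dots> = \<phi> g * \<psi> b"
    using swe2_H_counit[OF g vec_space_ground lin_times_left[OF \<phi>], of "\<psi> b"] by simp
  finally show ?thesis .
qed

lemma mult_C_tpure:
  assumes "h \<in> carr H" "g \<in> carr H" "a \<in> carr A" "b \<in> carr A"
  shows "mult C (tpure H A h a) (tpure H A g b) = tpure H A (mult H h g) (mult A a b)"
proof -
  have m: "bilin H A (tensor H A) (\<lambda>g b. tpure H A (mult H h g) (mult A a b))" if "h \<in> carr H"
      "a \<in> carr A" for h a
    using that by (intro bilinI lin_intros mult_H_mem mult_A_mem)
  have "bilin H A (tensor H A) (\<lambda>h a. tlift H A (\<lambda>g b. tpure H A (mult H h g) (mult A a b))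
      (tpure H A g b))"
    using assms by (intro bilinI lin_tlift_param[OF vec_space_H vec_space_tensor] lin_intros
        tpure_mem mult_H_mem mult_A_mem)
  from tlift_tpure[OF vec_space_H vec_space_tensor this assms(1,3)]
  show ?thesis
    by (simp add: mult_C tensor_mult_def tlift_tpure[OF vec_space_H vec_space_tensor m] assms)
qed

lemma bilin_mult_C: "bilin C C C (mult C)"
proof -
  have m: "bilin H A (tensor H A) (\<lambda>g b. tpure H A (mult H h g) (mult A a b))" if "h \<in> carr H"
      "a \<in> carr A" for h a
    using that by (intro bilinI lin_intros mult_H_mem mult_A_mem)
  have b: "bilin H A (tensor H A) (\<lambda>h a. tlift H A (\<lambda>g b. tpure H A (mult H h g) (mult A a b)) t)"
    if "t \<in> carr (tensor H A)" for t
    using that by (intro bilinI lin_tlift_param[OF vec_space_H vec_space_tensor] lin_intros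
        mult_H_mem mult_A_mem)
  show ?thesis
  proof (rule bilinI)
    fix t assume "t \<in> carr C"
    then show "lin C C (\<lambda>s. mult C s t)"
      unfolding mult_C tensor_mult_def lin_C by (intro lin_tlift vec_space_H vec_space_tensor b) simp
  next
    fix s assume "s \<in> carr C"
    then show "lin C C (mult C s)"
      unfolding mult_C tensor_mult_def lin_C
      by (intro lin_tlift_param[OF vec_space_H vec_space_tensor] lin_tlift vec_space_H
          vec_space_tensor m) simp_all
  qed
qed

lemma unity_C_mem: "unity C \<in> carr C"
  by (simp add: unity_C tpure_mem unity_H unity_A)

lemma mult_C_unity: "x \<in> carr C \<Longrightarrow> mult C x (unity C) = x"
  using tensor_ext[OF vec_space_H, of A "tensor H A" "\<lambda>x. mult C x (unity C)" "\<lambda>x. x" x]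
    bilinD(1)[OF bilin_mult_C unity_C_mem]
  by (simp add: lin_C lin_id unity_C mult_C_tpure unity_H unity_A mult_H_unity mult_A_unity)

lemma codouble_H_mem: "h \<in> carr H \<Longrightarrow> codouble_H A h \<in> carr C"
  by (simp add: codouble_H_A tpure_mem unity_A)

lemma tpure_C_mem: "h \<in> carr H \<Longrightarrow> a \<in> carr A \<Longrightarrow> tpure H A h a \<in> carr C"
  by (simp add: tpure_mem)

lemma lin_codouble_H: "lin V H p \<Longrightarrow> lin V C (\<lambda>x. codouble_H A (p x))"
  unfolding codouble_H_A lin_C by (intro lin_intros unity_A)

section \<open>The quantum double and the slices of its R-matrix\<close>

abbreviation "D \<equiv> double A"

lemma carr_D [simp]: "carr D = carr (tensor A H)" "scal D = fscal"
  by (simp_all add: double_def Let_def H_def)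

lemma vec_space_D: "vec_space D"
  using vec_space_tensor[of A H] by (simp add: vec_space_def)

lemma lin_D: "lin D U f = lin (tensor A H) U f" "lin V D g = lin V (tensor A H) g"
  by (simp_all add: lin_def)

definition double_product :: "'a \<Rightarrow> ('a \<Rightarrow> 'k) \<Rightarrow> 'a \<Rightarrow> ('a \<Rightarrow> 'k) \<Rightarrow> _" where
  "double_product a h b g = swe3 A b (\<lambda>b1 b2 b3. swe3 H h (\<lambda>h1 h2 h3.
     fscal ((antipode H h1) b1 * h3 b3) (tpure A H (mult A b2 a) (mult H h2 g))))"

lemma mult_D: "mult D s t = tlift A H (\<lambda>a h. tlift A H (double_product a h) t) s"
  unfolding double_product_def[abs_def]
  by (simp add: double_def Let_def H_def)

lemma lin_double_product:
  assumes "a \<in> carr A" "b \<in> carr A" "h \<in> carr H" "g \<in> carr H"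
  shows "lin A (tensor A H) (\<lambda>a. double_product a h b g)" "lin H (tensor A H)
      (\<lambda>h. double_product a h b g)"
    "lin A (tensor A H) (\<lambda>b. double_product a h b g)" "lin H (tensor A H) (\<lambda>g. double_product a h b g)"
  unfolding double_product_def using assms
  by (auto intro!: cA.lin_swe3[OF vec_space_tensor lin_id] cH.lin_swe3[OF vec_space_tensor lin_id]
      cH.lin_swe3_param[OF _ vec_space_tensor] cA.lin_swe3_param[OF _ vec_space_tensor]
      lin_fscal lin_fscal_coeff lin_times_left lin_times_right lin_intros antipode_H_mem
      tpure_mem mult_A_mem mult_H_mem lin_eval lin_compose[OF lin_eval lin_antipode_H] intro: H_lin)

lemma bilin_double_product: "a \<in> carr A \<Longrightarrow> h \<in> carr H \<Longrightarrow> bilin A H (tensor A H) (double_product a h)"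
  by (intro bilinI lin_double_product)

lemma bilin_mult_D: "bilin D D D (mult D)"
proof -
  have b: "bilin A H (tensor A H) (\<lambda>a h. tlift A H (double_product a h) t)" if "t \<in> carr
      (tensor A H)" for t
    using that by (intro bilinI lin_tlift_param[OF vec_space_A vec_space_tensor] lin_double_product)
  show ?thesis
  proof (rule bilinI)
    fix t assume t: "t \<in> carr D"
    show "lin D D (\<lambda>s. mult D s t)"
      using t unfolding mult_D lin_D by (intro lin_tlift vec_space_A vec_space_tensor b) simp
  next
    fix s assume s: "s \<in> carr D"
    show "lin D D (mult D s)"
      using s unfolding mult_D lin_D
      by (intro lin_tlift_param[OF vec_space_A vec_space_tensor] lin_tlift vec_space_A vec_space_tensor
          bilin_double_product) simp_all
  qed
qed

lemma mult_D_tpure: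
  assumes "a \<in> carr A" "b \<in> carr A" "h \<in> carr H" "g \<in> carr H"
  shows "mult D (tpure A H a h) (tpure A H b g) = double_product a h b g"
proof -
  have "bilin A H (tensor A H) (\<lambda>a h. tlift A H (double_product a h) (tpure A H b g))"
    using assms by (intro bilinI lin_tlift_param[OF vec_space_A vec_space_tensor]
        lin_double_product tpure_mem)
  from tlift_tpure[OF vec_space_A vec_space_tensor this assms(1,3)]
  show ?thesis
    unfolding mult_D
    by (simp add: tlift_tpure[OF vec_space_A vec_space_tensor bilin_double_product assms(2,4)] assms)
qed

text \<open>
  One cross relation of the double is trivial: the coproducts of the two units are pure tensors, and
  the pairings contribute \<open>1\<close>.
\<close>

lemma mult_D_A_H:
  assumes a: "a \<in> carr A" and g: "g \<in> carr H"
  shows "mult D (tpure A H a (unity H)) (tpure A H (unity A) g) = tpure A H a g"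
proof -
  let ?f = "\<lambda>h b1 b2 b3. swe3 H h (\<lambda>h1 h2 h3.
     fscal ((antipode H h1) b1 * h3 b3) (tpure A H (mult A b2 a) (mult H h2 g)))"
  have "double_product a (unity H) (unity A) g = ?f (unity H) (unity A) (unity A) (unity A)"
    unfolding double_product_def using a g unity_H
    by (intro swe3_A_unity[OF vec_space_tensor])
      (auto intro!: cH.lin_swe3_param[OF _ vec_space_tensor]
      lin_fscal lin_fscal_coeff lin_times_left lin_times_right lin_intros antipode_H_mem
      tpure_mem mult_A_mem mult_H_mem intro: H_lin)
  also have "\<dots> = fscal ((antipode H (unity H)) (unity A) * unity H (unity A))
     (tpure A H (mult A (unity A) a) (mult H (unity H) g))"
    using a g unity_A
    by (intro swe3_H_unity[OF vec_space_tensor])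
      (auto intro!: lin_fscal lin_fscal_coeff lin_times_left lin_times_right lin_intros antipode_H_mem
      tpure_mem mult_A_mem mult_H_mem lin_eval lin_compose[OF lin_eval lin_antipode_H])
  also have "\<dots> = tpure A H a g"
    using a g by (simp add: antipode_H_apply unity_A antipode_unity_A unity_H_apply counit_unity_A
        mult_A_unity mult_H_unity fscal_1)
  finally show ?thesis
    using mult_D_tpure[OF a unity_A unity_H g] by simp
qed

lemma dpair_eq: "dpair A u x = tlift A H (\<lambda>a h. tlift H A (\<lambda>g b. g a * h b) x) u"
  by (simp add: dpair_def Let_def H_def)

lemma bilin_dpair: "bilin D C ground (dpair A)"
proof (rule bilinI)
  fix x assume "x \<in> carr C"
  then show "lin D ground (\<lambda>u. dpair A u x)"
    unfolding dpair_eq lin_D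
    by (intro lin_tlift vec_space_A vec_space_ground bilinI lin_tlift_param[OF vec_space_H
        vec_space_ground]
        lin_times_left lin_times_right H_lin lin_eval) auto
next
  fix u assume "u \<in> carr D"
  then show "lin C ground (dpair A u)"
    unfolding dpair_eq lin_C
    by (intro lin_tlift_param[OF vec_space_A vec_space_ground] lin_tlift vec_space_H
        vec_space_ground bilinI
        lin_times_left lin_times_right H_lin lin_eval) auto
qed

lemma dpair_tpure:
  assumes "a \<in> carr A" "b \<in> carr A" "h \<in> carr H" "g \<in> carr H"
  shows "dpair A (tpure A H a h) (tpure H A g b) = g a * h b"
proof -
  have "bilin A H ground (\<lambda>a h. tlift H A (\<lambda>g b. g a * h b) (tpure H A g b))"
    using assms by (intro bilinI lin_tlift_param[OF vec_space_H vec_space_ground]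
        lin_times_left lin_times_right H_lin lin_eval tpure_mem)
  from tlift_tpure[OF vec_space_A vec_space_ground this assms(1,3)]
  have "dpair A (tpure A H a h) (tpure H A g b) = tlift H A (\<lambda>g b. g a * h b) (tpure H A g b)"
    unfolding dpair_eq .
  also have "\<dots> = g a * h b"
    using assms by (intro tlift_tpure[OF vec_space_H vec_space_ground] bilinI lin_times_left
        lin_times_right H_lin lin_eval)
  finally show ?thesis .
qed

abbreviation "R \<equiv> Rmat A I E F"

abbreviation "Q \<equiv> Qmat A I E F"

lemma inA_D: "a \<in> carr A \<Longrightarrow> tpure A H a (unity H) \<in> carr D"
  and inH_D: "h \<in> carr H \<Longrightarrow> tpure A H (unity A) h \<in> carr D"
  by (auto intro: tpure_mem unity_A unity_H)

lemma R_eq: "R = (\<Sum>i\<in>I. tpure D D (tpure A H (F i) (unity H)) (tpure A H (unity A) (E i)))"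
  by (simp add: Rmat_def Let_def H_def)

lemma R_mem: "R \<in> carr (tensor D D)"
  unfolding R_eq by (intro vec_space_sum[OF vec_space_tensor] tpure_mem inA_D inH_D E_mem F_mem)

text \<open>
  In \<open>\<R>\<^sub>2\<^sub>1 \<R>\<close> the products in the second tensor factor are in normal order, so that pairing them with
  an element of the codouble is immediate; the products in the first factor are left as they are.
\<close>

lemma Q_eq: "Q = (\<Sum>i\<in>I. \<Sum>j\<in>I. tpure D D
    (mult D (tpure A H (unity A) (E i)) (tpure A H (F j) (unity H))) (tpure A H (F i) (E j)))"
proof -
  let ?a = "\<lambda>i. tpure A H (F i) (unity H)" and ?h = "\<lambda>i. tpure A H (unity A) (E i)"
  let ?g = "\<lambda>s t s' t'. tpure D D (mult D s s') (mult D t t')"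
  have g: "bilin D D (tensor D D) (?g s t)" if "s \<in> carr D" "t \<in> carr D" for s t
    using that by (intro bilinI lin_tpure_left lin_tpure_right lin_bilin_right[OF bilin_mult_D] lin_id
        bilinD(3)[OF bilin_mult_D])
  have "tlift D D (\<lambda>u v. tpure D D v u) R = (\<Sum>i\<in>I. tpure D D (?h i) (?a i))"
    unfolding R_eq
    by (intro tlift_sum_tpure[OF vec_space_D vec_space_tensor[of D D]] bilinI lin_tpure_left
        lin_tpure_right lin_id inA_D inH_D E_mem F_mem)
  then have "Q = tlift D D (\<lambda>s t. tlift D D (?g s t) R) (\<Sum>i\<in>I. tpure D D (?h i) (?a i))"
    by (simp add: Qmat_def Let_def tensor_mult_def)
  also have "\<dots> = (\<Sum>i\<in>I. tlift D D (?g (?h i) (?a i)) R)"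
    by (intro tlift_sum_tpure[OF vec_space_D vec_space_tensor[of D D]] bilinI
        lin_tlift_param[OF vec_space_D vec_space_tensor R_mem] lin_tpure_left lin_tpure_right
        lin_bilin_left[OF bilin_mult_D] lin_id inA_D inH_D E_mem F_mem bilinD(3)[OF bilin_mult_D])
  also have "\<dots> = (\<Sum>i\<in>I. \<Sum>j\<in>I. ?g (?h i) (?a i) (?a j) (?h j))"
    unfolding R_eq
    by (intro sum.cong refl tlift_sum_tpure[OF vec_space_D vec_space_tensor[of D D]] g inA_D inH_D
        E_mem F_mem)
  also have "\<dots> = (\<Sum>i\<in>I. \<Sum>j\<in>I. tpure D D (mult D (?h i) (?a j)) (tpure A H (F i) (E j)))"
    by (intro sum.cong refl) (simp add: mult_D_A_H E_mem F_mem)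
  finally show ?thesis .
qed

lemma Q_mem: "Q \<in> carr (tensor D D)"
proof -
  have "tpure A H (F i) (E j) \<in> carr D" if "i \<in> I" "j \<in> I" for i j
    using that by (auto intro: tpure_mem E_mem F_mem)
  then show ?thesis
    unfolding Q_eq by (intro vec_space_sum[OF vec_space_tensor] tpure_mem bilinD(3)[OF
        bilin_mult_D] inA_D inH_D E_mem F_mem)
qed

lemma bilin_slice1: "x \<in> carr C \<Longrightarrow> bilin D D D (\<lambda>u v. fscal (dpair A u x) v)"
  and bilin_slice2: "x \<in> carr C \<Longrightarrow> bilin D D D (\<lambda>u v. fscal (dpair A v x) u)"
  by (intro bilinI; simp add: lin_D(2);
    intro lin_fscal lin_fscal_coeff bilinD(1)[OF bilin_dpair] lin_id[of D, unfolded lin_D(2)]; simp)+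

lemma lin_slice1: "T \<in> carr (tensor D D) \<Longrightarrow> lin C D (slice1 A T)"
  and lin_slice2: "T \<in> carr (tensor D D) \<Longrightarrow> lin C D (slice2 A T)"
  unfolding slice1_def slice2_def lin_D(2)
  by (intro lin_tlift_param[OF vec_space_D vec_space_tensor] lin_fscal_coeff bilinD(2)[OF
      bilin_dpair]; simp)+

text \<open>
  In this lemma and the two after it, the dual bases in \<open>\<R>\<close> or \<open>\<Q>\<close> expand the elements \<open>g\<close> and \<open>b\<close>
  with which they are paired.
\<close>

lemma slice1_R:
  assumes g: "g \<in> carr H" and b: "b \<in> carr A"
  shows "slice1 A R (tpure H A g b) = fscal (counit A b) (tpure A H (unity A) g)"
proof -
  have x: "tpure H A g b \<in> carr C" using g b by (simp add: tpure_mem)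
  have "slice1 A R (tpure H A g b) = (\<Sum>i\<in>I. fscal (dpair A (tpure A H (F i) (unity H))
      (tpure H A g b)) (tpure A H (unity A) (E i)))"
    unfolding slice1_def R_eq
    by (intro tlift_sum_tpure[OF vec_space_D vec_space_D bilin_slice1[OF x]] inA_D inH_D E_mem F_mem)
  also have "\<dots> = (\<Sum>i\<in>I. fscal (counit A b) (fscal (g (F i)) (tpure A H (unity A) (E i))))"
    by (intro sum.cong refl) (simp add: dpair_tpure F_mem unity_H g b unity_H_apply fscal_fscal
        mult.commute)
  also have "\<dots> = fscal (counit A b) (tpure A H (unity A) g)"
    using lin_expand_H[OF lin_tpure_right[OF unity_A lin_id] g] by (simp add: fscal_sum[symmetric])
  finally show ?thesis .
qed

lemma slice2_R:
  assumes g: "g \<in> carr H" and b: "b \<in> carr A"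
  shows "slice2 A R (tpure H A g b) = fscal (g (unity A)) (tpure A H b (unity H))"
proof -
  have x: "tpure H A g b \<in> carr C" using g b by (simp add: tpure_mem)
  have "slice2 A R (tpure H A g b) = (\<Sum>i\<in>I. fscal (dpair A (tpure A H (unity A) (E i))
      (tpure H A g b)) (tpure A H (F i) (unity H)))"
    unfolding slice2_def R_eq
    by (intro tlift_sum_tpure[OF vec_space_D vec_space_D bilin_slice2[OF x]] inA_D inH_D E_mem F_mem)
  also have "\<dots> = (\<Sum>i\<in>I. fscal (g (unity A)) (fscal (E i b) (tpure A H (F i) (unity H))))"
    by (intro sum.cong refl) (simp add: dpair_tpure E_mem unity_A g b fscal_fscal)
  also have "\<dots> = fscal (g (unity A)) (tpure A H b (unity H))"
    using lin_expand_A[OF lin_tpure_left[OF lin_id unity_H] b] by (simp add: fscal_sum[symmetric])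
  finally show ?thesis .
qed

lemma slice2_Q:
  assumes g: "g \<in> carr H" and b: "b \<in> carr A"
  shows "slice2 A Q (tpure H A g b) = mult D (tpure A H (unity A) g) (tpure A H b (unity H))"
proof -
  let ?m = "\<lambda>g b. mult D (tpure A H (unity A) g) (tpure A H b (unity H))"
  have x: "tpure H A g b \<in> carr C" using g b by (simp add: tpure_mem)
  have m: "?m g b \<in> carr D" if "g \<in> carr H" "b \<in> carr A" for g b
    using that by (intro bilinD(3)[OF bilin_mult_D] inA_D inH_D)
  have FE: "tpure A H (F i) (E j) \<in> carr D" if "i \<in> I" "j \<in> I" for i j
    using that by (auto intro: tpure_mem E_mem F_mem)
  have lg: "lin H D (\<lambda>g. ?m g b)" if "b \<in> carr A" for b
    using that by (intro lin_bilin_left[OF bilin_mult_D] inA_D lin_D(2)[THEN iffD2]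
        lin_tpure_right lin_id unity_A)
  have lb: "lin A D (\<lambda>b. ?m g b)" if "g \<in> carr H" for g
    using that by (intro lin_bilin_right[OF bilin_mult_D] inH_D lin_D(2)[THEN iffD2]
        lin_tpure_left lin_id unity_H)
  note L = lin_tlift[OF vec_space_D vec_space_D bilin_slice2[OF x]]
  have "slice2 A Q (tpure H A g b) = (\<Sum>i\<in>I. \<Sum>j\<in>I. fscal (dpair A (tpure A H (F i) (E j))
      (tpure H A g b)) (?m (E i) (F j)))"
    unfolding slice2_def Q_eq
    by (subst lin_apply_sum2[OF L vec_space_tensor])
      (intro sum.cong refl tpure_mem tlift_tpure[OF vec_space_D vec_space_D bilin_slice2[OF x]] m
          FE E_mem F_mem; assumption)+
  also have "\<dots> = (\<Sum>i\<in>I. fscal (g (F i)) (\<Sum>j\<in>I. fscal (E j b) (?m (E i) (F j))))"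
    by (intro sum.cong refl) (simp add: fscal_sum dpair_tpure E_mem F_mem g b fscal_fscal)
  also have "\<dots> = (\<Sum>i\<in>I. fscal (g (F i)) (?m (E i) b))"
    using lin_expand_A[OF lb[OF E_mem] b] by (intro sum.cong refl) simp
  also have "\<dots> = ?m g b"
    using lin_expand_H[OF lg[OF b] g] by simp
  finally show ?thesis .
qed

end

section \<open>Crossed modules as modules over the double\<close>

locale crossed_module_bases = dual_pair A H I E F
  for A :: "('k::field, 'a::ab_group_add) hopf"
    and H :: "('k, 'a \<Rightarrow> 'k) hopf"
    and I :: "'i set" and E :: "'i \<Rightarrow> 'a \<Rightarrow> 'k" and F :: "'i \<Rightarrow> 'a" +
  fixes W :: "('k, 'a \<Rightarrow> 'k, 'w::ab_group_add) crossed"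
    and J :: "'j set" and e :: "'j \<Rightarrow> 'w" and f :: "'j \<Rightarrow> 'w \<Rightarrow> 'k"
  assumes crossed: "crossed_module H W" and basis_e: "basis W J e" and dual_f: "dual_basis W J e f"
begin

lemma vec_space_W: "vec_space W" and bilin_act: "bilin H W W (act W)"
  and act_unity: "w \<in> carr W \<Longrightarrow> act W (unity H) w = w"
  and lin_coact: "lin W (tensor H W) (coact W)"
  using crossed by (auto simp: crossed_module_def left_module_def left_comodule_def)

lemma act_mem: "h \<in> carr H \<Longrightarrow> w \<in> carr W \<Longrightarrow> act W h w \<in> carr W"
  by (rule bilinD(3)[OF bilin_act])

lemma coact_mem: "w \<in> carr W \<Longrightarrow> coact W w \<in> carr (tensor H W)"
  using lin_coact by (rule linD)

lemma sweW_cong: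
  "w \<in> carr W \<Longrightarrow> (\<And>u v. u \<in> carr H \<Longrightarrow> v \<in> carr W \<Longrightarrow> p u v = q u v) \<Longrightarrow> sweW H W w p = sweW H W w q"
  unfolding sweW_def by (rule tlift_cong[OF vec_space_H coact_mem])

lemma sweW_mem:
  "w \<in> carr W \<Longrightarrow> vec_space U \<Longrightarrow> (\<And>u v. u \<in> carr H \<Longrightarrow> v \<in> carr W \<Longrightarrow> p u v \<in> carr U) \<Longrightarrow>
    sweW H W w p \<in> carr U"
  unfolding sweW_def by (rule tlift_mem[OF vec_space_H _ coact_mem])

lemma lin_sweW: "vec_space U \<Longrightarrow> bilin H W U p \<Longrightarrow> lin V W g \<Longrightarrow> lin V U (\<lambda>x. sweW H W (g x) p)"
  unfolding sweW_def by (intro lin_compose[OF lin_tlift[OF vec_space_H]] lin_compose[OF lin_coact])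

lemma lin_sweW_param:
  "w \<in> carr W \<Longrightarrow> vec_space U \<Longrightarrow>
    (\<And>u v. u \<in> carr H \<Longrightarrow> v \<in> carr W \<Longrightarrow> lin V U (\<lambda>y. p y u v)) \<Longrightarrow> lin V U (\<lambda>y. sweW H W w (p y))"
  unfolding sweW_def by (rule lin_tlift_param[OF vec_space_H _ coact_mem])

lemma sweW_apply_lin:
  "w \<in> carr W \<Longrightarrow> vec_space U \<Longrightarrow> lin U Z g \<Longrightarrow>
    (\<And>u v. u \<in> carr H \<Longrightarrow> v \<in> carr W \<Longrightarrow> p u v \<in> carr U) \<Longrightarrow>
    g (sweW H W w p) = sweW H W w (\<lambda>u v. g (p u v))"
  unfolding sweW_def by (rule tlift_apply_lin[OF vec_space_H coact_mem])

lemma sweW_sum: "sweW H W x (\<lambda>p q. \<Sum>i\<in>S. g i p q) = (\<Sum>i\<in>S. sweW H W x (g i))"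
  unfolding sweW_def by (rule tlift_sum)

lemma carr_endo: "\<phi> \<in> carr (endo W) \<longleftrightarrow> lin W W \<phi> \<and> (\<forall>w. w \<notin> carr W \<longrightarrow> \<phi> w = 0)"
  and scal_endo: "scal (endo W) c \<phi> = (\<lambda>w. scal W c (\<phi> w))"
  by (simp_all add: endo_def)

text \<open>
  The values of an endomorphism outside the carrier are fixed to be \<open>0\<close>, so the endomorphisms form a
  subspace of the space of all functions.
\<close>

lemma vec_space_endo: "vec_space (endo W)"
proof -
  interpret W: vector_space "scal W" by (rule vec_spaceD(1)[OF vec_space_W])
  interpret vector_space "scal (endo W)"
    by unfold_locales (auto simp: scal_endo plus_fun_def W.scale_left_distrib W.scale_right_distrib)
  have "subspace (carr (endo W))"
    by (rule subspaceI)
      (auto simp: carr_endo scal_endo lin_def plus_fun_def zero_fun_def W.scale_right_distrib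
        W.scale_left_commute vec_spaceD(2-4)[OF vec_space_W] add_ac)
  then show ?thesis by (simp add: vec_space_def vector_space_axioms)
qed

lemma endo_lin: "\<phi> \<in> carr (endo W) \<Longrightarrow> lin W W \<phi>" by (simp add: carr_endo)

lemma endo_eqI:
  "\<phi> \<in> carr (endo W) \<Longrightarrow> \<psi> \<in> carr (endo W) \<Longrightarrow> (\<And>w. w \<in> carr W \<Longrightarrow> \<phi> w = \<psi> w) \<Longrightarrow> \<phi> = \<psi>"
  by (fastforce simp: carr_endo fun_eq_iff)

lemma lin_eval_endo: "lin (endo W) W (\<lambda>\<phi>. \<phi> w)" if "w \<in> carr W"
  using that by (auto simp: lin_def carr_endo scal_endo plus_fun_def)

lemma lin_into_endo:
  assumes "\<And>x. x \<in> carr V \<Longrightarrow> p x \<in> carr (endo W)" "\<And>w. w \<in> carr W \<Longrightarrow> lin V W (\<lambda>x. p x w)" "vec_space V"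
  shows "lin V (endo W) p"
  unfolding lin_def
proof (intro conjI ballI allI)
  fix x c assume x: "x \<in> carr V"
  show "p x \<in> carr (endo W)" by (rule assms(1)[OF x])
  have "scal (endo W) c (p x) \<in> carr (endo W)" "p (scal V c x) \<in> carr (endo W)"
    using vec_spaceD(4)[OF vec_space_endo] vec_spaceD(4)[OF assms(3)] assms(1) x by blast+
  then show "p (scal V c x) = scal (endo W) c (p x)"
    using linD(3)[OF assms(2) x] by (intro endo_eqI) (auto simp: scal_endo)
  fix y assume y: "y \<in> carr V"
  have "p x + p y \<in> carr (endo W)" "p (x + y) \<in> carr (endo W)"
    using vec_spaceD(3)[OF vec_space_endo] vec_spaceD(3)[OF assms(3)] assms(1) x y by blast+
  then show "p (x + y) = p x + p y"
    using linD(2)[OF assms(2) x y] by (intro endo_eqI) (auto simp: plus_fun_def)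
qed

lemma finite_J: "finite J" and e_mem: "\<alpha> \<in> J \<Longrightarrow> e \<alpha> \<in> carr W"
  using basis_e by (auto simp: basis_def)

lemma f_lin: "\<alpha> \<in> J \<Longrightarrow> lin W ground (f \<alpha>)" and f_e: "\<alpha> \<in> J \<Longrightarrow> \<beta> \<in> J \<Longrightarrow> f \<alpha> (e \<beta>) = (if \<alpha> =
    \<beta> then 1 else 0)"
  and f_outside: "\<alpha> \<in> J \<Longrightarrow> w \<notin> carr W \<Longrightarrow> f \<alpha> w = 0"
  using dual_f by (auto simp: dual_basis_def dual_def)

lemma expand_W: "w \<in> carr W \<Longrightarrow> w = (\<Sum>\<alpha>\<in>J. scal W (f \<alpha> w) (e \<alpha>))"
  by (rule basis_expansion[OF vec_space_W basis_e f_lin f_e])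

definition double_act :: "'a \<Rightarrow> ('a \<Rightarrow> 'k) \<Rightarrow> 'w \<Rightarrow> 'w" where
  "double_act a h w = sweW H W (act W h w) (\<lambda>u v. scal W (u a) v)"

lemma bilin_coeff: "a \<in> carr A \<Longrightarrow> bilin H W W (\<lambda>u v. scal W (u a) v)"
  by (intro bilinI lin_coeff[OF vec_space_W] lin_scal[OF vec_space_W] lin_eval lin_id)

lemma lin_double_act_A: "h \<in> carr H \<Longrightarrow> w \<in> carr W \<Longrightarrow> lin A W (\<lambda>a. double_act a h w)"
  unfolding double_act_def
  by (intro lin_sweW_param[OF _ vec_space_W] act_mem lin_coeff[OF vec_space_W] H_lin)

lemma lin_double_act_H: "a \<in> carr A \<Longrightarrow> w \<in> carr W \<Longrightarrow> lin H W (\<lambda>h. double_act a h w)"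
  unfolding double_act_def
  by (intro lin_sweW[OF vec_space_W] bilin_coeff lin_bilin_left[OF bilin_act] lin_id)

lemma lin_double_act_W: "a \<in> carr A \<Longrightarrow> h \<in> carr H \<Longrightarrow> lin W W (double_act a h)"
  unfolding double_act_def
  by (intro lin_sweW[OF vec_space_W] bilin_coeff lin_bilin_right[OF bilin_act] lin_id)

lemma bilin_double_act: "w \<in> carr W \<Longrightarrow> bilin A H W (\<lambda>a h. double_act a h w)"
  by (intro bilinI lin_double_act_A lin_double_act_H)

lemma rep_eq: "rep A W x = on W (\<lambda>w. tlift A H (\<lambda>a h. double_act a h w) x)"
  by (simp add: rep_def double_act_def[abs_def] H_def[symmetric] Let_def)

lemma rep_apply: "w \<in> carr W \<Longrightarrow> rep A W x w = tlift A H (\<lambda>a h. double_act a h w) x"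
  by (simp add: rep_eq on_def)

lemma on_W_mem: "lin W W \<phi> \<Longrightarrow> on W \<phi> \<in> carr (endo W)"
  by (auto simp: carr_endo on_def lin_cong[OF vec_space_W, of "\<lambda>x. if x \<in> carr W then \<phi> x else 0" \<phi>])

lemma rep_mem: "x \<in> carr D \<Longrightarrow> rep A W x \<in> carr (endo W)"
  unfolding rep_eq
  by (intro on_W_mem lin_tlift_param[OF vec_space_A vec_space_W]) (auto intro: lin_double_act_W)

lemma lin_rep_apply: "w \<in> carr W \<Longrightarrow> lin D W (\<lambda>x. rep A W x w)"
  by (simp add: rep_apply lin_D(1) lin_tlift[OF vec_space_A vec_space_W bilin_double_act])

lemma lin_rep: "lin D (endo W) (rep A W)"
  by (rule lin_into_endo[OF rep_mem lin_rep_apply vec_space_D])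

lemma rep_tpure:
  "a \<in> carr A \<Longrightarrow> h \<in> carr H \<Longrightarrow> w \<in> carr W \<Longrightarrow> rep A W (tpure A H a h) w = double_act a h w"
  by (simp add: rep_apply tlift_tpure[OF vec_space_A vec_space_W bilin_double_act])

text \<open>
  The product of \<open>H\<close> is dual to the coproduct of \<open>A\<close>.
\<close>

lemma mult3_H_apply:
  assumes b: "b \<in> carr A" and m: "p \<in> carr H" "q \<in> carr H" "r \<in> carr H"
  shows "swe3 A b (\<lambda>b1 b2 b3. p b1 * q b2 * r b3) = mult H (mult H p q) r b"
proof -
  have "swe2 A x (\<lambda>b1 b2. p b1 * q b2 * r y) = swe2 A x (\<lambda>b1 b2. p b1 * q b2) * r y" if
      "x \<in> carr A" for x y
    using cA.swe2_apply_lin[OF that vec_space_ground lin_times_left[OF lin_id], of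
        "\<lambda>b1 b2. p b1 * q b2" "r y"] by simp
  then show ?thesis
    unfolding swe3_def mult_H_apply[OF b] using b
    by (intro cA.swe2_cong) (simp_all add: mult_H_apply)
qed

lemma comodule_compatibility:
  "h \<in> carr H \<Longrightarrow> w \<in> carr W \<Longrightarrow>
    swe2 H h (\<lambda>h1 h2. sweW H W (act W h1 w) (\<lambda>u v. tpure H W (mult H u h2) v)) =
    swe2 H h (\<lambda>h1 h2. sweW H W w (\<lambda>u v. tpure H W (mult H h1 u) (act W h2 v)))"
  using crossed by (simp add: crossed_module_def)

lemma swe3_A_scal:
  assumes b: "b \<in> carr A" and v: "v \<in> carr W"
  shows "swe3 A b (\<lambda>b1 b2 b3. scal W (c b1 b2 b3) v) = scal W (swe3 A b c) v"
  by (rule cA.swe3_apply_lin[OF b vec_space_ground lin_coeff[OF vec_space_W lin_id v], symmetric]) simp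

text \<open>
  The product in the double contributes \<open>(S g\<^sub>(\<^sub>1\<^sub>))(b\<^sub>(\<^sub>1\<^sub>))\<close> and \<open>g\<^sub>(\<^sub>3\<^sub>)(b\<^sub>(\<^sub>3\<^sub>))\<close>, and the coaction
  contributes \<open>u (b\<^sub>(\<^sub>2\<^sub>))\<close>.  Together they are the value at \<open>b\<close> of a threefold product in \<open>H\<close>.
\<close>

lemma rep_mult_D_swap:
  assumes g: "g \<in> carr H" and b: "b \<in> carr A" and w: "w \<in> carr W"
  shows "rep A W (mult D (tpure A H (unity A) g) (tpure A H b (unity H))) w =
    swe3 H g (\<lambda>g1 g2 g3. sweW H W (act W g2 w)
      (\<lambda>u v. scal W (mult H (mult H (antipode H g1) u) g3 b) v))"
proof -
  note L = lin_rep_apply[OF w, unfolded lin_D(1)]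
  have "rep A W (mult D (tpure A H (unity A) g) (tpure A H b (unity H))) w = 
    rep A W (double_product (unity A) g b (unity H)) w"
    by (simp add: mult_D_tpure unity_A unity_H g b)
  also have "\<dots> = swe3 A b (\<lambda>b1 b2 b3. swe3 H g (\<lambda>g1 g2 g3. sweW H W (act W g2 w)
      (\<lambda>u v. scal W (antipode H g1 b1 * u b2 * g3 b3) v)))"
    unfolding double_product_def
    apply (subst cA.swe3_apply_lin[OF b vec_space_tensor L])
     apply (intro cH.swe3_mem[OF g vec_space_tensor] fscal_mem tpure_mem mult_A_mem mult_H_mem
         unity_A unity_H; assumption)
    apply (rule cA.swe3_cong[OF b])
    apply (subst cH.swe3_apply_lin[OF g vec_space_tensor L])
     apply (intro fscal_mem tpure_mem mult_A_mem mult_H_mem unity_A unity_H; assumption)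
    apply (rule cH.swe3_cong[OF g])
    subgoal for b1 b2 b3 g1 g2 g3
      using linD(3)[OF L tpure_mem, of b2 g2 "antipode H g1 b1 * g3 b3"]
        sweW_apply_lin[OF act_mem[OF _ w] vec_space_W lin_scal[OF vec_space_W lin_id], of g2
            "\<lambda>u v. scal W (u b2) v" "antipode H g1 b1 * g3 b3"]
        vec_spaceD(4)[OF vec_space_W]
      by (simp add: mult_A_unity mult_H_unity rep_tpure w double_act_def scal_scal[OF vec_space_W]
          mult_ac)
    done
  also have "\<dots> = swe3 H g (\<lambda>g1 g2 g3. sweW H W (act W g2 w)
      (\<lambda>u v. swe3 A b (\<lambda>b1 b2 b3. scal W (antipode H g1 b1 * u b2 * g3 b3) v)))"
    by (simp only: swe3_def[of H] swe2_def[of H] sweW_def swe3_tlift_swap)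
  also have "\<dots> = swe3 H g (\<lambda>g1 g2 g3. sweW H W (act W g2 w)
      (\<lambda>u v. scal W (mult H (mult H (antipode H g1) u) g3 b) v))"
    by (intro cH.swe3_cong[OF g] sweW_cong act_mem w)
      (simp_all add: swe3_A_scal[OF b] mult3_H_apply[OF b] antipode_H_mem)
  finally show ?thesis .
qed

text \<open>
  The compatibility of action and coaction enters here.  By the preceding lemma the coefficient is
  \<open>\<langle>b, (S g\<^sub>(\<^sub>1\<^sub>)) u g\<^sub>(\<^sub>3\<^sub>)\<rangle>\<close> with \<open>u \<otimes> v\<close> the coaction of \<open>g\<^sub>(\<^sub>2\<^sub>) \<triangleright> w\<close>.  The compatibility condition
  rewrites \<open>u g\<^sub>(\<^sub>3\<^sub>) \<otimes> v\<close> as \<open>g\<^sub>(\<^sub>2\<^sub>) u \<otimes> g\<^sub>(\<^sub>3\<^sub>) \<triangleright> v\<close> with \<open>u \<otimes> v\<close> now the coaction of \<open>w\<close>, after which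
  \<open>(S g\<^sub>(\<^sub>1\<^sub>)) g\<^sub>(\<^sub>2\<^sub>)\<close> cancels.
\<close>

lemma rep_slice2_Q:
  assumes g: "g \<in> carr H" and b: "b \<in> carr A" and w: "w \<in> carr W"
  shows "rep A W (slice2 A Q (tpure H A g b)) w = sweW H W w (\<lambda>u v. scal W (u b) (act W g v))"
proof -
  let ?S = "antipode H"
  \<comment> \<open>The compatibility condition is an equation in \<open>H \<otimes> W\<close>; \<open>\<Psi> g1\<close> is the linear map that turns it
    into one between the coefficients at \<open>b\<close>.\<close>
  define \<Psi> where "\<Psi> g1 = tlift H W (\<lambda>u v. scal W (mult H (?S g1) u b) v)" for g1
  have b\<Psi>: "bilin H W W (\<lambda>u v. scal W (mult H (?S g1) u b) v)" if "g1 \<in> carr H" for g1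
    using that by (intro bilinI lin_coeff[OF vec_space_W] lin_scal[OF vec_space_W] lin_compose[OF
        lin_eval]
        lin_intros lin_id antipode_H_mem)
  have L: "lin (tensor H W) W (\<Psi> g1)" if "g1 \<in> carr H" for g1
    unfolding \<Psi>_def by (rule lin_tlift[OF vec_space_H vec_space_W b\<Psi>[OF that]])
  have \<Psi>_tpure: "\<Psi> g1 (tpure H W u v) = scal W (mult H (?S g1) u b) v"
    if "g1 \<in> carr H" "u \<in> carr H" "v \<in> carr W" for g1 u v
    unfolding \<Psi>_def by (rule tlift_tpure[OF vec_space_H vec_space_W b\<Psi>[OF that(1)] that(2,3)])
  have "rep A W (slice2 A Q (tpure H A g b)) w = swe3 H g (\<lambda>g1 g2 g3. sweW H W (act W g2 w)
      (\<lambda>u v. scal W (mult H (mult H (?S g1) u) g3 b) v))"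
    unfolding slice2_Q[OF g b] by (rule rep_mult_D_swap[OF g b w])
  also have "\<dots> = swe2 H g (\<lambda>g1 g23. swe2 H g23 (\<lambda>g2 g3. sweW H W (act W g2 w)
      (\<lambda>u v. scal W (mult H (mult H (?S g1) u) g3 b) v)))"
    unfolding swe3_def
    by (intro swe2_H_coassoc[OF g vec_space_W])
      (intro lin_sweW_param[OF _ vec_space_W] lin_sweW[OF vec_space_W] act_mem w bilinI
        lin_coeff[OF vec_space_W] lin_scal[OF vec_space_W] lin_compose[OF lin_eval] lin_intros
        lin_bilin_left[OF bilin_act] lin_bilin_right[OF bilin_act]
        lin_antipode_H antipode_H_mem mult_H_mem; assumption)+
  also have "\<dots> = swe2 H g (\<lambda>g1 g23. \<Psi> g1 (swe2 H g23 (\<lambda>g2 g3. sweW H W (act W g2 w)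
      (\<lambda>u v. tpure H W (mult H u g3) v))))"
    apply (intro cH.swe2_cong[OF g])
    apply (subst cH.swe2_apply_lin[OF _ vec_space_tensor L], assumption, assumption)
     apply (intro sweW_mem[OF _ vec_space_tensor] act_mem w tpure_mem mult_H_mem; assumption)
    apply (rule cH.swe2_cong, assumption)
    apply (subst sweW_apply_lin[OF act_mem[OF _ w] vec_space_tensor L], assumption, assumption)
     apply (intro tpure_mem mult_H_mem; assumption)
    apply (rule sweW_cong[OF act_mem[OF _ w]], assumption)
    apply (simp add: \<Psi>_tpure mult_H_mem mult_H_assoc antipode_H_mem)
    done
  also have "\<dots> = swe2 H g (\<lambda>g1 g23. \<Psi> g1 (swe2 H g23 (\<lambda>g2 g3. sweW H W w
      (\<lambda>u v. tpure H W (mult H g2 u) (act W g3 v)))))"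
    by (intro cH.swe2_cong[OF g]) (simp add: comodule_compatibility[OF _ w])
  also have "\<dots> = swe2 H g (\<lambda>g1 g23. swe2 H g23 (\<lambda>g2 g3. sweW H W w
      (\<lambda>u v. scal W (mult H (mult H (?S g1) g2) u b) (act W g3 v))))"
    apply (intro cH.swe2_cong[OF g])
    apply (subst cH.swe2_apply_lin[OF _ vec_space_tensor L], assumption, assumption)
     apply (intro sweW_mem[OF _ vec_space_tensor] act_mem w tpure_mem mult_H_mem; assumption)
    apply (rule cH.swe2_cong, assumption)
    apply (subst sweW_apply_lin[OF w vec_space_tensor L], assumption)
     apply (intro tpure_mem mult_H_mem act_mem; assumption)
    apply (rule sweW_cong[OF w])
    apply (simp add: \<Psi>_tpure mult_H_mem act_mem mult_H_assoc antipode_H_mem)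
    done
  also have "\<dots> = swe2 H g (\<lambda>g12 g3. swe2 H g12 (\<lambda>g1 g2. sweW H W w
      (\<lambda>u v. scal W (mult H (mult H (?S g1) g2) u b) (act W g3 v))))"
    by (intro swe2_H_coassoc[OF g vec_space_W, symmetric])
      (intro lin_sweW_param[OF w vec_space_W] act_mem 
        lin_coeff[OF vec_space_W] lin_scal[OF vec_space_W] lin_compose[OF lin_eval] lin_intros
        lin_bilin_left[OF bilin_act] lin_antipode_H antipode_H_mem mult_H_mem; assumption)+
  also have "\<dots> = swe2 H g (\<lambda>g12 g3. scal W (g12 (unity A)) (sweW H W w (\<lambda>u v. scal W (u b)
      (act W g3 v))))"
  proof (intro cH.swe2_cong[OF g])
    fix g12 g3 assume m: "g12 \<in> carr H" "g3 \<in> carr H"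
    have "swe2 H g12 (\<lambda>g1 g2. sweW H W w (\<lambda>u v. scal W (mult H (mult H (?S g1) g2) u b) (act W g3 v))) =
      sweW H W w (\<lambda>u v. swe2 H g12 (\<lambda>g1 g2. scal W (mult H (mult H (?S g1) g2) u b) (act W g3 v)))"
      unfolding swe2_def sweW_def by (rule tlift_swap)
    also have "\<dots> = sweW H W w (\<lambda>u v. scal W (g12 (unity A)) (scal W (u b) (act W g3 v)))"
    proof (rule sweW_cong[OF w])
      fix u v assume uv: "u \<in> carr H" "v \<in> carr W"
      have lu: "lin H H (\<lambda>x. mult H x u)" by (intro lin_intros lin_id uv)
      have "lin H W (\<lambda>x. scal W (mult H x u b) (act W g3 v))"
        by (intro lin_coeff[OF vec_space_W] lin_compose[OF lin_eval] lin_intros act_mem uv m)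
      from cH.swe2_apply_lin[OF m(1) vec_space_H this, of "\<lambda>g1 g2. mult H (?S g1) g2"]
      have "swe2 H g12 (\<lambda>g1 g2. scal W (mult H (mult H (?S g1) g2) u b) (act W g3 v)) =
        scal W (mult H (fscal (g12 (unity A)) (unity H)) u b) (act W g3 v)"
        by (simp add: mult_H_mem antipode_H_mem swe2_H_antipode[OF m(1)])
      also have "\<dots> = scal W (g12 (unity A)) (scal W (u b) (act W g3 v))"
        using linD(3)[OF lu unity_H, of "g12 (unity A)"]
        by (simp add: mult_H_unity uv scal_scal[OF vec_space_W] fscal_def)
      finally show "swe2 H g12 (\<lambda>g1 g2. scal W (mult H (mult H (?S g1) g2) u b) (act W g3 v)) =
        scal W (g12 (unity A)) (scal W (u b) (act W g3 v))" .
    qed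
    also have "\<dots> = scal W (g12 (unity A)) (sweW H W w (\<lambda>u v. scal W (u b) (act W g3 v)))"
      by (intro sweW_apply_lin[OF w vec_space_W lin_scal[OF vec_space_W lin_id], symmetric]
          vec_spaceD(4)[OF vec_space_W] act_mem m)
    finally show "swe2 H g12 (\<lambda>g1 g2. sweW H W w (\<lambda>u v. scal W (mult H (mult H (?S g1) g2) u b)
        (act W g3 v))) =
      scal W (g12 (unity A)) (sweW H W w (\<lambda>u v. scal W (u b) (act W g3 v)))" .
  qed
  also have "\<dots> = sweW H W w (\<lambda>u v. scal W (u b) (act W g v))"
    by (rule swe2_H_counit[OF g vec_space_W])
      (intro lin_sweW_param[OF w vec_space_W] lin_scal[OF vec_space_W] lin_bilin_left[OF
          bilin_act] lin_id)
  finally show ?thesis .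
qed

section \<open>One-forms and the differential\<close>

abbreviation "Om \<equiv> tensor (endo W) C"

lemma form_eq: "form A I E F W = tpure (endo W) C"
  by (simp add: form_def fun_eq_iff)

lemma rank1_mem: "w \<in> carr W \<Longrightarrow> \<beta> \<in> J \<Longrightarrow> rank1 W w (f \<beta>) \<in> carr (endo W)"
  using lin_coeff[OF vec_space_W f_lin]
  by (simp add: carr_endo rank1_def f_outside scal_zero_left[OF vec_space_W])

lemma lin_rank1: "\<beta> \<in> J \<Longrightarrow> lin W (endo W) (\<lambda>w. rank1 W w (f \<beta>))"
  by (rule lin_into_endo[OF rank1_mem _ vec_space_W])
    (simp_all add: rank1_def lin_scal[OF vec_space_W lin_id])

lemma expand_endo:
  assumes \<phi>: "\<phi> \<in> carr (endo W)"
  shows "\<phi> = (\<Sum>\<beta>\<in>J. rank1 W (\<phi> (e \<beta>)) (f \<beta>))"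
proof (rule endo_eqI[OF \<phi>])
  have \<phi>e: "\<phi> (e \<beta>) \<in> carr W" if "\<beta> \<in> J" for \<beta>
    by (rule linD(1)[OF endo_lin[OF \<phi>] e_mem[OF that]])
  show "(\<Sum>\<beta>\<in>J. rank1 W (\<phi> (e \<beta>)) (f \<beta>)) \<in> carr (endo W)"
    by (intro vec_space_sum[OF vec_space_endo] rank1_mem \<phi>e)
  fix w assume w: "w \<in> carr W"
  have "\<phi> w = \<phi> (\<Sum>\<alpha>\<in>J. scal W (f \<alpha> w) (e \<alpha>))" by (rule arg_cong[OF expand_W[OF w]])
  also have "\<dots> = (\<Sum>\<beta>\<in>J. \<phi> (scal W (f \<beta> w) (e \<beta>)))"
    by (rule lin_apply_sum[OF endo_lin[OF \<phi>] vec_space_W]) (rule vec_spaceD(4)[OF vec_space_W e_mem])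
  also have "\<dots> = (\<Sum>\<beta>\<in>J. rank1 W (\<phi> (e \<beta>)) (f \<beta>)) w"
    using linD(3)[OF endo_lin[OF \<phi>] e_mem] by (simp add: sum_fun_apply rank1_def)
  finally show "\<phi> w = (\<Sum>\<beta>\<in>J. rank1 W (\<phi> (e \<beta>)) (f \<beta>)) w" .
qed

text \<open>
  An endomorphism \<open>\<phi>\<close> is \<open>\<Sum>\<^sub>\<beta> \<phi>(e\<^sub>\<beta>) \<otimes> f\<^sup>\<beta>\<close>.
\<close>

lemma form_rep_slice2_Q:
  assumes h: "h \<in> carr H" and b: "b \<in> carr A" and x: "x \<in> carr C"
  shows "form A I E F W (rep A W (slice2 A Q (tpure H A h b))) x =
    (\<Sum>\<beta>\<in>J. sweW H W (e \<beta>) (\<lambda>u v. fscal (u b) (form A I E F W (rank1 W (act W h v) (f \<beta>)) x)))"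
proof -
  let ?\<phi> = "rep A W (slice2 A Q (tpure H A h b))"
  have \<phi>: "?\<phi> \<in> carr (endo W)"
    by (intro rep_mem linD(1)[OF lin_slice2[OF Q_mem]] tpure_C_mem h b)
  have lx: "lin (endo W) Om (\<lambda>\<phi>. tpure (endo W) C \<phi> x)" by (intro lin_tpure_left lin_id x)
  have "tpure (endo W) C ?\<phi> x = tpure (endo W) C (\<Sum>\<beta>\<in>J. rank1 W (?\<phi> (e \<beta>)) (f \<beta>)) x"
    by (rule arg_cong[OF expand_endo[OF \<phi>]])
  also have "\<dots> = (\<Sum>\<beta>\<in>J. tpure (endo W) C (rank1 W (?\<phi> (e \<beta>)) (f \<beta>)) x)"
    by (rule lin_apply_sum[OF lx vec_space_endo]) (intro rank1_mem linD(1)[OF endo_lin[OF \<phi>]] e_mem)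
  also have "\<dots> = (\<Sum>\<beta>\<in>J. sweW H W (e \<beta>) (\<lambda>u v. fscal (u b) (tpure (endo W) C (rank1 W (act W h v)
      (f \<beta>)) x)))"
  proof (rule sum.cong[OF refl])
    fix \<beta> assume \<beta>: "\<beta> \<in> J"
    have l: "lin W Om (\<lambda>w. tpure (endo W) C (rank1 W w (f \<beta>)) x)"
      by (intro lin_tpure_left lin_rank1 \<beta> x)
    show "tpure (endo W) C (rank1 W (?\<phi> (e \<beta>)) (f \<beta>)) x =
      sweW H W (e \<beta>) (\<lambda>u v. fscal (u b) (tpure (endo W) C (rank1 W (act W h v) (f \<beta>)) x))"
      unfolding rep_slice2_Q[OF h b e_mem[OF \<beta>]]
      apply (subst sweW_apply_lin[OF e_mem[OF \<beta>] vec_space_W l])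
       apply (intro vec_spaceD(4)[OF vec_space_W] act_mem h; assumption)
      apply (rule sweW_cong[OF e_mem[OF \<beta>]])
      using linD(3)[OF l act_mem[OF h]] apply simp
      done
  qed
  finally show ?thesis unfolding form_eq .
qed

lemma bilin_form_rep: "T \<in> carr (tensor D D) \<Longrightarrow> bilin C C Om (\<lambda>x y. form A I E F W (rep A W
    (slice2 A T x)) y)"
  unfolding form_eq
  by (intro bilinI lin_tpure_left lin_tpure_right lin_compose[OF lin_rep] lin_slice2 lin_id
      linD(1)[OF lin_compose[OF lin_rep lin_slice2]])

lemma sum_form_Ad_H:
  assumes \<phi>: "\<phi> \<in> carr (endo W)" and u: "u \<in> carr H" and h: "h \<in> carr H"
  shows "(\<Sum>i\<in>I. \<Sum>j\<in>I. fscal (u (mult A (F i) (F j)))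
      (form A I E F W \<phi> (codouble_H A (mult H (mult H (antipode H (E i)) h) (E j))))) =
    form A I E F W \<phi> (codouble_H A (Ad H u h))"
proof -
  have l: "lin H Om (\<lambda>x. tpure (endo W) C \<phi> (codouble_H A x))"
    by (intro lin_tpure_right lin_codouble_H lin_id \<phi>)
  have m: "mult H (mult H (antipode H (E i)) h) (E j) \<in> carr H" if "i \<in> I" "j \<in> I" for i j
    using that by (intro mult_H_mem antipode_H_mem E_mem h)
  show ?thesis
    unfolding form_eq Ad_H_sum[OF u h]
    apply (subst lin_apply_sum2[OF l vec_space_H])
     apply (intro fscal_H_mem m; assumption)
    using linD(3)[OF l m] apply simp
    done
qed

text \<open>
  Lemma \<open>Ad_A_dual\<close>, carried over along the map that sends \<open>x\<close> in \<open>H\<close> to \<open>\<phi> (x \<otimes> b)\<close>.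
\<close>

lemma sum_form_Ad_A:
  assumes \<phi>: "\<phi> \<in> carr (endo W)" and u: "u \<in> carr H" and a: "a \<in> carr A" and b: "b \<in> carr A"
  shows "(\<Sum>i\<in>I. \<Sum>j\<in>I. fscal (u (mult A (mult A (F i) a) (F j)))
      (form A I E F W \<phi> (tpure H A (mult H (antipode H (E i)) (E j)) b))) =
    (\<Sum>i\<in>I. fscal (u (Ad A (F i) a)) (form A I E F W \<phi> (mult C (codouble_H A (E i)) (codouble_A A b))))"
proof -
  have l: "lin H Om (\<lambda>x. tpure (endo W) C \<phi> (tpure H A x b))"
    by (intro lin_tpure_right lin_C(2)[THEN iffD2] lin_tpure_left lin_id \<phi> b)
  have m: "mult H (antipode H (E i)) (E j) \<in> carr H" if "i \<in> I" "j \<in> I" for i j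
    using that by (intro mult_H_mem antipode_H_mem E_mem)
  have "(\<Sum>i\<in>I. \<Sum>j\<in>I. fscal (u (mult A (mult A (F i) a) (F j)))
      (tpure (endo W) C \<phi> (tpure H A (mult H (antipode H (E i)) (E j)) b))) =
    tpure (endo W) C \<phi> (tpure H A (\<Sum>i\<in>I. \<Sum>j\<in>I. fscal (u (mult A (mult A (F i) a) (F j))) (mult H
        (antipode H (E i)) (E j))) b)"
    apply (subst lin_apply_sum2[OF l vec_space_H])
     apply (intro fscal_H_mem m; assumption)
    using linD(3)[OF l m] apply simp
    done
  also have "\<dots> = (\<Sum>i\<in>I. fscal (u (Ad A (F i) a)) (tpure (endo W) C \<phi> (tpure H A (E i) b)))"
    unfolding Ad_A_dual[OF u a]
    apply (subst lin_apply_sum[OF l vec_space_H])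
     apply (intro fscal_H_mem E_mem; assumption)
    using linD(3)[OF l E_mem] apply simp
    done
  also have "\<dots> = (\<Sum>i\<in>I. fscal (u (Ad A (F i) a)) (tpure (endo W) C \<phi> (mult C (codouble_H A (E i))
      (codouble_A A b))))"
    by (intro sum.cong refl) (simp add: codouble_H_A mult_C_tpure E_mem unity_H unity_A b
        mult_H_unity mult_A_unity)
  finally show ?thesis unfolding form_eq .
qed

lemma sum_sweW_swap:
  "(\<Sum>i\<in>I. \<Sum>j\<in>I. \<Sum>\<beta>\<in>J. sweW H W (x \<beta>) (g i j \<beta>)) = (\<Sum>\<beta>\<in>J. sweW H W (x \<beta>)
      (\<lambda>u v. \<Sum>i\<in>I. \<Sum>j\<in>I. g i j \<beta> u v))"
  unfolding sweW_sum
  by (rule trans[OF sum.cong[OF refl sum.swap] sum.swap])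

lemma diff_codouble_H:
  assumes h: "h \<in> carr H"
  shows "diff A I E F W J e f (codouble_H A h) =
    swe2 H h (\<lambda>h1 h2. \<Sum>\<beta>\<in>J. sweW H W (e \<beta>) (\<lambda>u v.
      form A I E F W (rank1 W (act W h2 v) (f \<beta>)) (codouble_H A (Ad H u h1))))
    - form A I E F W (theta W J e f) (codouble_H A h)"
proof -
  have "swe2 C (codouble_H A h) (\<lambda>x1 x2. form A I E F W (rep A W (slice2 A Q x1)) x2) =
    swe2 H h (\<lambda>h1 h2. \<Sum>i\<in>I. \<Sum>j\<in>I. form A I E F W
      (rep A W (slice2 A Q (tpure H A h2 (mult A (F i) (F j)))))
      (codouble_H A (mult H (mult H (antipode H (E i)) h1) (E j))))"
    by (rule swe2_codouble_H[OF vec_space_tensor bilin_form_rep[OF Q_mem] h])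
  also have "\<dots> = swe2 H h (\<lambda>h1 h2. \<Sum>\<beta>\<in>J. sweW H W (e \<beta>) (\<lambda>u v.
      form A I E F W (rank1 W (act W h2 v) (f \<beta>)) (codouble_H A (Ad H u h1))))"
  proof (rule cH.swe2_cong[OF h])
    fix h1 h2 assume m: "h1 \<in> carr H" "h2 \<in> carr H"
    let ?y = "\<lambda>i j. codouble_H A (mult H (mult H (antipode H (E i)) h1) (E j))"
    have "(\<Sum>i\<in>I. \<Sum>j\<in>I. form A I E F W
      (rep A W (slice2 A Q (tpure H A h2 (mult A (F i) (F j))))) (?y i j)) =
      (\<Sum>i\<in>I. \<Sum>j\<in>I. \<Sum>\<beta>\<in>J. sweW H W (e \<beta>) (\<lambda>u v. fscal (u (mult A (F i) (F j)))
        (form A I E F W (rank1 W (act W h2 v) (f \<beta>)) (?y i j))))"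
      by (intro sum.cong refl form_rep_slice2_Q mult_A_mem codouble_H_mem mult_H_mem
          antipode_H_mem E_mem F_mem m)
    also have "\<dots> = (\<Sum>\<beta>\<in>J. sweW H W (e \<beta>) (\<lambda>u v. form A I E F W (rank1 W (act W h2 v) (f \<beta>))
        (codouble_H A (Ad H u h1))))"
      unfolding sum_sweW_swap
      by (intro sum.cong refl sweW_cong sum_form_Ad_H rank1_mem act_mem e_mem m)
    finally show "(\<Sum>i\<in>I. \<Sum>j\<in>I. form A I E F W
      (rep A W (slice2 A Q (tpure H A h2 (mult A (F i) (F j))))) (?y i j)) =
      (\<Sum>\<beta>\<in>J. sweW H W (e \<beta>) (\<lambda>u v. form A I E F W (rank1 W (act W h2 v) (f \<beta>)) (codouble_H A
          (Ad H u h1))))" .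
  qed
  finally show ?thesis unfolding diff_def by simp
qed

lemma diff_codouble_A:
  assumes a: "a \<in> carr A"
  shows "diff A I E F W J e f (codouble_A A a) =
    swe2 A a (\<lambda>a1 a2. \<Sum>i\<in>I. \<Sum>\<beta>\<in>J. sweW H W (e \<beta>) (\<lambda>u v.
      fscal (u (Ad A (F i) a1)) (form A I E F W (rank1 W v (f \<beta>))
        (mult C (codouble_H A (E i)) (codouble_A A a2)))))
    - form A I E F W (theta W J e f) (codouble_A A a)"
proof -
  have "swe2 C (codouble_A A a) (\<lambda>x1 x2. form A I E F W (rep A W (slice2 A Q x1)) x2) =
    swe2 A a (\<lambda>a1 a2. \<Sum>i\<in>I. \<Sum>j\<in>I. form A I E F W
      (rep A W (slice2 A Q (tpure H A (unity H) (mult A (mult A (F i) a1) (F j)))))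
      (tpure H A (mult H (antipode H (E i)) (E j)) a2))"
    by (rule swe2_codouble_A[OF vec_space_tensor bilin_form_rep[OF Q_mem] a])
  also have "\<dots> = swe2 A a (\<lambda>a1 a2. \<Sum>i\<in>I. \<Sum>\<beta>\<in>J. sweW H W (e \<beta>) (\<lambda>u v.
      fscal (u (Ad A (F i) a1)) (form A I E F W (rank1 W v (f \<beta>))
        (mult C (codouble_H A (E i)) (codouble_A A a2)))))"
  proof (rule cA.swe2_cong[OF a])
    fix a1 a2 assume m: "a1 \<in> carr A" "a2 \<in> carr A"
    let ?y = "\<lambda>i j. tpure H A (mult H (antipode H (E i)) (E j)) a2"
    have "(\<Sum>i\<in>I. \<Sum>j\<in>I. form A I E F W
      (rep A W (slice2 A Q (tpure H A (unity H) (mult A (mult A (F i) a1) (F j))))) (?y i j)) =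
      (\<Sum>i\<in>I. \<Sum>j\<in>I. \<Sum>\<beta>\<in>J. sweW H W (e \<beta>) (\<lambda>u v. fscal (u (mult A (mult A (F i) a1) (F j)))
        (form A I E F W (rank1 W (act W (unity H) v) (f \<beta>)) (?y i j))))"
      by (intro sum.cong refl form_rep_slice2_Q mult_A_mem tpure_C_mem mult_H_mem antipode_H_mem
          E_mem F_mem unity_H m)
    also have "\<dots> = (\<Sum>\<beta>\<in>J. sweW H W (e \<beta>) (\<lambda>u v. \<Sum>i\<in>I.
      fscal (u (Ad A (F i) a1)) (form A I E F W (rank1 W v (f \<beta>))
        (mult C (codouble_H A (E i)) (codouble_A A a2)))))"
      unfolding sum_sweW_swap
      by (rule sum.cong[OF refl], rule sweW_cong[OF e_mem], assumption, subst act_unity, assumption,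
          intro sum_form_Ad_A rank1_mem m)
    also have "\<dots> = (\<Sum>i\<in>I. \<Sum>\<beta>\<in>J. sweW H W (e \<beta>) (\<lambda>u v.
      fscal (u (Ad A (F i) a1)) (form A I E F W (rank1 W v (f \<beta>))
        (mult C (codouble_H A (E i)) (codouble_A A a2)))))"
      unfolding sweW_sum by (rule sum.swap)
    finally show "(\<Sum>i\<in>I. \<Sum>j\<in>I. form A I E F W
      (rep A W (slice2 A Q (tpure H A (unity H) (mult A (mult A (F i) a1) (F j))))) (?y i j)) =
      (\<Sum>i\<in>I. \<Sum>\<beta>\<in>J. sweW H W (e \<beta>) (\<lambda>u v.
      fscal (u (Ad A (F i) a1)) (form A I E F W (rank1 W v (f \<beta>))
        (mult C (codouble_H A (E i)) (codouble_A A a2)))))" .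
  qed
  finally show ?thesis unfolding diff_def by simp
qed

section \<open>The left action\<close>

lemma entry_rank1:
  assumes "\<alpha> \<in> J" "\<beta> \<in> J" "\<alpha>' \<in> J" "\<beta>' \<in> J"
  shows "entry e f (rank1 W (e \<alpha>) (f \<beta>)) \<alpha>' \<beta>' = (if \<alpha>' = \<alpha> then 1 else 0) * (if \<beta>' = \<beta> then 1 else 0)"
  using linD(3)[OF f_lin e_mem, of \<alpha>' \<alpha> "f \<beta> (e \<beta>')"] assms
  by (simp add: entry_def rank1_def f_e)

lemma lin_entry: "\<alpha> \<in> J \<Longrightarrow> \<beta> \<in> J \<Longrightarrow> lin V (endo W) g \<Longrightarrow> lin V ground (\<lambda>x. entry e f (g x) \<alpha> \<beta>)"
  unfolding entry_def
  by (rule lin_compose[OF lin_compose[OF f_lin lin_eval_endo[OF e_mem]]])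

lemma right_act_eq: "right_act A I E F W \<omega> x = tlift (endo W) C (\<lambda>\<phi> y. form A I E F W \<phi> (mult C y x)) \<omega>"
  by (simp add: right_act_def Let_def)

lemma right_act_unity: "\<omega> \<in> carr Om \<Longrightarrow> right_act A I E F W \<omega> (unity C) = \<omega>"
proof -
  assume \<omega>: "\<omega> \<in> carr Om"
  have "right_act A I E F W \<omega> (unity C) = tlift (endo W) C (tpure (endo W) C) \<omega>"
    unfolding right_act_eq form_eq by (rule tlift_cong[OF vec_space_endo \<omega>]) (simp add: mult_C_unity)
  then show ?thesis
    using trep_props(2)[OF vec_space_endo \<omega>] by (simp add: tlift_def)
qed

lemma lin_right_act: "\<omega> \<in> carr Om \<Longrightarrow> lin C Om (right_act A I E F W \<omega>)"
  unfolding right_act_eq form_eq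
  by (intro lin_tlift_param[OF vec_space_endo vec_space_tensor] lin_tpure_right lin_bilin_right[OF
      bilin_mult_C] lin_id)

text \<open>
  The left action is extended from the basis by bilinearity, so on \<open>e\<^sub>\<alpha>\<^sup>\<beta> 1\<close> only the term with the same
  indices survives.
\<close>

lemma left_act_form_unity:
  assumes \<alpha>: "\<alpha> \<in> J" and \<beta>: "\<beta> \<in> J"
    and mem: "\<And>\<alpha> \<beta>. \<alpha> \<in> J \<Longrightarrow> \<beta> \<in> J \<Longrightarrow> left_act_basis A I E F W J e f x \<alpha> \<beta> \<in> carr Om"
  shows "left_act A I E F W J e f x (form A I E F W (rank1 W (e \<alpha>) (f \<beta>)) (unity C)) =
    left_act_basis A I E F W J e f x \<alpha> \<beta>"
proof -
  let ?B = "left_act_basis A I E F W J e f x"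
  let ?g = "\<lambda>\<phi> y. \<Sum>\<alpha>\<in>J. \<Sum>\<beta>\<in>J. fscal (entry e f \<phi> \<alpha> \<beta>) (right_act A I E F W (?B \<alpha> \<beta>) y)"
  have g: "bilin (endo W) C Om ?g"
    by (intro bilinI lin_sum[OF vec_space_tensor] lin_fscal lin_fscal_coeff lin_entry lin_id
        lin_right_act
        linD(1)[OF lin_right_act] mem)
  have "left_act A I E F W J e f x (form A I E F W (rank1 W (e \<alpha>) (f \<beta>)) (unity C)) =
      ?g (rank1 W (e \<alpha>) (f \<beta>)) (unity C)"
    unfolding left_act_def form_eq
    by (rule tlift_tpure[OF vec_space_endo vec_space_tensor g rank1_mem[OF e_mem[OF \<alpha>] \<beta>] unity_C_mem])
  also have "\<dots> = (\<Sum>\<alpha>'\<in>J. \<Sum>\<beta>'\<in>J. if \<beta>' = \<beta> then if \<alpha>' = \<alpha> then ?B \<alpha> \<beta> else 0 else 0)"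
    by (intro sum.cong refl)
      (auto simp: entry_rank1 \<alpha> \<beta> right_act_unity mem fscal_1 fscal_def zero_fun_def)
  also have "\<dots> = ?B \<alpha> \<beta>"
    using \<alpha> \<beta> finite_J by (simp add: sum.delta)
  finally show ?thesis .
qed

text \<open>
  On \<open>g \<otimes> b\<close> the first slice acts as \<open>\<epsilon>(b) g\<close> and the second one as \<open>\<epsilon>(g) b\<close>, so the coproduct collapses.
\<close>

lemma swe2_entry_R:
  assumes g: "g \<in> carr H" and b: "b \<in> carr A" and J: "\<alpha> \<in> J" "\<beta> \<in> J" "\<gamma> \<in> J" "\<delta> \<in> J"
  shows "swe2 C (tpure H A g b) (\<lambda>x1 x2.
      entry e f (rep A W (slice1 A R x1)) \<gamma> \<alpha> * entry e f (rep A W (slice2 A R x2)) \<beta> \<delta>) =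
    f \<gamma> (act W g (e \<alpha>)) * sweW H W (e \<delta>) (\<lambda>u v. u b * f \<beta> v)"
proof (rule swe2_codouble_collapse[OF _ _ _ _ _ _ g b])
  have b\<delta>: "bilin H W ground (\<lambda>u v. u b * f \<beta> v)" for b
    by (intro bilinI lin_times_left lin_times_right lin_eval f_lin J)
  show "lin C ground (\<lambda>x. entry e f (rep A W (slice1 A R x)) \<gamma> \<alpha>)"
    "lin C ground (\<lambda>x. entry e f (rep A W (slice2 A R x)) \<beta> \<delta>)"
    by (intro lin_entry J lin_compose[OF lin_rep] lin_slice1 lin_slice2 R_mem)+
  show "lin H ground (\<lambda>g. f \<gamma> (act W g (e \<alpha>)))"
    by (intro lin_compose[OF f_lin[OF J(3)]] lin_bilin_left[OF bilin_act] lin_id e_mem J)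
  show "lin A ground (\<lambda>b. sweW H W (e \<delta>) (\<lambda>u v. u b * f \<beta> v))"
    by (intro lin_sweW_param[OF e_mem[OF J(4)] vec_space_ground] lin_times_left H_lin)
  fix g b assume g: "g \<in> carr H" and b: "b \<in> carr A"
  have one: "sweW H W w (\<lambda>u v. scal W (u (unity A)) v) = w" if "w \<in> carr W" for w
    using crossed that by (simp add: crossed_module_def left_comodule_def)
  have ag: "act W g (e \<alpha>) \<in> carr W" by (intro act_mem g e_mem J)
  have "rep A W (slice1 A R (tpure H A g b)) (e \<alpha>) = scal W (counit A b) (act W g (e \<alpha>))"
    using linD(3)[OF lin_rep_apply[OF e_mem[OF J(1)]] inH_D[OF g], of "counit A b"]
    by (simp add: slice1_R g b rep_tpure unity_A e_mem J double_act_def one ag)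
  then show "entry e f (rep A W (slice1 A R (tpure H A g b))) \<gamma> \<alpha> = counit A b * f \<gamma> (act W g (e \<alpha>))"
    using linD(3)[OF f_lin[OF J(3)] ag] by (simp add: entry_def)
  have s: "sweW H W (e \<delta>) (\<lambda>u v. scal W (u b) v) \<in> carr W"
    by (intro sweW_mem[OF e_mem[OF J(4)] vec_space_W] vec_spaceD(4)[OF vec_space_W])
  have "rep A W (slice2 A R (tpure H A g b)) (e \<delta>) =
      scal W (g (unity A)) (sweW H W (e \<delta>) (\<lambda>u v. scal W (u b) v))"
    using linD(3)[OF lin_rep_apply[OF e_mem[OF J(4)]] inA_D[OF b], of "g (unity A)"]
    by (simp add: slice2_R g b rep_tpure unity_H e_mem J double_act_def act_unity)
  then have "entry e f (rep A W (slice2 A R (tpure H A g b))) \<beta> \<delta> =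
      g (unity A) * f \<beta> (sweW H W (e \<delta>) (\<lambda>u v. scal W (u b) v))"
    using linD(3)[OF f_lin[OF J(2)] s] by (simp add: entry_def)
  also have "f \<beta> (sweW H W (e \<delta>) (\<lambda>u v. scal W (u b) v)) = sweW H W (e \<delta>) (\<lambda>u v. f \<beta> (scal W (u b) v))"
    by (rule sweW_apply_lin[OF e_mem[OF J(4)] vec_space_W f_lin[OF J(2)]])
        (rule vec_spaceD(4)[OF vec_space_W])
  also have "\<dots> = sweW H W (e \<delta>) (\<lambda>u v. u b * f \<beta> v)"
    using linD(3)[OF f_lin[OF J(2)]] by (intro sweW_cong e_mem J) simp
  finally show "entry e f (rep A W (slice2 A R (tpure H A g b))) \<beta> \<delta> =
    g (unity A) * sweW H W (e \<delta>) (\<lambda>u v. u b * f \<beta> v)" .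
qed

text \<open>
  The endomorphism \<open>\<rho>(\<R>\<^sub>1(x\<^sub>(\<^sub>1\<^sub>))) e\<^sub>\<alpha>\<^sup>\<beta> \<rho>(\<R>\<^sub>2(x\<^sub>(\<^sub>2\<^sub>)))\<close> in terms of the basis \<open>e\<close>.  It gathers the first two
  of the three coproduct factors in the left action, which then has the shape of a sum over a single
  coproduct, like the differential.
\<close>

definition left_coeff :: "'j \<Rightarrow> 'j \<Rightarrow> ('k, 'a \<Rightarrow> 'k, 'a) tens \<Rightarrow> ('w \<Rightarrow> 'w)" where
  "left_coeff \<alpha> \<beta> x = (\<Sum>\<gamma>\<in>J. \<Sum>\<delta>\<in>J. scal (endo W) (swe2 C x (\<lambda>x1 x2.
      entry e f (rep A W (slice1 A R x1)) \<gamma> \<alpha> * entry e f (rep A W (slice2 A R x2)) \<beta> \<delta>))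
      (rank1 W (e \<gamma>) (f \<delta>)))"

lemma lin_left_coeff:
  assumes "\<alpha> \<in> J" "\<beta> \<in> J"
  shows "lin C (endo W) (left_coeff \<alpha> \<beta>)"
  unfolding left_coeff_def
  by (intro lin_sum[OF vec_space_endo] lin_coeff[OF vec_space_endo] rank1_mem e_mem cC.lin_swe2[OF
      vec_space_ground]
      bilinI lin_times_left lin_times_right lin_entry lin_compose[OF lin_rep] lin_slice1
          lin_slice2 R_mem lin_id assms)

lemma lin_fscal_form:
  "\<phi> \<in> carr (endo W) \<Longrightarrow> x \<in> carr C \<Longrightarrow> lin ground Om (\<lambda>c. fscal c (tpure (endo W) C \<phi> x))"
  by (intro lin_fscal_coeff lin_id tpure_mem)

lemma left_act_basis_eq:
  assumes x: "x \<in> carr C" and J: "\<alpha> \<in> J" "\<beta> \<in> J"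
  shows "left_act_basis A I E F W J e f x \<alpha> \<beta> = swe2 C x (\<lambda>x1 x2. form A I E F W
      (left_coeff \<alpha> \<beta> x1) x2)"
  unfolding left_act_basis_def Let_def swe3_def
proof (rule cC.swe2_cong[OF x])
  fix y z assume y: "y \<in> carr C" and z: "z \<in> carr C"
  let ?c = "\<lambda>\<gamma> \<delta> x1 x2. entry e f (rep A W (slice1 A R x1)) \<gamma> \<alpha> * entry e f (rep A W
      (slice2 A R x2)) \<beta> \<delta>"
  let ?r = "\<lambda>\<gamma> \<delta>. rank1 W (e \<gamma>) (f \<delta>)"
  have r: "?r \<gamma> \<delta> \<in> carr (endo W)" if "\<gamma> \<in> J" "\<delta> \<in> J" for \<gamma> \<delta>
    using that by (intro rank1_mem e_mem)
  have l: "lin (endo W) Om (\<lambda>\<phi>. tpure (endo W) C \<phi> z)" by (intro lin_tpure_left lin_id z)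
  have "swe2 C y (\<lambda>x1 x2. \<Sum>\<gamma>\<in>J. \<Sum>\<delta>\<in>J. fscal (?c \<gamma> \<delta> x1 x2) (tpure (endo W) C (?r \<gamma> \<delta>) z)) =
    (\<Sum>\<gamma>\<in>J. \<Sum>\<delta>\<in>J. swe2 C y (\<lambda>x1 x2. fscal (?c \<gamma> \<delta> x1 x2) (tpure (endo W) C (?r \<gamma> \<delta>) z)))"
    by (simp only: cC.swe2_sum)
  also have "\<dots> = (\<Sum>\<gamma>\<in>J. \<Sum>\<delta>\<in>J. fscal (swe2 C y (?c \<gamma> \<delta>)) (tpure (endo W) C (?r \<gamma> \<delta>) z))"
    by (intro sum.cong refl cC.swe2_apply_lin[OF y vec_space_ground lin_fscal_form, symmetric] r
        z) simp_all
  also have "\<dots> = (\<Sum>\<gamma>\<in>J. \<Sum>\<delta>\<in>J. tpure (endo W) C (scal (endo W) (swe2 C y (?c \<gamma> \<delta>)) (?r \<gamma> \<delta>)) z)"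
    using linD(3)[OF l r] by simp
  also have "\<dots> = tpure (endo W) C (left_coeff \<alpha> \<beta> y) z"
    unfolding left_coeff_def
    by (rule lin_apply_sum2[OF l vec_space_endo, symmetric]) (intro vec_spaceD(4)[OF vec_space_endo] r)
  finally show "swe2 C y (\<lambda>x1 x2. \<Sum>\<gamma>\<in>J. \<Sum>\<delta>\<in>J. fscal (?c \<gamma> \<delta> x1 x2) (form A I E F W (?r \<gamma> \<delta>) z)) =
    form A I E F W (left_coeff \<alpha> \<beta> y) z"
    unfolding form_eq .
qed

lemma bilin_form_left_coeff:
  "\<alpha> \<in> J \<Longrightarrow> \<beta> \<in> J \<Longrightarrow> bilin C C Om (\<lambda>x y. form A I E F W (left_coeff \<alpha> \<beta> x) y)"
  unfolding form_eq
  by (intro bilinI lin_tpure_left lin_tpure_right lin_left_coeff lin_id linD(1)[OF lin_left_coeff])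

text \<open>
  The matrix entries of the action of \<open>h\<close> recombine to the vector \<open>h \<triangleright> e\<^sub>\<alpha>\<close>.
\<close>

lemma form_left_coeff:
  assumes h: "h \<in> carr H" and b: "b \<in> carr A" and x: "x \<in> carr C" and J: "\<alpha> \<in> J" "\<beta> \<in> J"
  shows "form A I E F W (left_coeff \<alpha> \<beta> (tpure H A h b)) x =
    (\<Sum>\<gamma>\<in>J. sweW H W (e \<gamma>) (\<lambda>u v. fscal (u b * f \<beta> v) (form A I E F W (rank1 W (act W h (e \<alpha>))
        (f \<gamma>)) x)))"
proof -
  have w: "act W h (e \<alpha>) \<in> carr W" by (intro act_mem h e_mem J)
  let ?\<psi> = "\<lambda>\<delta>. sweW H W (e \<delta>) (\<lambda>u v. u b * f \<beta> v)"
  let ?r = "\<lambda>\<delta>. rank1 W (act W h (e \<alpha>)) (f \<delta>)"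
  have lx: "lin (endo W) Om (\<lambda>\<phi>. tpure (endo W) C \<phi> x)" by (intro lin_tpure_left lin_id x)
  have r: "?r \<delta> \<in> carr (endo W)" if "\<delta> \<in> J" for \<delta> by (intro rank1_mem w that)
  have "left_coeff \<alpha> \<beta> (tpure H A h b) =
    (\<Sum>\<gamma>\<in>J. \<Sum>\<delta>\<in>J. scal (endo W) (?\<psi> \<delta>) (scal (endo W) (f \<gamma> (act W h (e \<alpha>))) (rank1 W (e \<gamma>) (f \<delta>))))"
    unfolding left_coeff_def
    by (intro sum.cong refl) (simp add: swe2_entry_R h b J scal_scal[OF vec_space_endo] mult.commute)
  also have "\<dots> = (\<Sum>\<delta>\<in>J. \<Sum>\<gamma>\<in>J. scal (endo W) (?\<psi> \<delta>) (scal (endo W) (f \<gamma> (act W h (e \<alpha>))) (rank1 W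
      (e \<gamma>) (f \<delta>))))"
    by (rule sum.swap)
  also have "\<dots> = (\<Sum>\<delta>\<in>J. scal (endo W) (?\<psi> \<delta>) (?r \<delta>))"
  proof (rule sum.cong[OF refl])
    fix \<delta> assume \<delta>: "\<delta> \<in> J"
    have "?r \<delta> = rank1 W (\<Sum>\<gamma>\<in>J. scal W (f \<gamma> (act W h (e \<alpha>))) (e \<gamma>)) (f \<delta>)"
      by (rule arg_cong[OF expand_W[OF w]])
    also have "\<dots> = (\<Sum>\<gamma>\<in>J. rank1 W (scal W (f \<gamma> (act W h (e \<alpha>))) (e \<gamma>)) (f \<delta>))"
      by (rule lin_apply_sum[OF lin_rank1[OF \<delta>] vec_space_W]) (rule vec_spaceD(4)[OF vec_space_W e_mem])
    also have "\<dots> = (\<Sum>\<gamma>\<in>J. scal (endo W) (f \<gamma> (act W h (e \<alpha>))) (rank1 W (e \<gamma>) (f \<delta>)))"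
      using linD(3)[OF lin_rank1[OF \<delta>] e_mem] by simp
    finally show "(\<Sum>\<gamma>\<in>J. scal (endo W) (?\<psi> \<delta>) (scal (endo W) (f \<gamma> (act W h (e \<alpha>))) (rank1 W (e \<gamma>)
        (f \<delta>)))) =
      scal (endo W) (?\<psi> \<delta>) (?r \<delta>)"
      by (simp only: scal_sum_right[OF vec_space_endo])
  qed
  finally have "tpure (endo W) C (left_coeff \<alpha> \<beta> (tpure H A h b)) x =
      tpure (endo W) C (\<Sum>\<delta>\<in>J. scal (endo W) (?\<psi> \<delta>) (?r \<delta>)) x" by simp
  also have "\<dots> = (\<Sum>\<delta>\<in>J. tpure (endo W) C (scal (endo W) (?\<psi> \<delta>) (?r \<delta>)) x)"
    by (rule lin_apply_sum[OF lx vec_space_endo]) (intro vec_spaceD(4)[OF vec_space_endo] r)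
  also have "\<dots> = (\<Sum>\<delta>\<in>J. fscal (?\<psi> \<delta>) (tpure (endo W) C (?r \<delta>) x))"
    using linD(3)[OF lx r] by simp
  also have "\<dots> = (\<Sum>\<delta>\<in>J. sweW H W (e \<delta>) (\<lambda>u v. fscal (u b * f \<beta> v) (tpure (endo W) C (?r \<delta>) x)))"
    by (intro sum.cong refl sweW_apply_lin[OF e_mem vec_space_ground lin_fscal_form] r x) simp_all
  finally show ?thesis unfolding form_eq .
qed

lemma left_act_codouble_H:
  assumes h: "h \<in> carr H" and J: "\<alpha> \<in> J" "\<beta> \<in> J"
  shows "left_act A I E F W J e f (codouble_H A h) (form A I E F W (rank1 W (e \<alpha>) (f \<beta>)) (unity C)) =
    swe2 H h (\<lambda>h1 h2. \<Sum>\<gamma>\<in>J. sweW H W (e \<gamma>) (\<lambda>u v. fscal (f \<beta> v)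
      (form A I E F W (rank1 W (act W h2 (e \<alpha>)) (f \<gamma>)) (codouble_H A (Ad H u h1)))))"
proof -
  have x: "codouble_H A h \<in> carr C" by (rule codouble_H_mem[OF h])
  have "left_act A I E F W J e f (codouble_H A h) (form A I E F W (rank1 W (e \<alpha>) (f \<beta>)) (unity C)) =
    left_act_basis A I E F W J e f (codouble_H A h) \<alpha> \<beta>"
    by (intro left_act_form_unity J)
      (simp add: left_act_basis_eq[OF x] cC.swe2_mem[OF x vec_space_tensor] bilinD(3)[OF
          bilin_form_left_coeff] del: carr_C)
  also have "\<dots> = swe2 H h (\<lambda>h1 h2. \<Sum>i\<in>I. \<Sum>j\<in>I. form A I E F W
      (left_coeff \<alpha> \<beta> (tpure H A h2 (mult A (F i) (F j))))
      (codouble_H A (mult H (mult H (antipode H (E i)) h1) (E j))))"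
    unfolding left_act_basis_eq[OF x J]
    by (rule swe2_codouble_H[OF vec_space_tensor bilin_form_left_coeff[OF J] h])
  also have "\<dots> = swe2 H h (\<lambda>h1 h2. \<Sum>\<gamma>\<in>J. sweW H W (e \<gamma>) (\<lambda>u v. fscal (f \<beta> v)
      (form A I E F W (rank1 W (act W h2 (e \<alpha>)) (f \<gamma>)) (codouble_H A (Ad H u h1)))))"
  proof (rule cH.swe2_cong[OF h])
    fix h1 h2 assume m: "h1 \<in> carr H" "h2 \<in> carr H"
    let ?y = "\<lambda>i j. codouble_H A (mult H (mult H (antipode H (E i)) h1) (E j))"
    let ?r = "\<lambda>\<gamma>. rank1 W (act W h2 (e \<alpha>)) (f \<gamma>)"
    have r: "?r \<gamma> \<in> carr (endo W)" if "\<gamma> \<in> J" for \<gamma>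
      using that by (intro rank1_mem act_mem m e_mem J)
    have "(\<Sum>i\<in>I. \<Sum>j\<in>I. form A I E F W (left_coeff \<alpha> \<beta> (tpure H A h2 (mult A (F i) (F j)))) (?y i j)) =
      (\<Sum>i\<in>I. \<Sum>j\<in>I. \<Sum>\<gamma>\<in>J. sweW H W (e \<gamma>) (\<lambda>u v. fscal (u (mult A (F i) (F j)) * f \<beta> v)
        (form A I E F W (?r \<gamma>) (?y i j))))"
      by (intro sum.cong refl form_left_coeff mult_A_mem codouble_H_mem mult_H_mem antipode_H_mem
          E_mem F_mem m J)
    also have "\<dots> = (\<Sum>\<gamma>\<in>J. sweW H W (e \<gamma>) (\<lambda>u v. fscal (f \<beta> v) (form A I E F W (?r \<gamma>) (codouble_H A
        (Ad H u h1)))))"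
      unfolding sum_sweW_swap
    proof (intro sum.cong refl sweW_cong e_mem)
      fix \<gamma> u v assume \<gamma>: "\<gamma> \<in> J" and u: "u \<in> carr H"
      show "(\<Sum>i\<in>I. \<Sum>j\<in>I. fscal (u (mult A (F i) (F j)) * f \<beta> v) (form A I E F W (?r \<gamma>) (?y i j))) =
        fscal (f \<beta> v) (form A I E F W (?r \<gamma>) (codouble_H A (Ad H u h1)))"
        unfolding sum_form_Ad_H[OF r[OF \<gamma>] u m(1), symmetric]
        by (simp add: fscal_sum fscal_fscal mult.commute)
    qed
    finally show "(\<Sum>i\<in>I. \<Sum>j\<in>I. form A I E F W (left_coeff \<alpha> \<beta> (tpure H A h2 (mult A (F i) (F j))))
        (?y i j)) =
      (\<Sum>\<gamma>\<in>J. sweW H W (e \<gamma>) (\<lambda>u v. fscal (f \<beta> v) (form A I E F W (?r \<gamma>) (codouble_H A (Ad H u h1)))))" .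
  qed
  finally show ?thesis .
qed

lemma left_act_codouble_A:
  assumes a: "a \<in> carr A" and J: "\<alpha> \<in> J" "\<beta> \<in> J"
  shows "left_act A I E F W J e f (codouble_A A a) (form A I E F W (rank1 W (e \<alpha>) (f \<beta>)) (unity C)) =
    swe2 A a (\<lambda>a1 a2. \<Sum>i\<in>I. \<Sum>\<gamma>\<in>J. sweW H W (e \<gamma>) (\<lambda>u v. fscal (u (Ad A (F i) a1) * f \<beta> v)
      (form A I E F W (rank1 W (e \<alpha>) (f \<gamma>)) (mult C (codouble_H A (E i)) (codouble_A A a2)))))"
proof -
  have x: "codouble_A A a \<in> carr C" unfolding codouble_H_A by (rule tpure_C_mem[OF unity_H a])
  have "left_act A I E F W J e f (codouble_A A a) (form A I E F W (rank1 W (e \<alpha>) (f \<beta>)) (unity C)) =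
    left_act_basis A I E F W J e f (codouble_A A a) \<alpha> \<beta>"
    by (intro left_act_form_unity J)
      (simp add: left_act_basis_eq[OF x] cC.swe2_mem[OF x vec_space_tensor] bilinD(3)[OF
          bilin_form_left_coeff] del: carr_C)
  also have "\<dots> = swe2 A a (\<lambda>a1 a2. \<Sum>i\<in>I. \<Sum>j\<in>I. form A I E F W
      (left_coeff \<alpha> \<beta> (tpure H A (unity H) (mult A (mult A (F i) a1) (F j))))
      (tpure H A (mult H (antipode H (E i)) (E j)) a2))"
    unfolding left_act_basis_eq[OF x J]
    by (rule swe2_codouble_A[OF vec_space_tensor bilin_form_left_coeff[OF J] a])
  also have "\<dots> = swe2 A a (\<lambda>a1 a2. \<Sum>i\<in>I. \<Sum>\<gamma>\<in>J. sweW H W (e \<gamma>) (\<lambda>u v. fscal (u (Ad A (F i) a1) * f \<beta> v)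
      (form A I E F W (rank1 W (e \<alpha>) (f \<gamma>)) (mult C (codouble_H A (E i)) (codouble_A A a2)))))"
  proof (rule cA.swe2_cong[OF a])
    fix a1 a2 assume m: "a1 \<in> carr A" "a2 \<in> carr A"
    let ?y = "\<lambda>i j. tpure H A (mult H (antipode H (E i)) (E j)) a2"
    let ?z = "\<lambda>i. mult C (codouble_H A (E i)) (codouble_A A a2)"
    let ?r = "\<lambda>\<gamma>. rank1 W (e \<alpha>) (f \<gamma>)"
    have r: "?r \<gamma> \<in> carr (endo W)" if "\<gamma> \<in> J" for \<gamma>
      using that by (intro rank1_mem e_mem J)
    have "(\<Sum>i\<in>I. \<Sum>j\<in>I. form A I E F W
      (left_coeff \<alpha> \<beta> (tpure H A (unity H) (mult A (mult A (F i) a1) (F j)))) (?y i j)) =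
      (\<Sum>i\<in>I. \<Sum>j\<in>I. \<Sum>\<gamma>\<in>J. sweW H W (e \<gamma>) (\<lambda>u v. fscal (u (mult A (mult A (F i) a1) (F j)) * f \<beta> v)
        (form A I E F W (rank1 W (act W (unity H) (e \<alpha>)) (f \<gamma>)) (?y i j))))"
      by (intro sum.cong refl form_left_coeff mult_A_mem tpure_C_mem mult_H_mem antipode_H_mem
          E_mem F_mem unity_H m J)
    also have "\<dots> = (\<Sum>\<gamma>\<in>J. sweW H W (e \<gamma>) (\<lambda>u v. \<Sum>i\<in>I. fscal (u (Ad A (F i) a1) * f \<beta> v)
        (form A I E F W (?r \<gamma>) (?z i))))"
      unfolding sum_sweW_swap act_unity[OF e_mem[OF J(1)]]
    proof (rule sum.cong[OF refl], rule sweW_cong[OF e_mem], assumption)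
      fix \<gamma> u v assume \<gamma>: "\<gamma> \<in> J" and u: "u \<in> carr H"
      have "(\<Sum>i\<in>I. \<Sum>j\<in>I. fscal (u (mult A (mult A (F i) a1) (F j)) * f \<beta> v) (form A I E F W (?r \<gamma>)
          (?y i j))) =
        fscal (f \<beta> v) (\<Sum>i\<in>I. \<Sum>j\<in>I. fscal (u (mult A (mult A (F i) a1) (F j))) (form A I E F W
            (?r \<gamma>) (?y i j)))"
        by (simp add: fscal_sum fscal_fscal mult.commute)
      also have "\<dots> = (\<Sum>i\<in>I. fscal (u (Ad A (F i) a1) * f \<beta> v) (form A I E F W (?r \<gamma>) (?z i)))"
        unfolding sum_form_Ad_A[OF r[OF \<gamma>] u m] by (simp add: fscal_sum fscal_fscal mult.commute)
      finally show "(\<Sum>i\<in>I. \<Sum>j\<in>I. fscal (u (mult A (mult A (F i) a1) (F j)) * f \<beta> v)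
          (form A I E F W (?r \<gamma>) (?y i j))) =
        (\<Sum>i\<in>I. fscal (u (Ad A (F i) a1) * f \<beta> v) (form A I E F W (?r \<gamma>) (?z i)))" .
    qed
    also have "\<dots> = (\<Sum>i\<in>I. \<Sum>\<gamma>\<in>J. sweW H W (e \<gamma>) (\<lambda>u v. fscal (u (Ad A (F i) a1) * f \<beta> v)
        (form A I E F W (?r \<gamma>) (?z i))))"
      unfolding sweW_sum by (rule sum.swap)
    finally show "(\<Sum>i\<in>I. \<Sum>j\<in>I. form A I E F W
      (left_coeff \<alpha> \<beta> (tpure H A (unity H) (mult A (mult A (F i) a1) (F j)))) (?y i j)) =
      (\<Sum>i\<in>I. \<Sum>\<gamma>\<in>J. sweW H W (e \<gamma>) (\<lambda>u v. fscal (u (Ad A (F i) a1) * f \<beta> v) (form A I E F W (?r \<gamma>)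
          (?z i))))" .
  qed
  finally show ?thesis .
qed

end

section \<open>The calculus on the quantum codouble\<close>

theorem proposition6p1:
  fixes A :: "('k::field, 'a::ab_group_add) hopf"
    and H :: "('k, 'a \<Rightarrow> 'k) hopf"
    and W :: "('k, 'a \<Rightarrow> 'k, 'w::ab_group_add) crossed"
    and I :: "'i set" and E :: "'i \<Rightarrow> 'a \<Rightarrow> 'k" and F :: "'i \<Rightarrow> 'a"
    and J :: "'j set" and e :: "'j \<Rightarrow> 'w" and f :: "'j \<Rightarrow> 'w \<Rightarrow> 'k"
  assumes "hopf_algebra A" and "fin_dim A"
    and "H = dual_hopf A"
    and "basis H I E" and "basis A I F"
    and "\<forall>i\<in>I. \<forall>j\<in>I. E i (F j) = (if i = j then 1 else 0)"
    and "crossed_module H W" and "fin_dim W"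
    and "basis W J e" and "dual_basis W J e f"
  shows "(\<forall>h\<in>carr H.
           diff A I E F W J e f (codouble_H A h) =
             swe2 H h (\<lambda>h1 h2. \<Sum>\<beta>\<in>J. sweW H W (e \<beta>) (\<lambda>u v.
               form A I E F W (rank1 W (act W h2 v) (f \<beta>)) (codouble_H A (Ad H u h1))))
             - form A I E F W (theta W J e f) (codouble_H A h)) \<and>
         (\<forall>a\<in>carr A.
           diff A I E F W J e f (codouble_A A a) =
             swe2 A a (\<lambda>a1 a2. \<Sum>i\<in>I. \<Sum>\<beta>\<in>J. sweW H W (e \<beta>) (\<lambda>u v.
               fscal (u (Ad A (F i) a1))
                 (form A I E F W (rank1 W v (f \<beta>))
                   (mult (codouble A I E F) (codouble_H A (E i)) (codouble_A A a2)))))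
             - form A I E F W (theta W J e f) (codouble_A A a)) \<and>
         (\<forall>h\<in>carr H. \<forall>\<alpha>\<in>J. \<forall>\<beta>\<in>J.
           left_act A I E F W J e f (codouble_H A h)
               (form A I E F W (rank1 W (e \<alpha>) (f \<beta>)) (unity (codouble A I E F))) =
             swe2 H h (\<lambda>h1 h2. \<Sum>\<gamma>\<in>J. sweW H W (e \<gamma>) (\<lambda>u v.
               fscal (f \<beta> v)
                 (form A I E F W (rank1 W (act W h2 (e \<alpha>)) (f \<gamma>)) (codouble_H A (Ad H u h1)))))) \<and>
         (\<forall>a\<in>carr A. \<forall>\<alpha>\<in>J. \<forall>\<beta>\<in>J.
           left_act A I E F W J e f (codouble_A A a)
               (form A I E F W (rank1 W (e \<alpha>) (f \<beta>)) (unity (codouble A I E F))) =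
             swe2 A a (\<lambda>a1 a2. \<Sum>i\<in>I. \<Sum>\<gamma>\<in>J. sweW H W (e \<gamma>) (\<lambda>u v.
               fscal (u (Ad A (F i) a1) * f \<beta> v)
                 (form A I E F W (rank1 W (e \<alpha>) (f \<gamma>))
                   (mult (codouble A I E F) (codouble_H A (E i)) (codouble_A A a2))))))"
proof -
  interpret crossed_module_bases A H I E F W J e f
    using assms by unfold_locales (auto simp: basis_def)
  show ?thesis
    using diff_codouble_H diff_codouble_A left_act_codouble_H left_act_codouble_A by blast
qed

end
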